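(* Let $\mathsf{T}$ be a big tensor-triangulated category and let $\mathbb{I}\colon\mathsf{T}^{\mathrm{op}}\to\mathsf{T}$ be the Brown--Comenetz dual functor. Then $(\mathsf{T},\mathsf{T},\mathbb{I})$ is a duality triple.
   Context: A big tensor-triangulated category is a compactly generated triangulated category $\mathsf{T}$ with a compatible closed symmetric monoidal structure (product $\otimes$, unit $\mathbb{1}$, internal hom $F(-,-)$) for which the compact objects coincide with the rigid objects, where $X$ is rigid if the natural map $F(X,\mathbb{1})\otimes Y\to F(X,Y)$ is an isomorphism for all $Y\in\mathsf{T}$. Brown--Comenetz dual: for $X\in\mathsf{T}$, $\mathbb{I}X$ is the object (existing by Brown representability) representing the cohomological functor $\mathrm{Hom}_{\mathbb{Z}}(\mathrm{Hom}_{\mathsf{T}}(\mathbb{1},X\otimes-),\mathbb{Q}/\mathbb{Z})\colon \mathsf{T}^{\mathrm{op}}\to\mathbf{Ab}$. Writing $\mathbb{I}$ also for the object $\mathbb{I}\mathbb{1}$, there is a natural isomorphism $\mathbb{I}X\simeq F(X,\mathbb{I})$. For a compactly generated triangulated category $\mathsf{T}$ with compact objects $\mathsf{T}^{\mathrm{c}}$, $\mathrm{Mod}(\mathsf{T}^{\mathrm{c}})$ is the category of additive functors $(\mathsf{T}^{\mathrm{c}})^{\mathrm{op}}\to\mathbf{Ab}$ and $\mathbf{y}X=\mathrm{Hom}_{\mathsf{T}}(-,X)|_{\mathsf{T}^{\mathrm{c}}}$. A morphism $\alpha\colon X\to Y$ is a pure monomorphism if it sits in a triangle $X\to Y\to Z\to\Sigma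 X$ with $0\to\mathbf{y}X\to\mathbf{y}Y\to\mathbf{y}Z\to0$ exact. An object $X$ is pure injective if $\mathbf{y}X$ is injective. A duality triple $(\mathsf{T},\mathsf{U},Q)$ consists of two compactly generated triangulated categories $\mathsf{T},\mathsf{U}$ and exact functors $Q\colon\mathsf{T}^{\mathrm{op}}\to\mathsf{U}$ and $Q\colon\mathsf{U}^{\mathrm{op}}\to\mathsf{T}$ (both denoted $Q$) such that: (1) $Q(X)$ is pure injective for every $X$ in $\mathsf{T}$ or $\mathsf{U}$; (2) for every $X$ in $\mathsf{T}$ or $\mathsf{U}$ there is a natural map $i_X\colon X\to Q^2(X)$ which is a pure monomorphism; (3) $Q(i_X)\circ i_{Q(X)}$ is the identity for every $X$ in $\mathsf{T}$ or $\mathsf{U}$; (4) $Q(\bigoplus_I X_i)\simeq\prod_I Q(X_i)$ for every set of objects $\{X_i\}_I$ in $\mathsf{T}$ or in $\mathsf{U}$. In $(\mathsf{T},\mathsf{T},\mathbb{I})$ both functors are $\mathbb{I}$. *)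

theory Defs
  imports "HOL-Algebra.Free_Abelian_Groups"
begin

section \<open>Categories and functors\<close>

text \<open>
  Composition is written in the usual order: \<open>g \<cdot> f\<close> is \<open>g\<close> after \<open>f\<close>.  All fields are only
  meaningful on the objects and arrows of the category.
\<close>

record ('o, 'a) category =
  obj :: "'o set"
  arr :: "'a set"
  src :: "'a \<Rightarrow> 'o"
  tgt :: "'a \<Rightarrow> 'o"
  ident :: "'o \<Rightarrow> 'a"
  compose :: "'a \<Rightarrow> 'a \<Rightarrow> 'a"  (infixr \<open>\<cdot>\<index>\<close> 70)

definition Hom :: "('o, 'a, 'm) category_scheme \<Rightarrow> 'o \<Rightarrow> 'o \<Rightarrow> 'a set" where
  "Hom C X Y = {f \<in> arr C. src C f = X \<and> tgt C f = Y}"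

locale category =
  fixes C :: "('o, 'a, 'm) category_scheme" (structure)
  assumes src_obj: "f \<in> arr C \<Longrightarrow> src C f \<in> obj C"
    and tgt_obj: "f \<in> arr C \<Longrightarrow> tgt C f \<in> obj C"
    and ident_hom: "X \<in> obj C \<Longrightarrow> ident C X \<in> Hom C X X"
    and comp_hom: "\<lbrakk>f \<in> Hom C X Y; g \<in> Hom C Y Z\<rbrakk> \<Longrightarrow> g \<cdot> f \<in> Hom C X Z"
    and ident_left: "f \<in> Hom C X Y \<Longrightarrow> ident C Y \<cdot> f = f"
    and ident_right: "f \<in> Hom C X Y \<Longrightarrow> f \<cdot> ident C X = f"
    and comp_assoc: "\<lbrakk>f \<in> Hom C W X; g \<in> Hom C X Y; h \<in> Hom C Y Z\<rbrakk>
      \<Longrightarrow> (h \<cdot> g) \<cdot> f = h \<cdot> (g \<cdot> f)"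

definition isos :: "('o, 'a, 'm) category_scheme \<Rightarrow> 'o \<Rightarrow> 'o \<Rightarrow> 'a set" where
  "isos C X Y = {f \<in> Hom C X Y. \<exists>g \<in> Hom C Y X.
     g \<cdot>\<^bsub>C\<^esub> f = ident C X \<and> f \<cdot>\<^bsub>C\<^esub> g = ident C Y}"

definition zero_object :: "('o, 'a, 'm) category_scheme \<Rightarrow> 'o \<Rightarrow> bool" where
  "zero_object C Z \<longleftrightarrow> Z \<in> obj C \<and>
     (\<forall>X \<in> obj C. (\<exists>!f. f \<in> Hom C X Z) \<and> (\<exists>!f. f \<in> Hom C Z X))"

definition is_coproduct ::
  "('o, 'a, 'm) category_scheme \<Rightarrow> 'i set \<Rightarrow> ('i \<Rightarrow> 'o) \<Rightarrow> 'o \<Rightarrow> ('i \<Rightarrow> 'a) \<Rightarrow> bool" where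
  "is_coproduct C J X P \<iota> \<longleftrightarrow> P \<in> obj C \<and> (\<forall>j \<in> J. \<iota> j \<in> Hom C (X j) P) \<and>
     (\<forall>Y \<in> obj C. \<forall>f. (\<forall>j \<in> J. f j \<in> Hom C (X j) Y) \<longrightarrow>
        (\<exists>!u. u \<in> Hom C P Y \<and> (\<forall>j \<in> J. u \<cdot>\<^bsub>C\<^esub> \<iota> j = f j)))"

definition is_product ::
  "('o, 'a, 'm) category_scheme \<Rightarrow> 'i set \<Rightarrow> ('i \<Rightarrow> 'o) \<Rightarrow> 'o \<Rightarrow> ('i \<Rightarrow> 'a) \<Rightarrow> bool" where
  "is_product C J X P \<pi> \<longleftrightarrow> P \<in> obj C \<and> (\<forall>j \<in> J. \<pi> j \<in> Hom C P (X j)) \<and>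
     (\<forall>Y \<in> obj C. \<forall>f. (\<forall>j \<in> J. f j \<in> Hom C Y (X j)) \<longrightarrow>
        (\<exists>!u. u \<in> Hom C Y P \<and> (\<forall>j \<in> J. \<pi> j \<cdot>\<^bsub>C\<^esub> u = f j)))"

record ('o, 'a, 'p, 'b) functr =
  fobj :: "'o \<Rightarrow> 'p"
  farr :: "'a \<Rightarrow> 'b"

definition covariant_functor ::
  "('o, 'a, 'm) category_scheme \<Rightarrow> ('p, 'b, 'n) category_scheme
     \<Rightarrow> ('o, 'a, 'p, 'b) functr \<Rightarrow> bool" where
  "covariant_functor C D Q \<longleftrightarrow>
     (\<forall>X \<in> obj C. fobj Q X \<in> obj D \<and> farr Q (ident C X) = ident D (fobj Q X)) \<and>
     (\<forall>X Y. \<forall>f \<in> Hom C X Y. farr Q f \<in> Hom D (fobj Q X) (fobj Q Y)) \<and>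
     (\<forall>X Y Z. \<forall>f \<in> Hom C X Y. \<forall>g \<in> Hom C Y Z.
        farr Q (g \<cdot>\<^bsub>C\<^esub> f) = farr Q g \<cdot>\<^bsub>D\<^esub> farr Q f)"

definition contravariant_functor ::
  "('o, 'a, 'm) category_scheme \<Rightarrow> ('p, 'b, 'n) category_scheme
     \<Rightarrow> ('o, 'a, 'p, 'b) functr \<Rightarrow> bool" where
  "contravariant_functor C D Q \<longleftrightarrow>
     (\<forall>X \<in> obj C. fobj Q X \<in> obj D \<and> farr Q (ident C X) = ident D (fobj Q X)) \<and>
     (\<forall>X Y. \<forall>f \<in> Hom C X Y. farr Q f \<in> Hom D (fobj Q Y) (fobj Q X)) \<and>
     (\<forall>X Y Z. \<forall>f \<in> Hom C X Y. \<forall>g \<in> Hom C Y Z.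
        farr Q (g \<cdot>\<^bsub>C\<^esub> f) = farr Q f \<cdot>\<^bsub>D\<^esub> farr Q g)"

section \<open>Additive categories\<close>

record ('o, 'a) additive_category = "('o, 'a) category" +
  add :: "'a \<Rightarrow> 'a \<Rightarrow> 'a"  (infixl \<open>\<boxplus>\<index>\<close> 65)
  zero_arr :: "'o \<Rightarrow> 'o \<Rightarrow> 'a"

text \<open>As in \<open>HOL-Algebra\<close>, abelian groups are commutative groups in multiplicative notation.\<close>

definition hom_group :: "('o, 'a, 'm) additive_category_scheme \<Rightarrow> 'o \<Rightarrow> 'o \<Rightarrow> 'a monoid" where
  "hom_group C X Y = \<lparr>carrier = Hom C X Y, monoid.mult = add C, one = zero_arr C X Y\<rparr>"

definition neg :: "('o, 'a, 'm) additive_category_scheme \<Rightarrow> 'a \<Rightarrow> 'a" where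
  "neg C f = inv\<^bsub>hom_group C (src C f) (tgt C f)\<^esub> f"

locale additive_category = category C
  for C :: "('o, 'a, 'm) additive_category_scheme" (structure) +
  assumes hom_comm_group: "\<lbrakk>X \<in> obj C; Y \<in> obj C\<rbrakk> \<Longrightarrow> comm_group (hom_group C X Y)"
    and comp_add_right: "\<lbrakk>f \<in> Hom C X Y; f' \<in> Hom C X Y; g \<in> Hom C Y Z\<rbrakk>
      \<Longrightarrow> g \<cdot> (f \<boxplus> f') = (g \<cdot> f) \<boxplus> (g \<cdot> f')"
    and comp_add_left: "\<lbrakk>f \<in> Hom C X Y; g \<in> Hom C Y Z; g' \<in> Hom C Y Z\<rbrakk>
      \<Longrightarrow> (g \<boxplus> g') \<cdot> f = (g \<cdot> f) \<boxplus> (g' \<cdot> f)"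
    and zero_object_exists: "\<exists>Z. zero_object C Z"
    and biproduct_exists: "\<lbrakk>X \<in> obj C; Y \<in> obj C\<rbrakk> \<Longrightarrow>
      \<exists>P \<in> obj C. \<exists>i \<in> Hom C X P. \<exists>j \<in> Hom C Y P. \<exists>p \<in> Hom C P X. \<exists>q \<in> Hom C P Y.
        p \<cdot> i = ident C X \<and> q \<cdot> j = ident C Y \<and> p \<cdot> j = zero_arr C Y X \<and>
        q \<cdot> i = zero_arr C X Y \<and> (i \<cdot> p) \<boxplus> (j \<cdot> q) = ident C P"

definition additive ::
  "('o, 'a, 'm) additive_category_scheme \<Rightarrow> ('p, 'b, 'n) additive_category_scheme
     \<Rightarrow> ('o, 'a, 'p, 'b) functr \<Rightarrow> bool" where
  "additive C D Q \<longleftrightarrow> (\<forall>X Y. \<forall>f \<in> Hom C X Y. \<forall>g \<in> Hom C X Y.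
     farr Q (f \<boxplus>\<^bsub>C\<^esub> g) = farr Q f \<boxplus>\<^bsub>D\<^esub> farr Q g)"

section \<open>Triangulated categories\<close>

text \<open>A triple \<open>(f, g, h)\<close> in \<open>tri\<close> is a distinguished triangle \<open>X \<rightarrow> Y \<rightarrow> Z \<rightarrow> \<Sigma>X\<close>.\<close>

record ('o, 'a) triangulated_category = "('o, 'a) additive_category" +
  shift :: "('o, 'a, 'o, 'a) functr"
  tri :: "('a \<times> 'a \<times> 'a) set"

abbreviation Sh :: "('o, 'a, 'm) triangulated_category_scheme \<Rightarrow> 'o \<Rightarrow> 'o" where
  "Sh C \<equiv> fobj (shift C)"

abbreviation sh :: "('o, 'a, 'm) triangulated_category_scheme \<Rightarrow> 'a \<Rightarrow> 'a" where
  "sh C \<equiv> farr (shift C)"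

definition is_candidate ::
  "('o, 'a, 'm) triangulated_category_scheme \<Rightarrow> 'o \<Rightarrow> 'o \<Rightarrow> 'o \<Rightarrow> 'a \<Rightarrow> 'a \<Rightarrow> 'a \<Rightarrow> bool" where
  "is_candidate C X Y Z f g h \<longleftrightarrow> f \<in> Hom C X Y \<and> g \<in> Hom C Y Z \<and> h \<in> Hom C Z (Sh C X)"

definition is_triangle ::
  "('o, 'a, 'm) triangulated_category_scheme \<Rightarrow> 'o \<Rightarrow> 'o \<Rightarrow> 'o \<Rightarrow> 'a \<Rightarrow> 'a \<Rightarrow> 'a \<Rightarrow> bool" where
  "is_triangle C X Y Z f g h \<longleftrightarrow> is_candidate C X Y Z f g h \<and> (f, g, h) \<in> tri C"

locale triangulated_category = additive_category C
  for C :: "('o, 'a, 'm) triangulated_category_scheme" (structure) +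
  assumes shift_functor: "covariant_functor C C (shift C)"
    and shift_additive: "additive C C (shift C)"
    and shift_fully_faithful: "\<lbrakk>X \<in> obj C; Y \<in> obj C\<rbrakk>
      \<Longrightarrow> bij_betw (sh C) (Hom C X Y) (Hom C (Sh C X) (Sh C Y))"
    and shift_ess_surj: "Y \<in> obj C \<Longrightarrow> \<exists>X \<in> obj C. isos C (Sh C X) Y \<noteq> {}"
    and tri_iso: "\<lbrakk>is_triangle C X Y Z f g h; is_candidate C X' Y' Z' f' g' h';
        u \<in> isos C X X'; v \<in> isos C Y Y'; w \<in> isos C Z Z';
        v \<cdot> f = f' \<cdot> u; w \<cdot> g = g' \<cdot> v; sh C u \<cdot> h = h' \<cdot> w\<rbrakk>
      \<Longrightarrow> is_triangle C X' Y' Z' f' g' h'"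
    and tri_ident: "\<lbrakk>X \<in> obj C; zero_object C Z\<rbrakk>
      \<Longrightarrow> is_triangle C X X Z (ident C X) (zero_arr C X Z) (zero_arr C Z (Sh C X))"
    and tri_complete: "f \<in> Hom C X Y \<Longrightarrow> \<exists>Z g h. is_triangle C X Y Z f g h"
    and tri_rotate: "is_candidate C X Y Z f g h \<Longrightarrow>
      is_triangle C X Y Z f g h \<longleftrightarrow> is_triangle C Y Z (Sh C X) g h (neg C (sh C f))"
    and tri_fill: "\<lbrakk>is_triangle C X Y Z f g h; is_triangle C X' Y' Z' f' g' h';
        u \<in> Hom C X X'; v \<in> Hom C Y Y'; v \<cdot> f = f' \<cdot> u\<rbrakk>
      \<Longrightarrow> \<exists>w \<in> Hom C Z Z'. w \<cdot> g = g' \<cdot> v \<and> sh C u \<cdot> h = h' \<cdot> w"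
    and tri_octahedral: "\<lbrakk>is_triangle C X Y U f a b; is_triangle C Y Z W g c d;
        is_triangle C X Z V (g \<cdot> f) p q\<rbrakk>
      \<Longrightarrow> \<exists>u v. is_triangle C U V W u v (sh C a \<cdot> d) \<and>
            u \<cdot> a = p \<cdot> g \<and> q \<cdot> u = b \<and> v \<cdot> p = c \<and> d \<cdot> v = sh C f \<cdot> q"

definition exact_functor ::
  "('o, 'a, 'm) triangulated_category_scheme \<Rightarrow> ('p, 'b, 'n) triangulated_category_scheme
     \<Rightarrow> ('o, 'a, 'p, 'b) functr \<Rightarrow> bool" where
  "exact_functor C D Q \<longleftrightarrow> covariant_functor C D Q \<and> additive C D Q \<and>
     (\<exists>\<theta>. (\<forall>X \<in> obj C. \<theta> X \<in> isos D (fobj Q (Sh C X)) (Sh D (fobj Q X))) \<and>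
          (\<forall>X Y. \<forall>f \<in> Hom C X Y.
             \<theta> Y \<cdot>\<^bsub>D\<^esub> farr Q (sh C f) = sh D (farr Q f) \<cdot>\<^bsub>D\<^esub> \<theta> X) \<and>
          (\<forall>X Y Z f g h. is_triangle C X Y Z f g h \<longrightarrow>
             is_triangle D (fobj Q X) (fobj Q Y) (fobj Q Z)
               (farr Q f) (farr Q g) (\<theta> X \<cdot>\<^bsub>D\<^esub> farr Q h)))"

text \<open>
  Exact functors \<open>C\<^sup>o\<^sup>p \<rightarrow> D\<close>, where \<open>C\<^sup>o\<^sup>p\<close> has shift \<open>\<Sigma>\<^sup>-\<^sup>1\<close>.  The comparison
  \<open>Q(\<Sigma>\<^sup>-\<^sup>1 X) \<cong> \<Sigma>(Q X)\<close> is recorded at \<open>\<Sigma>X\<close>, as \<open>\<theta>\<^sub>X : Q X \<cong> \<Sigma>(Q(\<Sigma>X))\<close>, to avoid choosing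
  an inverse of \<open>\<Sigma>\<close>.  The sign in the triangulation of \<open>C\<^sup>o\<^sup>p\<close> is immaterial, since \<open>\<theta>\<close> may be
  replaced by \<open>-\<theta>\<close>.
\<close>

definition exact_contravariant_functor ::
  "('o, 'a, 'm) triangulated_category_scheme \<Rightarrow> ('p, 'b, 'n) triangulated_category_scheme
     \<Rightarrow> ('o, 'a, 'p, 'b) functr \<Rightarrow> bool" where
  "exact_contravariant_functor C D Q \<longleftrightarrow> contravariant_functor C D Q \<and> additive C D Q \<and>
     (\<exists>\<theta>. (\<forall>X \<in> obj C. \<theta> X \<in> isos D (fobj Q X) (Sh D (fobj Q (Sh C X)))) \<and>
          (\<forall>X Y. \<forall>f \<in> Hom C X Y.
             \<theta> X \<cdot>\<^bsub>D\<^esub> farr Q f = sh D (farr Q (sh C f)) \<cdot>\<^bsub>D\<^esub> \<theta> Y) \<and>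
          (\<forall>X Y Z f g h. is_triangle C X Y Z f g h \<longrightarrow>
             is_triangle D (fobj Q Z) (fobj Q Y) (fobj Q X)
               (farr Q g) (farr Q f) (sh D (farr Q h) \<cdot>\<^bsub>D\<^esub> \<theta> X)))"

section \<open>Compact generation\<close>

text \<open>
  The type \<open>'i\<close> plays the role of a universe: a \<^emph>\<open>set\<close> in the sense of the size distinction between
  sets and classes is a collection of cardinality smaller than that of \<open>'i\<close>.  Families indexed by
  a set may then be taken to be indexed by a subset of \<open>'i\<close>.
\<close>

definition small :: "'i itself \<Rightarrow> 'b set \<Rightarrow> bool" where
  "small sz A \<longleftrightarrow> (card_of A, card_of (UNIV :: 'i set)) \<in> ordLess"

definition has_coproducts :: "'i itself \<Rightarrow> ('o, 'a, 'm) category_scheme \<Rightarrow> bool" where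
  "has_coproducts sz C \<longleftrightarrow> (\<forall>(J :: 'i set) X. small sz J \<and> (\<forall>j \<in> J. X j \<in> obj C) \<longrightarrow>
     (\<exists>P \<iota>. is_coproduct C J X P \<iota>))"

text \<open>The canonical map from the direct sum of the \<open>Hom(K, X j)\<close> to \<open>Hom(K, P)\<close> is bijective.\<close>

definition compact_object ::
  "'i itself \<Rightarrow> ('o, 'a, 'm) additive_category_scheme \<Rightarrow> 'o \<Rightarrow> bool" where
  "compact_object sz C K \<longleftrightarrow> K \<in> obj C \<and>
     (\<forall>(J :: 'i set) X P \<iota>. small sz J \<and> (\<forall>j \<in> J. X j \<in> obj C) \<and> is_coproduct C J X P \<iota> \<longrightarrow>
        (\<lambda>x. gfinprod (hom_group C K P) (\<lambda>j. \<iota> j \<cdot>\<^bsub>C\<^esub> x j) J)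
          \<in> iso (sum_group J (\<lambda>j. hom_group C K (X j))) (hom_group C K P))"

definition compactly_generated ::
  "'i itself \<Rightarrow> ('o, 'a, 'm) triangulated_category_scheme \<Rightarrow> bool" where
  "compactly_generated sz C \<longleftrightarrow> triangulated_category C \<and>
     (\<forall>X \<in> obj C. \<forall>Y \<in> obj C. small sz (Hom C X Y)) \<and>
     has_coproducts sz C \<and>
     (\<exists>G. small sz G \<and> (\<forall>K \<in> G. compact_object sz C K) \<and>
        (\<forall>X \<in> obj C. (\<forall>K \<in> G. Hom C K X = {zero_arr C K X}) \<longrightarrow> zero_object C X))"

section \<open>Modules over the compact objects, and purity\<close>

text \<open>
  Additive functors from the opposite of the full subcategory of compact objects to abelian groups.
\<close>

record ('o, 'a, 'u) tc_module =
  val :: "'o \<Rightarrow> 'u monoid"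
  act :: "'a \<Rightarrow> 'u \<Rightarrow> 'u"

definition is_tc_module ::
  "'i itself \<Rightarrow> ('o, 'a, 'm) additive_category_scheme \<Rightarrow> ('o, 'a, 'u) tc_module \<Rightarrow> bool" where
  "is_tc_module sz C M \<longleftrightarrow>
     (\<forall>K. compact_object sz C K \<longrightarrow>
        comm_group (val M K) \<and> (\<forall>x \<in> carrier (val M K). act M (ident C K) x = x)) \<and>
     (\<forall>K L. compact_object sz C K \<and> compact_object sz C L \<longrightarrow>
        (\<forall>f \<in> Hom C K L. act M f \<in> hom (val M L) (val M K)) \<and>
        (\<forall>f \<in> Hom C K L. \<forall>g \<in> Hom C K L. \<forall>x \<in> carrier (val M L).
           act M (f \<boxplus>\<^bsub>C\<^esub> g) x = act M f x \<otimes>\<^bsub>val M K\<^esub> act M g x)) \<and>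
     (\<forall>K L N. compact_object sz C K \<and> compact_object sz C L \<and> compact_object sz C N \<longrightarrow>
        (\<forall>f \<in> Hom C K L. \<forall>g \<in> Hom C L N. \<forall>x \<in> carrier (val M N).
           act M (g \<cdot>\<^bsub>C\<^esub> f) x = act M f (act M g x)))"

definition is_tc_module_map ::
  "'i itself \<Rightarrow> ('o, 'a, 'm) additive_category_scheme
     \<Rightarrow> ('o, 'a, 'u) tc_module \<Rightarrow> ('o, 'a, 'v) tc_module \<Rightarrow> ('o \<Rightarrow> 'u \<Rightarrow> 'v) \<Rightarrow> bool" where
  "is_tc_module_map sz C M N \<eta> \<longleftrightarrow>
     (\<forall>K. compact_object sz C K \<longrightarrow> \<eta> K \<in> hom (val M K) (val N K)) \<and>
     (\<forall>K L. compact_object sz C K \<and> compact_object sz C L \<longrightarrow>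
        (\<forall>f \<in> Hom C K L. \<forall>x \<in> carrier (val M L). \<eta> K (act M f x) = act N f (\<eta> L x)))"

text \<open>
  Monomorphisms and exact sequences of modules are computed objectwise.  The modules \<open>M\<close>, \<open>N\<close> in
  the extension property take values in abelian groups carried by an arbitrary type \<open>'u\<close>, with
  no restriction on their size.
\<close>

definition injective_tc_module ::
  "'i itself \<Rightarrow> 'u itself \<Rightarrow> ('o, 'a, 'm) additive_category_scheme
     \<Rightarrow> ('o, 'a, 'v) tc_module \<Rightarrow> bool" where
  "injective_tc_module sz vals C E \<longleftrightarrow> is_tc_module sz C E \<and>
     (\<forall>(M :: ('o, 'a, 'u) tc_module) (N :: ('o, 'a, 'u) tc_module) j \<phi>.
        is_tc_module sz C M \<and> is_tc_module sz C N \<and> is_tc_module_map sz C M N j \<and>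
        (\<forall>K. compact_object sz C K \<longrightarrow> inj_on (j K) (carrier (val M K))) \<and>
        is_tc_module_map sz C M E \<phi> \<longrightarrow>
        (\<exists>\<psi>. is_tc_module_map sz C N E \<psi> \<and>
           (\<forall>K. compact_object sz C K \<longrightarrow>
              (\<forall>x \<in> carrier (val M K). \<psi> K (j K x) = \<phi> K x))))"

definition restricted_yoneda ::
  "('o, 'a, 'm) additive_category_scheme \<Rightarrow> 'o \<Rightarrow> ('o, 'a, 'a) tc_module" where
  "restricted_yoneda C X = \<lparr>val = (\<lambda>K. hom_group C K X), act = (\<lambda>f g. g \<cdot>\<^bsub>C\<^esub> f)\<rparr>"

definition pure_injective ::
  "'i itself \<Rightarrow> 'u itself \<Rightarrow> ('o, 'a, 'm) additive_category_scheme \<Rightarrow> 'o \<Rightarrow> bool" where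
  "pure_injective sz vals C X \<longleftrightarrow> X \<in> obj C \<and>
     injective_tc_module sz vals C (restricted_yoneda C X)"

definition pure_mono ::
  "'i itself \<Rightarrow> ('o, 'a, 'm) triangulated_category_scheme \<Rightarrow> 'o \<Rightarrow> 'o \<Rightarrow> 'a \<Rightarrow> bool" where
  "pure_mono sz C X Y \<alpha> \<longleftrightarrow> (\<exists>Z \<beta> \<gamma>. is_triangle C X Y Z \<alpha> \<beta> \<gamma> \<and>
     (\<forall>K. compact_object sz C K \<longrightarrow>
        inj_on (\<lambda>u. \<alpha> \<cdot>\<^bsub>C\<^esub> u) (Hom C K X) \<and>
        (\<lambda>u. \<alpha> \<cdot>\<^bsub>C\<^esub> u) ` Hom C K X = {v \<in> Hom C K Y. \<beta> \<cdot>\<^bsub>C\<^esub> v = zero_arr C K Z} \<and>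
        (\<lambda>v. \<beta> \<cdot>\<^bsub>C\<^esub> v) ` Hom C K Y = Hom C K Z))"

section \<open>Duality triples\<close>

text \<open>
  Writing \<open>Q : T\<^sup>o\<^sup>p \<rightarrow> U\<close> and \<open>R : U\<^sup>o\<^sup>p \<rightarrow> T\<close> for the two functors, these are the conditions on the
  objects of \<open>T\<close>; the conditions on the objects of \<open>U\<close> are obtained by exchanging the roles.  The
  families \<open>i\<close> and \<open>k\<close> are the natural maps \<open>i\<^sub>X : X \<rightarrow> R(Q X)\<close> and \<open>k\<^sub>Y : Y \<rightarrow> Q(R Y)\<close>.
\<close>

definition half_duality ::
  "'i itself \<Rightarrow> 'u itself \<Rightarrow> ('o, 'a, 'm) triangulated_category_scheme
     \<Rightarrow> ('p, 'b, 'n) triangulated_category_scheme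
     \<Rightarrow> ('o, 'a, 'p, 'b) functr \<Rightarrow> ('p, 'b, 'o, 'a) functr
     \<Rightarrow> ('o \<Rightarrow> 'a) \<Rightarrow> ('p \<Rightarrow> 'b) \<Rightarrow> bool" where
  "half_duality sz vals T U Q R i k \<longleftrightarrow>
     exact_contravariant_functor T U Q \<and>
     (\<forall>X \<in> obj T. pure_injective sz vals U (fobj Q X)) \<and>
     (\<forall>X \<in> obj T. i X \<in> Hom T X (fobj R (fobj Q X))) \<and>
     (\<forall>X Y. \<forall>f \<in> Hom T X Y. farr R (farr Q f) \<cdot>\<^bsub>T\<^esub> i X = i Y \<cdot>\<^bsub>T\<^esub> f) \<and>
     (\<forall>X \<in> obj T. pure_mono sz T X (fobj R (fobj Q X)) (i X)) \<and>
     (\<forall>X \<in> obj T. farr Q (i X) \<cdot>\<^bsub>U\<^esub> k (fobj Q X) = ident U (fobj Q X)) \<and>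
     (\<forall>(J :: 'i set) X P \<iota>. small sz J \<and> (\<forall>j \<in> J. X j \<in> obj T) \<and> is_coproduct T J X P \<iota> \<longrightarrow>
        is_product U J (\<lambda>j. fobj Q (X j)) (fobj Q P) (\<lambda>j. farr Q (\<iota> j)))"

definition duality_triple ::
  "'i itself \<Rightarrow> 'u itself \<Rightarrow> ('o, 'a, 'm) triangulated_category_scheme
     \<Rightarrow> ('p, 'b, 'n) triangulated_category_scheme
     \<Rightarrow> ('o, 'a, 'p, 'b) functr \<Rightarrow> ('p, 'b, 'o, 'a) functr \<Rightarrow> bool" where
  "duality_triple sz vals T U Q R \<longleftrightarrow>
     compactly_generated sz T \<and> compactly_generated sz U \<and>
     (\<exists>i k. half_duality sz vals T U Q R i k \<and> half_duality sz vals U T R Q k i)"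

section \<open>Big tensor-triangulated categories\<close>

text \<open>
  Besides the symmetric monoidal structure, the data consist of the internal hom on objects with
  its evaluation maps \<open>ev X Y : F(X, Y) \<otimes> X \<rightarrow> Y\<close>, and of the comparison maps
  \<open>susp X Y : \<Sigma>X \<otimes> Y \<rightarrow> \<Sigma>(X \<otimes> Y)\<close>.
\<close>

record ('o, 'a) tt_category = "('o, 'a) triangulated_category" +
  tensor :: "'o \<Rightarrow> 'o \<Rightarrow> 'o"  (infixr \<open>\<boxtimes>\<index>\<close> 75)
  tensor_arr :: "'a \<Rightarrow> 'a \<Rightarrow> 'a"  (infixr \<open>\<star>\<index>\<close> 75)
  unit :: "'o"
  assoc :: "'o \<Rightarrow> 'o \<Rightarrow> 'o \<Rightarrow> 'a"
  lunit :: "'o \<Rightarrow> 'a"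
  runit :: "'o \<Rightarrow> 'a"
  swap :: "'o \<Rightarrow> 'o \<Rightarrow> 'a"
  ihom :: "'o \<Rightarrow> 'o \<Rightarrow> 'o"
  ev :: "'o \<Rightarrow> 'o \<Rightarrow> 'a"
  susp :: "'o \<Rightarrow> 'o \<Rightarrow> 'a"

locale symmetric_monoidal = category C
  for C :: "('o, 'a, 'm) tt_category_scheme" (structure) +
  assumes tensor_obj: "\<lbrakk>X \<in> obj C; Y \<in> obj C\<rbrakk> \<Longrightarrow> X \<boxtimes> Y \<in> obj C"
    and unit_obj: "unit C \<in> obj C"
    and tensor_hom: "\<lbrakk>f \<in> Hom C X X'; g \<in> Hom C Y Y'\<rbrakk> \<Longrightarrow> f \<star> g \<in> Hom C (X \<boxtimes> Y) (X' \<boxtimes> Y')"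
    and tensor_ident: "\<lbrakk>X \<in> obj C; Y \<in> obj C\<rbrakk>
      \<Longrightarrow> ident C X \<star> ident C Y = ident C (X \<boxtimes> Y)"
    and tensor_comp: "\<lbrakk>f \<in> Hom C X X'; f' \<in> Hom C X' X''; g \<in> Hom C Y Y'; g' \<in> Hom C Y' Y''\<rbrakk>
      \<Longrightarrow> (f' \<cdot> f) \<star> (g' \<cdot> g) = (f' \<star> g') \<cdot> (f \<star> g)"
    and assoc_iso: "\<lbrakk>X \<in> obj C; Y \<in> obj C; Z \<in> obj C\<rbrakk>
      \<Longrightarrow> assoc C X Y Z \<in> isos C ((X \<boxtimes> Y) \<boxtimes> Z) (X \<boxtimes> (Y \<boxtimes> Z))"
    and lunit_iso: "X \<in> obj C \<Longrightarrow> lunit C X \<in> isos C (unit C \<boxtimes> X) X"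
    and runit_iso: "X \<in> obj C \<Longrightarrow> runit C X \<in> isos C (X \<boxtimes> unit C) X"
    and swap_iso: "\<lbrakk>X \<in> obj C; Y \<in> obj C\<rbrakk> \<Longrightarrow> swap C X Y \<in> isos C (X \<boxtimes> Y) (Y \<boxtimes> X)"
    and assoc_nat: "\<lbrakk>f \<in> Hom C X X'; g \<in> Hom C Y Y'; h \<in> Hom C Z Z'\<rbrakk>
      \<Longrightarrow> assoc C X' Y' Z' \<cdot> ((f \<star> g) \<star> h) = (f \<star> (g \<star> h)) \<cdot> assoc C X Y Z"
    and lunit_nat: "f \<in> Hom C X X' \<Longrightarrow> lunit C X' \<cdot> (ident C (unit C) \<star> f) = f \<cdot> lunit C X"
    and runit_nat: "f \<in> Hom C X X' \<Longrightarrow> runit C X' \<cdot> (f \<star> ident C (unit C)) = f \<cdot> runit C X"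
    and swap_nat: "\<lbrakk>f \<in> Hom C X X'; g \<in> Hom C Y Y'\<rbrakk>
      \<Longrightarrow> swap C X' Y' \<cdot> (f \<star> g) = (g \<star> f) \<cdot> swap C X Y"
    and pentagon: "\<lbrakk>W \<in> obj C; X \<in> obj C; Y \<in> obj C; Z \<in> obj C\<rbrakk> \<Longrightarrow>
      (ident C W \<star> assoc C X Y Z) \<cdot> assoc C W (X \<boxtimes> Y) Z \<cdot> (assoc C W X Y \<star> ident C Z)
        = assoc C W X (Y \<boxtimes> Z) \<cdot> assoc C (W \<boxtimes> X) Y Z"
    and triangle: "\<lbrakk>X \<in> obj C; Y \<in> obj C\<rbrakk> \<Longrightarrow>
      (ident C X \<star> lunit C Y) \<cdot> assoc C X (unit C) Y = runit C X \<star> ident C Y"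
    and hexagon: "\<lbrakk>X \<in> obj C; Y \<in> obj C; Z \<in> obj C\<rbrakk> \<Longrightarrow>
      assoc C Y Z X \<cdot> swap C X (Y \<boxtimes> Z) \<cdot> assoc C X Y Z
        = (ident C Y \<star> swap C X Z) \<cdot> assoc C Y X Z \<cdot> (swap C X Y \<star> ident C Z)"
    and swap_swap: "\<lbrakk>X \<in> obj C; Y \<in> obj C\<rbrakk> \<Longrightarrow> swap C Y X \<cdot> swap C X Y = ident C (X \<boxtimes> Y)"

locale closed_symmetric_monoidal = symmetric_monoidal C
  for C :: "('o, 'a, 'm) tt_category_scheme" (structure) +
  assumes ihom_obj: "\<lbrakk>X \<in> obj C; Y \<in> obj C\<rbrakk> \<Longrightarrow> ihom C X Y \<in> obj C"
    and ev_hom: "\<lbrakk>X \<in> obj C; Y \<in> obj C\<rbrakk> \<Longrightarrow> ev C X Y \<in> Hom C (ihom C X Y \<boxtimes> X) Y"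
    and ev_universal: "\<lbrakk>X \<in> obj C; Y \<in> obj C; Z \<in> obj C; f \<in> Hom C (Z \<boxtimes> X) Y\<rbrakk>
      \<Longrightarrow> \<exists>!g. g \<in> Hom C Z (ihom C X Y) \<and> ev C X Y \<cdot> (g \<star> ident C X) = f"

definition transpose_arr ::
  "('o, 'a, 'm) tt_category_scheme \<Rightarrow> 'o \<Rightarrow> 'o \<Rightarrow> 'o \<Rightarrow> 'a \<Rightarrow> 'a" where
  "transpose_arr C Z X Y f =
     (THE g. g \<in> Hom C Z (ihom C X Y) \<and> ev C X Y \<cdot>\<^bsub>C\<^esub> (g \<star>\<^bsub>C\<^esub> ident C X) = f)"

definition ihom_from :: "('o, 'a, 'm) tt_category_scheme \<Rightarrow> 'o \<Rightarrow> ('o, 'a, 'o, 'a) functr" where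
  "ihom_from C W = \<lparr>fobj = (\<lambda>X. ihom C W X),
     farr = (\<lambda>f. transpose_arr C (ihom C W (src C f)) W (tgt C f) (f \<cdot>\<^bsub>C\<^esub> ev C W (src C f)))\<rparr>"

definition ihom_into :: "('o, 'a, 'm) tt_category_scheme \<Rightarrow> 'o \<Rightarrow> ('o, 'a, 'o, 'a) functr" where
  "ihom_into C W = \<lparr>fobj = (\<lambda>X. ihom C X W),
     farr = (\<lambda>f. transpose_arr C (ihom C (tgt C f) W) (src C f) W
       (ev C (tgt C f) W \<cdot>\<^bsub>C\<^esub> (ident C (ihom C (tgt C f) W) \<star>\<^bsub>C\<^esub> f)))\<rparr>"

text \<open>
  The natural map \<open>F(X, \<one>) \<otimes> Y \<rightarrow> F(X, Y)\<close> is the transpose of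
  \<open>(F(X, \<one>) \<otimes> Y) \<otimes> X \<cong> F(X, \<one>) \<otimes> (X \<otimes> Y) \<cong> (F(X, \<one>) \<otimes> X) \<otimes> Y \<rightarrow> \<one> \<otimes> Y \<cong> Y\<close>;
  the inverse of the associativity isomorphism is characterised rather than chosen.
\<close>

definition assoc_inv :: "('o, 'a, 'm) tt_category_scheme \<Rightarrow> 'o \<Rightarrow> 'o \<Rightarrow> 'o \<Rightarrow> 'a" where
  "assoc_inv C X Y Z =
     (THE g. g \<in> Hom C (X \<boxtimes>\<^bsub>C\<^esub> (Y \<boxtimes>\<^bsub>C\<^esub> Z)) ((X \<boxtimes>\<^bsub>C\<^esub> Y) \<boxtimes>\<^bsub>C\<^esub> Z) \<and>
        g \<cdot>\<^bsub>C\<^esub> assoc C X Y Z = ident C ((X \<boxtimes>\<^bsub>C\<^esub> Y) \<boxtimes>\<^bsub>C\<^esub> Z) \<and>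
        assoc C X Y Z \<cdot>\<^bsub>C\<^esub> g = ident C (X \<boxtimes>\<^bsub>C\<^esub> (Y \<boxtimes>\<^bsub>C\<^esub> Z)))"

definition rigid_map :: "('o, 'a, 'm) tt_category_scheme \<Rightarrow> 'o \<Rightarrow> 'o \<Rightarrow> 'a" where
  "rigid_map C X Y = (let D = ihom C X (unit C) in
     transpose_arr C (D \<boxtimes>\<^bsub>C\<^esub> Y) X Y
       (lunit C Y \<cdot>\<^bsub>C\<^esub> (ev C X (unit C) \<star>\<^bsub>C\<^esub> ident C Y) \<cdot>\<^bsub>C\<^esub> assoc_inv C D X Y \<cdot>\<^bsub>C\<^esub>
        (ident C D \<star>\<^bsub>C\<^esub> swap C Y X) \<cdot>\<^bsub>C\<^esub> assoc C D Y X))"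

definition rigid_object :: "('o, 'a, 'm) tt_category_scheme \<Rightarrow> 'o \<Rightarrow> bool" where
  "rigid_object C X \<longleftrightarrow> X \<in> obj C \<and>
     (\<forall>Y \<in> obj C. rigid_map C X Y \<in> isos C (ihom C X (unit C) \<boxtimes>\<^bsub>C\<^esub> Y) (ihom C X Y))"

text \<open>
  Compatibility of the closed symmetric monoidal structure with the triangulation, following
  Hovey, Palmieri and Strickland: the tensor product commutes coherently with the shift and is
  exact, the internal hom is exact in both variables, and the twist on \<open>\<Sigma>\<one> \<otimes> \<Sigma>\<one>\<close> is \<open>-1\<close>.
  By symmetry it suffices to treat the first variable of the tensor product.
\<close>

locale tt_category = triangulated_category C + closed_symmetric_monoidal C
  for C :: "('o, 'a, 'm) tt_category_scheme" (structure) +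
  assumes tensor_add: "\<lbrakk>f \<in> Hom C X Y; g \<in> Hom C X Y; W \<in> obj C\<rbrakk>
      \<Longrightarrow> (f \<boxplus> g) \<star> ident C W = (f \<star> ident C W) \<boxplus> (g \<star> ident C W)"
    and susp_iso: "\<lbrakk>X \<in> obj C; Y \<in> obj C\<rbrakk>
      \<Longrightarrow> susp C X Y \<in> isos C (Sh C X \<boxtimes> Y) (Sh C (X \<boxtimes> Y))"
    and susp_nat: "\<lbrakk>f \<in> Hom C X X'; g \<in> Hom C Y Y'\<rbrakk>
      \<Longrightarrow> susp C X' Y' \<cdot> (sh C f \<star> g) = sh C (f \<star> g) \<cdot> susp C X Y"
    and susp_unit: "X \<in> obj C \<Longrightarrow> sh C (runit C X) \<cdot> susp C X (unit C) = runit C (Sh C X)"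
    and susp_assoc: "\<lbrakk>X \<in> obj C; Y \<in> obj C; Z \<in> obj C\<rbrakk> \<Longrightarrow>
      sh C (assoc C X Y Z) \<cdot> susp C (X \<boxtimes> Y) Z \<cdot> (susp C X Y \<star> ident C Z)
        = susp C X (Y \<boxtimes> Z) \<cdot> assoc C (Sh C X) Y Z"
    and tensor_exact: "\<lbrakk>is_triangle C X Y Z f g h; W \<in> obj C\<rbrakk> \<Longrightarrow>
      is_triangle C (X \<boxtimes> W) (Y \<boxtimes> W) (Z \<boxtimes> W)
        (f \<star> ident C W) (g \<star> ident C W) (susp C X W \<cdot> (h \<star> ident C W))"
    and ihom_from_exact: "W \<in> obj C \<Longrightarrow> exact_functor C C (ihom_from C W)"
    and ihom_into_exact: "W \<in> obj C \<Longrightarrow> exact_contravariant_functor C C (ihom_into C W)"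
    and twist_sign: "swap C (Sh C (unit C)) (Sh C (unit C))
      = neg C (ident C (Sh C (unit C) \<boxtimes> Sh C (unit C)))"

definition big_tt_category :: "'i itself \<Rightarrow> ('o, 'a, 'm) tt_category_scheme \<Rightarrow> bool" where
  "big_tt_category sz T \<longleftrightarrow> tt_category T \<and> compactly_generated sz T \<and>
     (\<forall>X \<in> obj T. compact_object sz T X \<longleftrightarrow> rigid_object T X)"

section \<open>Brown--Comenetz duality\<close>

definition rat_group :: "rat monoid" where
  "rat_group = \<lparr>carrier = UNIV, monoid.mult = (+), one = 0\<rparr>"

definition QZ :: "rat set monoid" where
  "QZ = rat_group Mod \<int>"

text \<open>
  Elements of \<open>hom A QZ\<close> are functions on the whole type, so equality of homomorphisms is made
  meaningful by restricting to functions that are undefined outside the carrier of \<open>A\<close>.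
\<close>

definition character_group :: "('c, 'n) monoid_scheme \<Rightarrow> ('c \<Rightarrow> rat set) monoid" where
  "character_group A = \<lparr>carrier = hom A QZ \<inter> extensional (carrier A),
     monoid.mult = (\<lambda>\<phi> \<psi>. \<lambda>x\<in>carrier A. \<phi> x \<otimes>\<^bsub>QZ\<^esub> \<psi> x),
     one = (\<lambda>x\<in>carrier A. \<one>\<^bsub>QZ\<^esub>)\<rparr>"

text \<open>
  \<open>r X Y\<close> is the isomorphism of \<open>Hom(Y, \<I>X)\<close> with the group of homomorphisms from
  \<open>Hom(\<one>, X \<otimes> Y)\<close> to \<open>\<rat>/\<int>\<close>.  Naturality in \<open>Y\<close> says that \<open>\<I>X\<close> represents the functor;
  naturality in \<open>X\<close> says that the action of \<open>\<I>\<close> on arrows is the one determined by the Yoneda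
  lemma.
\<close>

definition brown_comenetz_dual ::
  "('o, 'a, 'm) tt_category_scheme \<Rightarrow> ('o, 'a, 'o, 'a) functr \<Rightarrow> bool" where
  "brown_comenetz_dual T I \<longleftrightarrow> contravariant_functor T T I \<and>
     (\<exists>r. (\<forall>X \<in> obj T. \<forall>Y \<in> obj T.
             r X Y \<in> iso (hom_group T Y (fobj I X))
                         (character_group (hom_group T (unit T) (X \<boxtimes>\<^bsub>T\<^esub> Y)))) \<and>
          (\<forall>X \<in> obj T. \<forall>Y Y'. \<forall>k \<in> Hom T Y' Y. \<forall>g \<in> Hom T Y (fobj I X).
             \<forall>u \<in> Hom T (unit T) (X \<boxtimes>\<^bsub>T\<^esub> Y').
               r X Y' (g \<cdot>\<^bsub>T\<^esub> k) u = r X Y g ((ident T X \<star>\<^bsub>T\<^esub> k) \<cdot>\<^bsub>T\<^esub> u)) \<and>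
          (\<forall>Y \<in> obj T. \<forall>X X'. \<forall>f \<in> Hom T X X'. \<forall>g \<in> Hom T Y (fobj I X').
             \<forall>u \<in> Hom T (unit T) (X \<boxtimes>\<^bsub>T\<^esub> Y).
               r X Y (farr I f \<cdot>\<^bsub>T\<^esub> g) u = r X' Y g ((f \<star>\<^bsub>T\<^esub> ident T Y) \<cdot>\<^bsub>T\<^esub> u)))"

end

theory Submission
  imports Defs "HOL-Algebra.Multiplicative_Group"
begin

text \<open>
  By the universal property, \<open>\<I>X\<close> is naturally isomorphic to \<open>F(X, \<I>\<one>)\<close>, hence exact in \<open>X\<close>,
  and the symmetry of the tensor product makes \<open>\<I>\<close> adjoint to itself on the right, with unit
  \<open>i\<^sub>X : X \<rightarrow> \<I>\<^sup>2X\<close> corresponding to the evaluation pairing \<open>Hom(\<one>, X \<otimes> \<I>X) \<rightarrow> \<rat>/\<int>\<close>.  The triangle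
  identity and the compatibility with coproducts are then formal.

  For compact, hence rigid, \<open>K\<close> with dual \<open>D\<close>, a map \<open>v : K \<rightarrow> X\<close> with \<open>i\<^sub>X \<circ> v = 0\<close> yields an
  element of \<open>Hom(\<one>, X \<otimes> D)\<close> killed by all characters, so \<open>v = 0\<close>; this gives purity of \<open>i\<^sub>X\<close>.

  For pure injectivity, Baer's criterion reduces the extension problem to subfunctors of
  \<open>Hom(-, K)\<close>.  There it becomes the extension of a character from a subgroup of
  \<open>Hom(\<one>, X \<otimes> K)\<close>, which is possible since \<open>\<rat>/\<int>\<close> is divisible.
\<close>

section \<open>Divisible groups\<close>

text \<open>Two extension problems follow one pattern: a partial map is kept as its graph, Zorn's
  lemma gives a maximal graph, and one missing element can always be adjoined. For groups the
  missing value comes from divisibility (\<open>extends_to_hom\<close>), for modules from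
  \<open>baer\<close>, which for \<open>dual X\<close> is again a group extension. All graphs live
  in a fixed type, so the modules may be arbitrarily large.

  The obstacle is that the character prescribed on a subgroup of Hom(1, X tensor K) must be well
  defined. If \<open>f : L -> K\<close> kills an element \<open>h\<close> of Hom(1, X tensor L),
  then \<open>h\<close> comes from the fibre of \<open>f\<close>, and the prescribed map can be
  evaluated there only if the fibre is compact. Hence compact objects are shown, directly from the
  coproduct condition, to be closed under biproducts, desuspension and fibres. Rigidity supplies the
  coevaluation used for purity.

  Exactness cannot be read off from characters, since exact sequences of Hom groups do not single
  out distinguished triangles. It is transported from the internal hom, whose exactness is part of
  the compatibility axioms.\<close>

definition divisible :: "('a, 'm) monoid_scheme \<Rightarrow> bool" where
  "divisible G \<longleftrightarrow> (\<forall>x \<in> carrier G. \<forall>n::nat. n > 0 \<longrightarrow> (\<exists>y \<in> carrier G. y [^]\<^bsub>G\<^esub> n = x))"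

lemma int_pow_DirProd:
  assumes "group G" "group H" "x \<in> carrier G" "y \<in> carrier H"
  shows "(x, y) [^]\<^bsub>G \<times>\<times> H\<^esub> (k::int) = (x [^]\<^bsub>G\<^esub> k, y [^]\<^bsub>H\<^esub> k)"
proof -
  have "fst \<in> hom (G \<times>\<times> H) G" "snd \<in> hom (G \<times>\<times> H) H"
    by (auto simp: hom_def DirProd_def)
  from hom_int_pow[OF this(1), of "(x, y)" k] hom_int_pow[OF this(2), of "(x, y)" k]
  show ?thesis using assms DirProd_group by (auto simp: prod_eq_iff)
qed

lemma DirProd_comm_group:
  assumes "comm_group G" "comm_group H" shows "comm_group (G \<times>\<times> H)"
proof -
  interpret G: comm_group G by fact
  interpret H: comm_group H by fact
  interpret P: group "G \<times>\<times> H" by (intro DirProd_group G.is_group H.is_group)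
  show ?thesis by (rule P.group_comm_groupI) (auto simp: G.m_comm H.m_comm)
qed

lemma chain_Union_subgroup:
  assumes "\<C> \<noteq> {}" "\<And>S. S \<in> \<C> \<Longrightarrow> subgroup S G" "\<And>S S'. \<lbrakk>S \<in> \<C>; S' \<in> \<C>\<rbrakk> \<Longrightarrow> S \<subseteq> S' \<or> S' \<subseteq> S"
  shows "subgroup (\<Union>\<C>) G"
proof
  show "\<Union>\<C> \<subseteq> carrier G" by (rule Union_least) (rule subgroup.subset[OF assms(2)])
  obtain S where S: "S \<in> \<C>" using assms(1) by blast
  show "\<one>\<^bsub>G\<^esub> \<in> \<Union>\<C>" using S subgroup.one_closed[OF assms(2)[OF S]] by (rule UnionI)
  show "inv\<^bsub>G\<^esub> x \<in> \<Union>\<C>" if "x \<in> \<Union>\<C>" for x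
    using that by (auto dest: subgroup.m_inv_closed[OF assms(2)])
  show "x \<otimes>\<^bsub>G\<^esub> y \<in> \<Union>\<C>" if "x \<in> \<Union>\<C>" "y \<in> \<Union>\<C>" for x y
  proof -
    from that obtain S S' where "S \<in> \<C>" "S' \<in> \<C>" "x \<in> S" "y \<in> S'" by blast
    then obtain U where "U \<in> \<C>" "x \<in> U" "y \<in> U" using assms(3)[of S S'] by auto
    then show ?thesis by (auto dest: subgroup.m_closed[OF assms(2)])
  qed
qed

text \<open>
  A partial homomorphism is represented by its graph, a subgroup of the product.
\<close>

locale partial_hom =
  fixes G :: "('a, 'm) monoid_scheme" and D :: "('b, 'n) monoid_scheme" and R :: "('a \<times> 'b) set"
  assumes G: "comm_group G" and D: "comm_group D" and R: "subgroup R (G \<times>\<times> D)"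
    and functional: "(\<one>\<^bsub>G\<^esub>, y) \<in> R \<Longrightarrow> y = \<one>\<^bsub>D\<^esub>"
begin

sublocale G: comm_group G by (rule G)
sublocale D: comm_group D by (rule D)
sublocale P: comm_group "G \<times>\<times> D" by (intro DirProd_comm_group G D)
sublocale R: subgroup R "G \<times>\<times> D" by (rule R)

lemma carr: "(x, y) \<in> R \<Longrightarrow> x \<in> carrier G \<and> y \<in> carrier D"
  using R.subset by auto

lemma mult: "\<lbrakk>(x, y) \<in> R; (x', y') \<in> R\<rbrakk> \<Longrightarrow> (x \<otimes>\<^bsub>G\<^esub> x', y \<otimes>\<^bsub>D\<^esub> y') \<in> R"
  using R.m_closed by fastforce

lemma inverse: "(x, y) \<in> R \<Longrightarrow> (inv\<^bsub>G\<^esub> x, inv\<^bsub>D\<^esub> y) \<in> R"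
  using R.m_inv_closed[of "(x, y)"] carr[of x y] by simp

lemma int_pow: "(x, y) \<in> R \<Longrightarrow> (x [^]\<^bsub>G\<^esub> (k::int), y [^]\<^bsub>D\<^esub> k) \<in> R"
  using P.subgroup_int_pow_closed[OF R, of "(x, y)" k] carr[of x y]
  by (simp add: int_pow_DirProd)

text \<open>Dividing one pair by the other lands over the neutral element, so
  \<open>functional\<close>, which speaks of that single fibre, controls every fibre.\<close>

lemma single_valued: assumes "(x, y) \<in> R" "(x, y') \<in> R" shows "y = y'"
proof -
  have "(x \<otimes>\<^bsub>G\<^esub> inv\<^bsub>G\<^esub> x, y \<otimes>\<^bsub>D\<^esub> inv\<^bsub>D\<^esub> y') \<in> R" by (intro mult inverse assms)
  then have "y \<otimes>\<^bsub>D\<^esub> inv\<^bsub>D\<^esub> y' = \<one>\<^bsub>D\<^esub>" using functional carr assms(1) by simp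
  then show ?thesis using carr[OF assms(1)] carr[OF assms(2)] by (metis D.inv_equality D.inv_inv D.inv_closed)
qed

text \<open>The value \<open>e\<close> to be assigned to \<open>a\<close> has to agree with
  \<open>R\<close> on every power of \<open>a\<close> in the domain. The exponents of these powers
  form a subgroup of the integers; if it has a least positive element \<open>n\<close>, an
  \<open>n\<close>-th root of the value there serves all of them.\<close>

lemma compatible_value:
  assumes a: "a \<in> carrier G" and div: "divisible D"
  obtains e where "e \<in> carrier D" "\<And>(k::int) y. (a [^]\<^bsub>G\<^esub> k, y) \<in> R \<Longrightarrow> y = e [^]\<^bsub>D\<^esub> k"
proof (cases "\<exists>n::nat. n > 0 \<and> a [^]\<^bsub>G\<^esub> n \<in> Domain R")
  case False
  \<comment> \<open>If no positive power of \<open>a\<close> lies in the domain, neither does a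
    negative one, because the domain is closed under inverses. Only the exponent 0 imposes a
    condition, and the neutral element can be chosen as value.\<close>
  have "k = 0" if "(a [^]\<^bsub>G\<^esub> (k::int), y) \<in> R" for k y
  proof (rule ccontr)
    assume "k \<noteq> 0"
    moreover have "a [^]\<^bsub>G\<^esub> nat \<bar>k\<bar> \<in> Domain R"
    proof (cases "k \<ge> 0")
      case True
      then have "a [^]\<^bsub>G\<^esub> nat \<bar>k\<bar> = a [^]\<^bsub>G\<^esub> k" by (simp flip: int_pow_int)
      then show ?thesis using that by (metis DomainI)
    next
      case neg: False
      have "(inv\<^bsub>G\<^esub> (a [^]\<^bsub>G\<^esub> k), inv\<^bsub>D\<^esub> y) \<in> R" using inverse that by blast
      moreover have "inv\<^bsub>G\<^esub> (a [^]\<^bsub>G\<^esub> k) = a [^]\<^bsub>G\<^esub> nat \<bar>k\<bar>"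
        using neg a by (simp flip: int_pow_int G.int_pow_neg)
      ultimately show ?thesis by (metis DomainI)
    qed
    ultimately show False using False by (metis zero_less_abs_iff zero_less_nat_eq)
  qed
  then have "y = \<one>\<^bsub>D\<^esub> [^]\<^bsub>D\<^esub> k" if "(a [^]\<^bsub>G\<^esub> (k::int), y) \<in> R" for k y
    using that functional by fastforce
  with that[of "\<one>\<^bsub>D\<^esub>"] show thesis by simp
next
  case True
  \<comment> \<open>The generator of the group of exponents \<open>k\<close> for which the
    \<open>k\<close>-th power of \<open>a\<close> lies in the domain.\<close>
  define n where "n = (LEAST n::nat. n > 0 \<and> a [^]\<^bsub>G\<^esub> n \<in> Domain R)"
  have n: "n > 0" "a [^]\<^bsub>G\<^esub> n \<in> Domain R" using LeastI_ex[OF True] by (auto simp: n_def)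
  then obtain b where b: "(a [^]\<^bsub>G\<^esub> int n, b) \<in> R" by (auto simp: int_pow_int)
  then obtain e where e: "e \<in> carrier D" "e [^]\<^bsub>D\<^esub> n = b"
    using div n(1) carr unfolding divisible_def by meson
  have "y = e [^]\<^bsub>D\<^esub> k" if y: "(a [^]\<^bsub>G\<^esub> (k::int), y) \<in> R" for k y
  proof -
    \<comment> \<open>The power with exponent \<open>r\<close> also lies in the domain, so
      minimality of \<open>n\<close> forces \<open>r = 0\<close>: every admissible exponent is a
      multiple of \<open>n\<close>.\<close>
    define q r where "q = k div int n" and "r = nat (k mod int n)"
    have k: "k = int n * q + int r" "r < n" using n(1) by (auto simp: q_def r_def nat_less_iff)
    have "(a [^]\<^bsub>G\<^esub> k \<otimes>\<^bsub>G\<^esub> (a [^]\<^bsub>G\<^esub> int n) [^]\<^bsub>G\<^esub> (- q), y \<otimes>\<^bsub>D\<^esub> b [^]\<^bsub>D\<^esub> (- q)) \<in> R"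
      by (intro mult int_pow y b)
    moreover have "a [^]\<^bsub>G\<^esub> k \<otimes>\<^bsub>G\<^esub> (a [^]\<^bsub>G\<^esub> int n) [^]\<^bsub>G\<^esub> (- q) = a [^]\<^bsub>G\<^esub> int r"
      using a by (subst G.int_pow_pow) (auto simp: G.int_pow_mult[symmetric] k(1))
    ultimately have "a [^]\<^bsub>G\<^esub> r \<in> Domain R" by (auto simp: int_pow_int)
    then have "r = 0" using not_less_Least[of r "\<lambda>n. n > 0 \<and> a [^]\<^bsub>G\<^esub> n \<in> Domain R"] k(2) n_def by auto
    then have kn: "k = int n * q" using k by simp
    have "(a [^]\<^bsub>G\<^esub> k, b [^]\<^bsub>D\<^esub> q) \<in> R" using int_pow[OF b, of q] a by (simp add: G.int_pow_pow kn)
    then have "y = b [^]\<^bsub>D\<^esub> q" using single_valued y by blast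
    then show ?thesis using e D.int_pow_pow[OF e(1), of "int n" q] by (simp add: kn int_pow_int)
  qed
  with e that show thesis by blast
qed

text \<open>The new graph is the product of \<open>R\<close> with the cyclic subgroup generated by
  \<open>(a, e)\<close>. It remains functional because a product of some \<open>x\<close> in the
  domain and a power of \<open>a\<close> that is neutral puts this power into the domain of
  \<open>R\<close>, where \<open>compatible_value\<close> has fixed its value.\<close>

lemma extend_by_element:
  assumes a: "a \<in> carrier G" and div: "divisible D"
  obtains R' where "partial_hom G D R'" "R \<subseteq> R'" "a \<in> Domain R'"
proof -
  obtain e where e: "e \<in> carrier D" "\<And>(k::int) y. (a [^]\<^bsub>G\<^esub> k, y) \<in> R \<Longrightarrow> y = e [^]\<^bsub>D\<^esub> k"
    using compatible_value[OF assms] by blast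
  let ?S = "generate (G \<times>\<times> D) {(a, e)}"
  let ?R = "R <#>\<^bsub>G \<times>\<times> D\<^esub> ?S"
  have S: "?S = {(a [^]\<^bsub>G\<^esub> (k::int), e [^]\<^bsub>D\<^esub> k) | k. True}"
    using P.generate_pow[of "(a, e)"] a e(1) by (auto simp: int_pow_DirProd)
  have sub: "subgroup ?R (G \<times>\<times> D)"
    using a e(1) by (intro P.mult_subgroups R P.generate_is_subgroup) auto
  have R': "?R = {(x \<otimes>\<^bsub>G\<^esub> a [^]\<^bsub>G\<^esub> (k::int), y \<otimes>\<^bsub>D\<^esub> e [^]\<^bsub>D\<^esub> k) | x y k. (x, y) \<in> R}"
    unfolding set_mult_def S by (auto; force)
  have ones: "(\<one>\<^bsub>G\<^esub>, \<one>\<^bsub>D\<^esub>) \<in> R" using R.one_closed by simp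
  show thesis
  proof (rule that[of ?R])
    show "R \<subseteq> ?R"
    proof (clarify)
      fix x y assume "(x, y) \<in> R"
      moreover from carr[OF this] have "(x, y) = (x \<otimes>\<^bsub>G\<^esub> a [^]\<^bsub>G\<^esub> (0::int), y \<otimes>\<^bsub>D\<^esub> e [^]\<^bsub>D\<^esub> (0::int))" by simp
      ultimately show "(x, y) \<in> ?R" unfolding R' by blast
    qed
    have "(a, e) = (\<one>\<^bsub>G\<^esub> \<otimes>\<^bsub>G\<^esub> a [^]\<^bsub>G\<^esub> (1::int), \<one>\<^bsub>D\<^esub> \<otimes>\<^bsub>D\<^esub> e [^]\<^bsub>D\<^esub> (1::int))"
      using a e by simp
    then have "(a, e) \<in> ?R" unfolding R' using ones by blast
    then show "a \<in> Domain ?R" by blast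
    show "partial_hom G D ?R"
    proof (unfold partial_hom_def, intro conjI allI impI G D sub)
      fix d assume "(\<one>\<^bsub>G\<^esub>, d) \<in> ?R"
      then obtain x y k where xy: "(x, y) \<in> R" "\<one>\<^bsub>G\<^esub> = x \<otimes>\<^bsub>G\<^esub> a [^]\<^bsub>G\<^esub> (k::int)" "d = y \<otimes>\<^bsub>D\<^esub> e [^]\<^bsub>D\<^esub> k"
        unfolding R' by blast
      have "inv\<^bsub>G\<^esub> x = a [^]\<^bsub>G\<^esub> k"
        using xy(2) carr[OF xy(1)] a by (metis G.inv_equality G.inv_inv G.int_pow_closed)
      then have "inv\<^bsub>D\<^esub> y = e [^]\<^bsub>D\<^esub> k" using e(2) inverse[OF xy(1)] by metis
      then show "d = \<one>\<^bsub>D\<^esub>" using xy(3) carr[OF xy(1)] by (metis D.r_inv)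
    qed
  qed
qed

text \<open>Divisible abelian groups are injective: a maximal graph containing \<open>R\<close> has
  full domain.\<close>

lemma extends_to_hom:
  assumes div: "divisible D"
  obtains \<chi> where "\<chi> \<in> hom G D" "\<And>x y. (x, y) \<in> R \<Longrightarrow> \<chi> x = y"
proof -
  let ?A = "{S. partial_hom G D S \<and> R \<subseteq> S}"
  have "\<exists>M\<in>?A. \<forall>X\<in>?A. M \<subseteq> X \<longrightarrow> X = M"
  proof (rule subset_Zorn_nonempty)
    show "?A \<noteq> {}" using partial_hom_axioms by auto
    fix \<C> assume C: "\<C> \<noteq> {}" "subset.chain ?A \<C>"
    then have sub: "partial_hom G D S" "R \<subseteq> S" if "S \<in> \<C>" for S
      using that by (auto simp: subset.chain_def)
    have "subgroup (\<Union>\<C>) (G \<times>\<times> D)"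
    proof (rule chain_Union_subgroup[OF C(1)])
      show "S \<subseteq> S' \<or> S' \<subseteq> S" if "S \<in> \<C>" "S' \<in> \<C>" for S S'
        using C(2) that subset_chain_def[of ?A \<C>] by simp
    qed (rule partial_hom.R[OF sub(1)])
    moreover have "y = \<one>\<^bsub>D\<^esub>" if "(\<one>\<^bsub>G\<^esub>, y) \<in> \<Union>\<C>" for y
      using that by (auto dest: partial_hom.functional[OF sub(1)])
    ultimately have "partial_hom G D (\<Union>\<C>)" using G D by (simp add: partial_hom_def)
    then show "\<Union>\<C> \<in> ?A" using sub(2) C(1) by auto
  qed
  then obtain M where M: "partial_hom G D M" "R \<subseteq> M"
    and max: "\<And>X. partial_hom G D X \<Longrightarrow> M \<subseteq> X \<Longrightarrow> X = M"
    by (smt (verit) mem_Collect_eq subset_trans)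
  interpret M: partial_hom G D M by (rule M)
  \<comment> \<open>Adjoining \<open>a\<close> to the maximal graph cannot enlarge it, so
    \<open>a\<close> was in its domain already.\<close>
  have tot: "\<exists>y. (a, y) \<in> M" if "a \<in> carrier G" for a
    using M.extend_by_element[OF that div] max by (metis DomainE)
  define \<chi> where "\<chi> a = (THE y. (a, y) \<in> M)" for a
  have val: "\<chi> x = y" if "(x, y) \<in> M" for x y
    unfolding \<chi>_def using that M.single_valued by blast
  show thesis
  proof
    show "\<chi> \<in> hom G D"
    proof (rule homI)
      fix x assume "x \<in> carrier G"
      then show "\<chi> x \<in> carrier D" using tot val M.carr by metis
      fix y assume "y \<in> carrier G"
      with \<open>x \<in> carrier G\<close> show "\<chi> (x \<otimes>\<^bsub>G\<^esub> y) = \<chi> x \<otimes>\<^bsub>D\<^esub> \<chi> y" using tot val M.mult by metis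
    qed
    show "\<And>x y. (x, y) \<in> R \<Longrightarrow> \<chi> x = y" using val M(2) by blast
  qed
qed

end

section \<open>The group of rationals modulo integers and its characters\<close>

lemma carrier_rat_group: "carrier rat_group = UNIV"
  by (simp add: rat_group_def)

lemma comm_group_rat: "comm_group rat_group"
proof (rule comm_groupI)
  fix x assume "x \<in> carrier rat_group"
  have "- x \<in> carrier rat_group" "- x \<otimes>\<^bsub>rat_group\<^esub> x = \<one>\<^bsub>rat_group\<^esub>" by (auto simp: rat_group_def)
  then show "\<exists>y\<in>carrier rat_group. y \<otimes>\<^bsub>rat_group\<^esub> x = \<one>\<^bsub>rat_group\<^esub>" by blast
qed (auto simp: rat_group_def)

lemma rat_group_nat_pow: "x [^]\<^bsub>rat_group\<^esub> (n::nat) = of_nat n * x"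
  by (induction n) (auto simp: rat_group_def nat_pow_def algebra_simps)

lemma rat_group_int_pow: "x [^]\<^bsub>rat_group\<^esub> (k::int) = of_int k * x"
proof -
  interpret group rat_group using comm_group_rat by (simp add: comm_group_def)
  have "inv\<^bsub>rat_group\<^esub> y = - y" for y by (rule inv_equality) (auto simp: rat_group_def)
  then show ?thesis by (auto simp: int_pow_def2 rat_group_nat_pow)
qed

lemma subgroup_Ints: "subgroup \<int> rat_group"
proof -
  interpret group rat_group using comm_group_rat by (simp add: comm_group_def)
  have "inv\<^bsub>rat_group\<^esub> y = - y" for y by (rule inv_equality) (auto simp: rat_group_def)
  then show ?thesis by unfold_locales (auto simp: rat_group_def)
qed

lemma normal_Ints: "\<int> \<lhd> rat_group"
  using comm_group.subgroup_imp_normal[OF comm_group_rat subgroup_Ints] .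

lemma comm_group_QZ: "comm_group QZ"
  unfolding QZ_def by (rule comm_group.abelian_FactGroup[OF comm_group_rat subgroup_Ints])

lemma QZ_class_hom: "(\<lambda>q. \<int> #>\<^bsub>rat_group\<^esub> q) \<in> hom rat_group QZ"
  unfolding QZ_def by (rule normal.r_coset_hom_Mod[OF normal_Ints])

lemma QZ_class_eq_one_iff: "\<int> #>\<^bsub>rat_group\<^esub> q = \<one>\<^bsub>QZ\<^esub> \<longleftrightarrow> q \<in> \<int>"
proof -
  interpret group rat_group using comm_group_rat by (simp add: comm_group_def)
  show ?thesis
    unfolding QZ_def
    using coset_join1[OF _ _ subgroup_Ints, of q] coset_join2[OF _ subgroup_Ints, of q]
    by (auto simp: rat_group_def)
qed

lemma QZ_class_int_pow:
  "(\<int> #>\<^bsub>rat_group\<^esub> q) [^]\<^bsub>QZ\<^esub> (k::int) = \<int> #>\<^bsub>rat_group\<^esub> (of_int k * q)"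
  using hom_int_pow[OF QZ_class_hom, of q k] comm_group_rat comm_group_QZ
  by (simp add: comm_group_def rat_group_int_pow carrier_rat_group)

lemma divisible_QZ: "divisible QZ"
  unfolding divisible_def
proof (intro ballI allI impI)
  fix x n assume "x \<in> carrier QZ" "(n::nat) > 0"
  then obtain q where x: "x = \<int> #>\<^bsub>rat_group\<^esub> q" by (auto simp: QZ_def carrier_FactGroup)
  have "(\<int> #>\<^bsub>rat_group\<^esub> (q / of_nat n)) [^]\<^bsub>QZ\<^esub> n = x"
    using \<open>n > 0\<close> by (simp add: QZ_class_int_pow x flip: int_pow_int)
  moreover have "\<int> #>\<^bsub>rat_group\<^esub> (q / of_nat n) \<in> carrier QZ"
    by (auto simp: QZ_def carrier_FactGroup rat_group_def)
  ultimately show "\<exists>y\<in>carrier QZ. y [^]\<^bsub>QZ\<^esub> n = x" by blast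
qed

text \<open>The target group contains elements of every finite order, so \<open>a\<close> can be
  sent to a nontrivial class on the cyclic subgroup it generates; divisibility extends this to all
  of \<open>G\<close>.\<close>

lemma characters_separate_points:
  assumes "comm_group G" "a \<in> carrier G" "a \<noteq> \<one>\<^bsub>G\<^esub>"
  obtains \<chi> where "\<chi> \<in> hom G QZ" "\<chi> a \<noteq> \<one>\<^bsub>QZ\<^esub>"
proof -
  interpret G: comm_group G by fact
  interpret Q: comm_group QZ by (rule comm_group_QZ)
  \<comment> \<open>\<open>G.ord a\<close> is 0 when \<open>a\<close> has infinite order. Any
    \<open>m > 1\<close> is then admissible; 2 is taken.\<close>
  define m where "m = (if G.ord a = 0 then 2 else G.ord a)"
  define e where "e = \<int> #>\<^bsub>rat_group\<^esub> (1 / of_nat m)"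
  have m1: "m > 1" using G.ord_eq_1[OF assms(2)] assms(3) by (auto simp: m_def)
  have e: "e \<in> carrier QZ" by (auto simp: e_def QZ_def carrier_FactGroup rat_group_def)
  have "(1::rat) / of_nat m \<notin> \<int>"
  proof
    assume "(1::rat) / of_nat m \<in> \<int>"
    then obtain z where "(1::rat) / of_nat m = of_int z" by (auto elim: Ints_cases)
    then have "(1::rat) = of_int (z * int m)" using m1 by (simp add: field_simps)
    then have "z * int m = 1" by linarith
    then show False using m1 by (auto simp: zmult_eq_1_iff)
  qed
  then have e1: "e \<noteq> \<one>\<^bsub>QZ\<^esub>" by (simp add: e_def QZ_class_eq_one_iff)
  \<comment> \<open>This is what makes sending \<open>a\<close> to \<open>e\<close> well defined on
    the cyclic subgroup: every relation satisfied by \<open>a\<close> also holds for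
    \<open>e\<close>.\<close>
  have ek: "e [^]\<^bsub>QZ\<^esub> k = \<one>\<^bsub>QZ\<^esub>" if "a [^]\<^bsub>G\<^esub> (k::int) = \<one>\<^bsub>G\<^esub>" for k
  proof -
    have "int (G.ord a) dvd k" using that G.int_pow_eq_id assms(2) by blast
    then have "int m dvd k" by (auto simp: m_def)
    then obtain z where "k = int m * z" by (auto elim: dvdE)
    then show ?thesis using m1 by (simp add: e_def QZ_class_int_pow QZ_class_eq_one_iff)
  qed
  interpret P: comm_group "G \<times>\<times> QZ" by (intro DirProd_comm_group assms(1) comm_group_QZ)
  let ?S = "generate (G \<times>\<times> QZ) {(a, e)}"
  have S: "?S = {(a [^]\<^bsub>G\<^esub> (k::int), e [^]\<^bsub>QZ\<^esub> k) | k. True}"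
    using P.generate_pow[of "(a, e)"] assms(2) e
    by (auto simp: int_pow_DirProd G.is_group Q.is_group)
  have "partial_hom G QZ ?S"
  proof (unfold partial_hom_def, intro conjI allI impI)
    show "subgroup ?S (G \<times>\<times> QZ)" using e assms(2) by (intro P.generate_is_subgroup) auto
    show "y = \<one>\<^bsub>QZ\<^esub>" if "(\<one>\<^bsub>G\<^esub>, y) \<in> ?S" for y using that ek unfolding S by auto
  qed (fact assms(1) comm_group_QZ)+
  then obtain \<chi> where "\<chi> \<in> hom G QZ" "\<And>x y. (x, y) \<in> ?S \<Longrightarrow> \<chi> x = y"
    using partial_hom.extends_to_hom divisible_QZ by blast
  moreover have "(a, e) \<in> ?S" by (rule generate.incl) simp
  ultimately show thesis using that e1 by metis
qed

lemma character_groupI: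
  assumes "group A" "\<chi> \<in> hom A QZ"
  shows "restrict \<chi> (carrier A) \<in> carrier (character_group A)"
proof -
  interpret A: group A by fact
  show ?thesis using assms(2) by (auto simp: character_group_def hom_def Pi_iff)
qed

lemma character_group_eqI:
  assumes "\<phi> \<in> carrier (character_group A)" "\<psi> \<in> carrier (character_group A)"
    "\<And>x. x \<in> carrier A \<Longrightarrow> \<phi> x = \<psi> x"
  shows "\<phi> = \<psi>"
  using assms by (auto simp: character_group_def intro: extensionalityI)

section \<open>Additive and triangulated categories\<close>

context category
begin

text \<open>Membership in a Hom set is traded for equations on \<open>src\<close> and
  \<open>tgt\<close>, which rewriting can follow through composites. The simplification rules below
  restate the axioms in this form, with composites bracketed to the right.\<close>

lemma Hom_iff: "f \<in> Hom C X Y \<longleftrightarrow> f \<in> arr C \<and> src C f = X \<and> tgt C f = Y"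
  by (simp add: Hom_def)

lemma Hom_obj: assumes "f \<in> Hom C X Y" shows "X \<in> obj C" "Y \<in> obj C"
  using assms src_obj tgt_obj by (auto simp: Hom_iff)

lemma ident_simps [simp]:
  assumes "X \<in> obj C"
  shows "ident C X \<in> arr C" "src C (ident C X) = X" "tgt C (ident C X) = X"
  using ident_hom[OF assms] by (auto simp: Hom_iff)

lemma comp_simps [simp]:
  assumes "f \<in> arr C" "g \<in> arr C" "tgt C f = src C g"
  shows "g \<cdot> f \<in> arr C" "src C (g \<cdot> f) = src C f" "tgt C (g \<cdot> f) = tgt C g"
  using comp_hom[of f "src C f" "src C g" g "tgt C g"] assms by (auto simp: Hom_iff)

lemma comp_ident_left [simp]: "\<lbrakk>f \<in> arr C; tgt C f = Y\<rbrakk> \<Longrightarrow> ident C Y \<cdot> f = f"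
  by (rule ident_left[of f "src C f"]) (auto simp: Hom_iff)

lemma comp_ident_right [simp]: "\<lbrakk>f \<in> arr C; src C f = X\<rbrakk> \<Longrightarrow> f \<cdot> ident C X = f"
  by (rule ident_right[of f _ "tgt C f"]) (auto simp: Hom_iff)

lemma comp_assoc' [simp]:
  "\<lbrakk>f \<in> arr C; g \<in> arr C; h \<in> arr C; tgt C f = src C g; tgt C g = src C h\<rbrakk>
    \<Longrightarrow> (h \<cdot> g) \<cdot> f = h \<cdot> (g \<cdot> f)"
  by (rule comp_assoc[of f "src C f" "src C g" g "src C h" h "tgt C h"]) (auto simp: Hom_iff)

lemma isosI:
  "\<lbrakk>f \<in> Hom C X Y; g \<in> Hom C Y X; g \<cdot> f = ident C X; f \<cdot> g = ident C Y\<rbrakk> \<Longrightarrow> f \<in> isos C X Y"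
  unfolding isos_def by auto

lemma isosE:
  assumes "f \<in> isos C X Y"
  obtains g where "f \<in> Hom C X Y" "g \<in> Hom C Y X" "g \<in> isos C Y X"
    "g \<cdot> f = ident C X" "f \<cdot> g = ident C Y"
  using assms unfolding isos_def by auto

lemma iso_Hom: "f \<in> isos C X Y \<Longrightarrow> f \<in> Hom C X Y"
  unfolding isos_def by auto

lemma ident_iso: "X \<in> obj C \<Longrightarrow> ident C X \<in> isos C X X"
  by (rule isosI[of _ _ _ "ident C X"]) (auto simp: Hom_iff)

lemma iso_comp:
  assumes f: "f \<in> isos C X Y" and g: "g \<in> isos C Y Z"
  shows "g \<cdot> f \<in> isos C X Z"
proof -
  obtain f' where f': "f \<in> Hom C X Y" "f' \<in> Hom C Y X" "f' \<cdot> f = ident C X" "f \<cdot> f' = ident C Y"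
    using isosE[OF f] by metis
  obtain g' where g': "g \<in> Hom C Y Z" "g' \<in> Hom C Z Y" "g' \<cdot> g = ident C Y" "g \<cdot> g' = ident C Z"
    using isosE[OF g] by metis
  have "(f' \<cdot> g') \<cdot> (g \<cdot> f) = f' \<cdot> (g' \<cdot> g) \<cdot> f"
    using f'(1,2) g'(1,2) by (simp add: Hom_iff)
  moreover have "(g \<cdot> f) \<cdot> (f' \<cdot> g') = g \<cdot> (f \<cdot> f') \<cdot> g'"
    using f'(1,2) g'(1,2) by (simp add: Hom_iff)
  ultimately show ?thesis
    using f' g' comp_hom by (intro isosI[of _ _ _ "f' \<cdot> g'"]) (auto simp: Hom_iff)
qed

lemma iso_monic:
  assumes "f \<in> isos C X Y" "u \<in> Hom C W X" "v \<in> Hom C W X" "f \<cdot> u = f \<cdot> v"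
  shows "u = v"
proof -
  obtain g where g: "f \<in> Hom C X Y" "g \<in> Hom C Y X" "g \<cdot> f = ident C X"
    using isosE[OF assms(1)] by metis
  have "(g \<cdot> f) \<cdot> u = (g \<cdot> f) \<cdot> v"
    using g(1,2) assms(2-4) by (simp add: Hom_iff)
  then show ?thesis using g assms by (auto simp: Hom_iff)
qed

lemma iso_epic:
  assumes "f \<in> isos C X Y" "u \<in> Hom C Y W" "v \<in> Hom C Y W" "u \<cdot> f = v \<cdot> f"
  shows "u = v"
proof -
  obtain g where g: "f \<in> Hom C X Y" "g \<in> Hom C Y X" "f \<cdot> g = ident C Y"
    using isosE[OF assms(1)] by metis
  have "u \<cdot> (f \<cdot> g) = (u \<cdot> f) \<cdot> g" using g(1,2) assms(2-3) by (auto simp: Hom_iff)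
  also have "\<dots> = v \<cdot> (f \<cdot> g)" unfolding assms(4) using g(1,2) assms(2-3) by (auto simp: Hom_iff)
  finally show ?thesis using g assms by (auto simp: Hom_iff)
qed

text \<open>Yoneda: a preimage \<open>g\<close> of the identity of \<open>Y\<close> is a right
  inverse, and \<open>f (g f) = f\<close> together with injectivity at \<open>X\<close> makes it a
  left inverse too.\<close>

lemma iso_through_mono:
  assumes "f \<in> Hom C X Y" "\<And>W. W \<in> obj C \<Longrightarrow> bij_betw (\<lambda>u. f \<cdot> u) (Hom C W X) (Hom C W Y)"
  shows "f \<in> isos C X Y"
proof -
  note o = Hom_obj[OF assms(1)]
  have "ident C Y \<in> (\<lambda>u. f \<cdot> u) ` Hom C Y X"
    using assms(2)[OF o(2)] ident_hom[OF o(2)] by (auto simp: bij_betw_def)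
  then obtain g where g: "g \<in> Hom C Y X" "f \<cdot> g = ident C Y" by auto
  have "f \<cdot> (g \<cdot> f) = (f \<cdot> g) \<cdot> f" using g(1) assms(1) by (simp add: Hom_iff)
  then have "f \<cdot> (g \<cdot> f) = f \<cdot> ident C X" using g assms(1) by (simp add: Hom_iff)
  moreover have "inj_on (\<lambda>u. f \<cdot> u) (Hom C X X)" using assms(2)[OF o(1)] by (auto simp: bij_betw_def)
  ultimately have "g \<cdot> f = ident C X"
    using comp_hom[OF assms(1) g(1)] ident_hom[OF o(1)] by (auto simp: inj_on_def)
  with g assms show ?thesis by (intro isosI)
qed

lemma covariant_functorD:
  assumes "covariant_functor C C F"
  shows "X \<in> obj C \<Longrightarrow> fobj F X \<in> obj C"
    and "X \<in> obj C \<Longrightarrow> farr F (ident C X) = ident C (fobj F X)"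
    and "f \<in> Hom C X Y \<Longrightarrow> farr F f \<in> Hom C (fobj F X) (fobj F Y)"
    and "\<lbrakk>f \<in> Hom C X Y; g \<in> Hom C Y Z\<rbrakk> \<Longrightarrow> farr F (g \<cdot> f) = farr F g \<cdot> farr F f"
  using assms unfolding covariant_functor_def by blast+

lemma contravariant_functorD:
  assumes "contravariant_functor C C F"
  shows "X \<in> obj C \<Longrightarrow> fobj F X \<in> obj C"
    and "X \<in> obj C \<Longrightarrow> farr F (ident C X) = ident C (fobj F X)"
    and "f \<in> Hom C X Y \<Longrightarrow> farr F f \<in> Hom C (fobj F Y) (fobj F X)"
    and "\<lbrakk>f \<in> Hom C X Y; g \<in> Hom C Y Z\<rbrakk> \<Longrightarrow> farr F (g \<cdot> f) = farr F f \<cdot> farr F g"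
  using assms unfolding contravariant_functor_def by blast+

lemma covariant_functor_iso:
  assumes "covariant_functor C C F" "f \<in> isos C X Y"
  shows "farr F f \<in> isos C (fobj F X) (fobj F Y)"
proof -
  note F = covariant_functorD[OF assms(1)]
  obtain g where g: "f \<in> Hom C X Y" "g \<in> Hom C Y X" "g \<cdot> f = ident C X" "f \<cdot> g = ident C Y"
    using isosE[OF assms(2)] by metis
  show ?thesis
    using F(3)[OF g(1)] F(3)[OF g(2)] F(4)[OF g(1,2)] F(4)[OF g(2,1)] g F(2) Hom_obj[OF g(1)]
    by (intro isosI[of _ _ _ "farr F g"]) auto
qed

lemma zero_objectD:
  assumes "zero_object C Z"
  shows "Z \<in> obj C" "\<lbrakk>f \<in> Hom C X Z; g \<in> Hom C X Z\<rbrakk> \<Longrightarrow> f = g"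
    "\<lbrakk>f \<in> Hom C Z X; g \<in> Hom C Z X\<rbrakk> \<Longrightarrow> f = g"
  using assms Hom_obj unfolding zero_object_def by blast+

lemma coproductD:
  assumes "is_coproduct C J X P \<iota>"
  shows "P \<in> obj C" "j \<in> J \<Longrightarrow> \<iota> j \<in> Hom C (X j) P"
  using assms unfolding is_coproduct_def by auto

lemma coproduct_lift:
  assumes "is_coproduct C J X P \<iota>" "Y \<in> obj C" "\<And>j. j \<in> J \<Longrightarrow> f j \<in> Hom C (X j) Y"
  obtains u where "u \<in> Hom C P Y" "\<And>j. j \<in> J \<Longrightarrow> u \<cdot> \<iota> j = f j"
  using assms unfolding is_coproduct_def by metis

lemma coproduct_eqI:
  assumes "is_coproduct C J X P \<iota>" "u \<in> Hom C P Y" "v \<in> Hom C P Y" "\<And>j. j \<in> J \<Longrightarrow> u \<cdot> \<iota> j = v \<cdot> \<iota> j"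
  shows "u = v"
proof -
  have "\<forall>j\<in>J. u \<cdot> \<iota> j \<in> Hom C (X j) Y"
    using coproductD[OF assms(1)] assms(2) comp_hom by blast
  then have "\<exists>!w. w \<in> Hom C P Y \<and> (\<forall>j\<in>J. w \<cdot> \<iota> j = u \<cdot> \<iota> j)"
    using assms(1)[unfolded is_coproduct_def, THEN conjunct2, THEN conjunct2, rule_format,
        OF Hom_obj(2)[OF assms(2)], of "\<lambda>j. u \<cdot> \<iota> j"] by simp
  then show ?thesis using assms(2-4) by metis
qed

end

context additive_category
begin

lemma hom_group_simps [simp]:
  "carrier (hom_group C X Y) = Hom C X Y" "x \<otimes>\<^bsub>hom_group C X Y\<^esub> y = x \<boxplus> y"
  "\<one>\<^bsub>hom_group C X Y\<^esub> = zero_arr C X Y"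
  by (simp_all add: hom_group_def)

lemma
  assumes "X \<in> obj C" "Y \<in> obj C"
  shows zero_Hom: "zero_arr C X Y \<in> Hom C X Y"
    and add_Hom: "\<lbrakk>f \<in> Hom C X Y; g \<in> Hom C X Y\<rbrakk> \<Longrightarrow> f \<boxplus> g \<in> Hom C X Y"
    and add_assoc: "\<lbrakk>f \<in> Hom C X Y; g \<in> Hom C X Y; h \<in> Hom C X Y\<rbrakk> \<Longrightarrow> (f \<boxplus> g) \<boxplus> h = f \<boxplus> (g \<boxplus> h)"
    and add_zero_left: "f \<in> Hom C X Y \<Longrightarrow> zero_arr C X Y \<boxplus> f = f"
    and add_zero_right: "f \<in> Hom C X Y \<Longrightarrow> f \<boxplus> zero_arr C X Y = f"
    and neg_Hom: "f \<in> Hom C X Y \<Longrightarrow> neg C f \<in> Hom C X Y"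
    and neg_left: "f \<in> Hom C X Y \<Longrightarrow> neg C f \<boxplus> f = zero_arr C X Y"
    and neg_right: "f \<in> Hom C X Y \<Longrightarrow> f \<boxplus> neg C f = zero_arr C X Y"
    and neg_neg: "f \<in> Hom C X Y \<Longrightarrow> neg C (neg C f) = f"
    and neg_eqI: "\<lbrakk>f \<in> Hom C X Y; g \<in> Hom C X Y; f \<boxplus> g = zero_arr C X Y\<rbrakk> \<Longrightarrow> neg C g = f"
    and add_right_cancel: "\<lbrakk>f \<in> Hom C X Y; g \<in> Hom C X Y; h \<in> Hom C X Y; f \<boxplus> h = g \<boxplus> h\<rbrakk> \<Longrightarrow> f = g"
proof -
  interpret G: comm_group "hom_group C X Y" by (rule hom_comm_group[OF assms])
  have n: "f \<in> Hom C X Y \<Longrightarrow> neg C f = inv\<^bsub>hom_group C X Y\<^esub> f" for f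
    by (auto simp: neg_def Hom_iff)
  show "zero_arr C X Y \<in> Hom C X Y" using G.one_closed by simp
  show "\<lbrakk>f \<in> Hom C X Y; g \<in> Hom C X Y\<rbrakk> \<Longrightarrow> f \<boxplus> g \<in> Hom C X Y" using G.m_closed by simp
  show "\<lbrakk>f \<in> Hom C X Y; g \<in> Hom C X Y; h \<in> Hom C X Y\<rbrakk> \<Longrightarrow> (f \<boxplus> g) \<boxplus> h = f \<boxplus> (g \<boxplus> h)"
    using G.m_assoc by simp
  show "f \<in> Hom C X Y \<Longrightarrow> zero_arr C X Y \<boxplus> f = f" using G.l_one by simp
  show "f \<in> Hom C X Y \<Longrightarrow> f \<boxplus> zero_arr C X Y = f" using G.r_one by simp
  show nh: "neg C f \<in> Hom C X Y" if "f \<in> Hom C X Y" for f using G.inv_closed n that by simp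
  show "f \<in> Hom C X Y \<Longrightarrow> neg C f \<boxplus> f = zero_arr C X Y" using G.l_inv n by simp
  show "f \<in> Hom C X Y \<Longrightarrow> f \<boxplus> neg C f = zero_arr C X Y" using G.r_inv n by simp
  show "f \<in> Hom C X Y \<Longrightarrow> neg C (neg C f) = f" using G.inv_inv n nh by simp
  show "\<lbrakk>f \<in> Hom C X Y; g \<in> Hom C X Y; f \<boxplus> g = zero_arr C X Y\<rbrakk> \<Longrightarrow> neg C g = f"
    using G.inv_equality[of f g] n by simp
  show "\<lbrakk>f \<in> Hom C X Y; g \<in> Hom C X Y; h \<in> Hom C X Y; f \<boxplus> h = g \<boxplus> h\<rbrakk> \<Longrightarrow> f = g"
    using G.right_cancel by simp
qed

lemma zero_simps [simp]:
  assumes "X \<in> obj C" "Y \<in> obj C"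
  shows "zero_arr C X Y \<in> arr C" "src C (zero_arr C X Y) = X" "tgt C (zero_arr C X Y) = Y"
  using zero_Hom[OF assms] by (auto simp: Hom_iff)

lemma add_simps [simp]:
  assumes "f \<in> arr C" "g \<in> arr C" "src C f = src C g" "tgt C f = tgt C g"
  shows "f \<boxplus> g \<in> arr C" "src C (f \<boxplus> g) = src C g" "tgt C (f \<boxplus> g) = tgt C g"
  using add_Hom[OF src_obj tgt_obj, of g g f g] assms by (auto simp: Hom_iff)

lemma neg_simps [simp]:
  assumes "f \<in> arr C" shows "neg C f \<in> arr C" "src C (neg C f) = src C f" "tgt C (neg C f) = tgt C f"
  using neg_Hom[OF src_obj tgt_obj, of f f f] assms by (auto simp: Hom_iff)

lemma comp_distrib_left [simp]:
  "\<lbrakk>f \<in> arr C; f' \<in> arr C; g \<in> arr C; src C f = src C f'; tgt C f = src C g; tgt C f' = src C g\<rbrakk>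
    \<Longrightarrow> g \<cdot> (f \<boxplus> f') = (g \<cdot> f) \<boxplus> (g \<cdot> f')"
  by (rule comp_add_right[of _ "src C f'" "src C g" _ _ "tgt C g"]) (auto simp: Hom_iff)

lemma comp_distrib_right [simp]:
  "\<lbrakk>f \<in> arr C; g \<in> arr C; g' \<in> arr C; tgt C f = src C g'; src C g = src C g'; tgt C g = tgt C g'\<rbrakk>
    \<Longrightarrow> (g \<boxplus> g') \<cdot> f = (g \<cdot> f) \<boxplus> (g' \<cdot> f)"
  by (rule comp_add_left[of _ "src C f" "src C g'" _ "tgt C g'"]) (auto simp: Hom_iff)

text \<open>An idempotent element of a group is neutral. Through this, the preservation of zero by
  composition, by additive functors and by the tensor product is derived from additivity.\<close>

lemma self_add_zero:
  assumes "f \<in> Hom C X Y" "f \<boxplus> f = f" shows "f = zero_arr C X Y"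
proof -
  note o = Hom_obj[OF assms(1)]
  have "f \<boxplus> f = zero_arr C X Y \<boxplus> f" using assms add_zero_left[OF o] by simp
  then show ?thesis using add_right_cancel[OF o assms(1) zero_Hom[OF o] assms(1)] by simp
qed

lemma comp_zero_right [simp]:
  assumes "f \<in> arr C" "src C f = Y" "X \<in> obj C"
  shows "f \<cdot> zero_arr C X Y = zero_arr C X (tgt C f)"
proof -
  have o: "Y \<in> obj C" using src_obj assms by auto
  have "f \<cdot> (zero_arr C X Y \<boxplus> zero_arr C X Y) = (f \<cdot> zero_arr C X Y) \<boxplus> (f \<cdot> zero_arr C X Y)"
    using assms o by (intro comp_distrib_left) auto
  then show ?thesis
    using assms o add_zero_left[OF assms(3) o zero_Hom[OF assms(3) o]]
    by (intro self_add_zero) (auto simp: Hom_iff)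
qed

lemma comp_zero_left [simp]:
  assumes "f \<in> arr C" "tgt C f = X" "Y \<in> obj C"
  shows "zero_arr C X Y \<cdot> f = zero_arr C (src C f) Y"
proof -
  have o: "X \<in> obj C" using tgt_obj assms by auto
  have "(zero_arr C X Y \<boxplus> zero_arr C X Y) \<cdot> f = (zero_arr C X Y \<cdot> f) \<boxplus> (zero_arr C X Y \<cdot> f)"
    using assms o by (intro comp_distrib_right) auto
  then show ?thesis
    using assms o add_zero_left[OF o assms(3) zero_Hom[OF o assms(3)]]
    by (intro self_add_zero) (auto simp: Hom_iff)
qed

lemma comp_neg_left [simp]:
  assumes "f \<in> arr C" "g \<in> arr C" "tgt C f = src C g"
  shows "neg C g \<cdot> f = neg C (g \<cdot> f)"
proof (rule neg_eqI[symmetric])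
  have "(neg C g \<cdot> f) \<boxplus> (g \<cdot> f) = (neg C g \<boxplus> g) \<cdot> f" using assms by simp
  also have "\<dots> = zero_arr C (src C f) (tgt C g)"
    using assms neg_left[OF src_obj tgt_obj, of g g g] tgt_obj by (simp add: Hom_iff)
  finally show "neg C g \<cdot> f \<boxplus> g \<cdot> f = zero_arr C (src C f) (tgt C g)" .
qed (use assms in \<open>auto simp: Hom_iff src_obj tgt_obj\<close>)

lemma comp_neg_right [simp]:
  assumes "f \<in> arr C" "g \<in> arr C" "tgt C f = src C g"
  shows "g \<cdot> neg C f = neg C (g \<cdot> f)"
proof (rule neg_eqI[symmetric])
  have "(g \<cdot> neg C f) \<boxplus> (g \<cdot> f) = g \<cdot> (neg C f \<boxplus> f)" using assms by simp
  also have "\<dots> = zero_arr C (src C f) (tgt C g)"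
    using assms neg_left[OF src_obj tgt_obj, of f f f] src_obj by (simp add: Hom_iff)
  finally show "g \<cdot> neg C f \<boxplus> g \<cdot> f = zero_arr C (src C f) (tgt C g)" .
qed (use assms in \<open>auto simp: Hom_iff src_obj tgt_obj\<close>)

lemma neg_eq_iff:
  assumes "f \<in> Hom C X Y" "g \<in> Hom C X Y" shows "neg C f = neg C g \<longleftrightarrow> f = g"
  using neg_neg assms Hom_obj by metis

lemma eq_if_diff_zero:
  assumes "f \<in> Hom C X Y" "g \<in> Hom C X Y" "f \<boxplus> neg C g = zero_arr C X Y" shows "f = g"
  using neg_eqI[OF Hom_obj[OF assms(1)] assms(1) neg_Hom[OF Hom_obj[OF assms(1)] assms(2)] assms(3)]
    neg_neg[OF Hom_obj[OF assms(1)] assms(2)] by simp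

lemma zero_objectI:
  assumes "Z \<in> obj C" "ident C Z = zero_arr C Z Z" shows "zero_object C Z"
proof -
  have "f = zero_arr C X Z" if "f \<in> Hom C X Z" for X f
  proof -
    have "f = ident C Z \<cdot> f" using that by (simp add: Hom_iff)
    also have "\<dots> = zero_arr C X Z" using that assms by (auto simp: Hom_iff)
    finally show ?thesis .
  qed
  moreover have "f = zero_arr C Z X" if "f \<in> Hom C Z X" for X f
  proof -
    have "f = f \<cdot> ident C Z" using that by (simp add: Hom_iff)
    also have "\<dots> = zero_arr C Z X" using that assms by (auto simp: Hom_iff)
    finally show ?thesis .
  qed
  ultimately show ?thesis using assms(1) zero_Hom unfolding zero_object_def by blast
qed

lemma zero_object_ident: "zero_object C Z \<Longrightarrow> ident C Z = zero_arr C Z Z"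
  using zero_objectD ident_hom zero_Hom by blast

lemma obtain_biproduct:
  assumes "X \<in> obj C" "Y \<in> obj C"
  obtains P i j p q where "P \<in> obj C" "i \<in> Hom C X P" "j \<in> Hom C Y P" "p \<in> Hom C P X" "q \<in> Hom C P Y"
    "p \<cdot> i = ident C X" "q \<cdot> j = ident C Y" "p \<cdot> j = zero_arr C Y X"
    "q \<cdot> i = zero_arr C X Y" "(i \<cdot> p) \<boxplus> (j \<cdot> q) = ident C P"
  using biproduct_exists[OF assms] by blast

lemma additive_zero:
  assumes "Defs.additive C C F" "f \<in> Hom C X Y" "f = zero_arr C X Y" "farr F f \<in> Hom C U V"
  shows "farr F f = zero_arr C U V"
proof -
  have "f \<boxplus> f = f" using add_zero_left[OF Hom_obj[OF assms(2)]] assms(2,3) by simp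
  then have "farr F f \<boxplus> farr F f = farr F f" using assms(1,2) unfolding Defs.additive_def by metis
  then show ?thesis using self_add_zero assms(4) by simp
qed

end

section \<open>Exact sequences, rotation and fibres of distinguished triangles\<close>

context triangulated_category
begin

lemmas Sh_functorD = covariant_functorD[OF shift_functor]

lemma Sh_obj [simp]: "X \<in> obj C \<Longrightarrow> Sh C X \<in> obj C" by (rule Sh_functorD)
lemma sh_Hom: "f \<in> Hom C X Y \<Longrightarrow> sh C f \<in> Hom C (Sh C X) (Sh C Y)" by (rule Sh_functorD)
lemma sh_simps [simp]:
  "f \<in> arr C \<Longrightarrow> sh C f \<in> arr C" "f \<in> arr C \<Longrightarrow> src C (sh C f) = Sh C (src C f)"
  "f \<in> arr C \<Longrightarrow> tgt C (sh C f) = Sh C (tgt C f)"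
  using sh_Hom[of f "src C f" "tgt C f"] by (auto simp: Hom_iff)
lemma sh_ident [simp]: "X \<in> obj C \<Longrightarrow> sh C (ident C X) = ident C (Sh C X)" by (rule Sh_functorD)
lemma sh_comp: "\<lbrakk>f \<in> arr C; g \<in> arr C; tgt C f = src C g\<rbrakk> \<Longrightarrow> sh C (g \<cdot> f) = sh C g \<cdot> sh C f"
  using Sh_functorD(4)[of f "src C f" "src C g" g "tgt C g"] by (auto simp: Hom_iff)

lemma sh_zero [simp]: "\<lbrakk>X \<in> obj C; Y \<in> obj C\<rbrakk> \<Longrightarrow> sh C (zero_arr C X Y) = zero_arr C (Sh C X) (Sh C Y)"
  using additive_zero[OF shift_additive zero_Hom refl sh_Hom[OF zero_Hom]] .

lemma sh_add: "\<lbrakk>f \<in> Hom C X Y; g \<in> Hom C X Y\<rbrakk> \<Longrightarrow> sh C (f \<boxplus> g) = sh C f \<boxplus> sh C g"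
  using shift_additive unfolding Defs.additive_def by blast

lemma sh_neg:
  assumes "f \<in> Hom C X Y" shows "sh C (neg C f) = neg C (sh C f)"
proof (rule neg_eqI[symmetric])
  note o = Hom_obj[OF assms]
  show "Sh C X \<in> obj C" "Sh C Y \<in> obj C" using o by auto
  show "sh C (neg C f) \<in> Hom C (Sh C X) (Sh C Y)" using sh_Hom neg_Hom[OF o] assms by blast
  show "sh C f \<in> Hom C (Sh C X) (Sh C Y)" using sh_Hom assms by blast
  show "sh C (neg C f) \<boxplus> sh C f = zero_arr C (Sh C X) (Sh C Y)"
    using sh_add[OF neg_Hom[OF o assms] assms] neg_left[OF o assms] o by simp
qed

lemma sh_inj: "\<lbrakk>f \<in> Hom C X Y; g \<in> Hom C X Y; sh C f = sh C g\<rbrakk> \<Longrightarrow> f = g"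
  by (rule inj_onD[OF bij_betw_imp_inj_on[OF shift_fully_faithful]]) (auto dest: Hom_obj)

lemma sh_full:
  assumes "X \<in> obj C" "Y \<in> obj C" "g \<in> Hom C (Sh C X) (Sh C Y)"
  obtains f where "f \<in> Hom C X Y" "sh C f = g"
proof -
  have "g \<in> sh C ` Hom C X Y"
    using bij_betw_imp_surj_on[OF shift_fully_faithful[OF assms(1,2)]] assms(3) by simp
  then show thesis using that by auto
qed

lemma Sh_zero_object: "zero_object C Z \<Longrightarrow> zero_object C (Sh C Z)"
  using zero_objectI[of "Sh C Z"] zero_object_ident[of Z] zero_objectD(1)[of Z]
    sh_ident[of Z] sh_zero[of Z Z] by simp

lemma triangleD:
  assumes "is_triangle C X Y Z f g h"
  shows "f \<in> Hom C X Y" "g \<in> Hom C Y Z" "h \<in> Hom C Z (Sh C X)"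
  using assms unfolding is_triangle_def is_candidate_def by auto

lemma rotate: "is_triangle C X Y Z f g h \<Longrightarrow> is_triangle C Y Z (Sh C X) g h (neg C (sh C f))"
  using tri_rotate unfolding is_triangle_def by blast

text \<open>The identity triangle on \<open>W\<close>, rotated back once. The sign disappears
  because there is only one arrow out of the shift of a zero object. It serves as the target
  triangle in \<open>triangle_cohomological\<close>.\<close>

lemma tri_zero_ident:
  assumes "W \<in> obj C" "zero_object C Z"
  shows "is_triangle C Z W W (zero_arr C Z W) (ident C W) (zero_arr C W (Sh C Z))"
proof (rule tri_rotate[THEN iffD2])
  note Z = zero_objectD(1)[OF assms(2)]
  show "is_candidate C Z W W (zero_arr C Z W) (ident C W) (zero_arr C W (Sh C Z))"
    unfolding is_candidate_def using assms Z by (auto simp: Hom_iff)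
  have "neg C (sh C (zero_arr C Z W)) = zero_arr C (Sh C Z) (Sh C W)"
    using neg_Hom zero_Hom Z assms sh_zero zero_objectD(3)[OF Sh_zero_object[OF assms(2)]] by (metis Sh_obj)
  then show "is_triangle C W W (Sh C Z) (ident C W) (zero_arr C W (Sh C Z)) (neg C (sh C (zero_arr C Z W)))"
    using tri_ident[OF assms(1) Sh_zero_object[OF assms(2)]] by simp
qed

text \<open>The pair \<open>(ident C X, f)\<close> starts a morphism from the triangle
  \<open>X -> X -> 0\<close> to the given one; the filler shows that \<open>g\<close> after
  \<open>f\<close> factors through the zero object.\<close>

lemma triangle_comp_zero:
  assumes "is_triangle C X Y Z f g h"
  shows "g \<cdot> f = zero_arr C X Z"
proof -
  note D = triangleD[OF assms]
  obtain N where N: "zero_object C N" using zero_object_exists by auto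
  note o = Hom_obj[OF D(1)] Hom_obj[OF D(2)] zero_objectD(1)[OF N]
  obtain w where w: "w \<in> Hom C N Z" "w \<cdot> zero_arr C X N = g \<cdot> f"
    using tri_fill[OF tri_ident[OF o(1) N] assms ident_hom[OF o(1)] D(1) refl] by blast
  then show ?thesis using comp_zero_right[of w N X] o by (simp add: Hom_iff)
qed

text \<open>Since \<open>y\<close> kills \<open>f\<close>, it starts a morphism of triangles to
  \<open>0 -> W -> W\<close>, whose filler is the factorisation.\<close>

lemma triangle_cohomological:
  assumes "is_triangle C X Y Z f g h" "y \<in> Hom C Y W" "y \<cdot> f = zero_arr C X W"
  obtains z where "z \<in> Hom C Z W" "z \<cdot> g = y"
proof -
  note D = triangleD[OF assms(1)]
  obtain N where N: "zero_object C N" using zero_object_exists by auto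
  note o = Hom_obj[OF D(1)] Hom_obj[OF D(2)] zero_objectD(1)[OF N] Hom_obj[OF assms(2)]
  have "y \<cdot> f = zero_arr C N W \<cdot> zero_arr C X N" using assms o by simp
  then obtain w where "w \<in> Hom C Z W" "w \<cdot> g = ident C W \<cdot> y"
    using tri_fill[OF assms(1) tri_zero_ident[OF o(7) N] zero_Hom[OF o(1,5)] assms(2)] by blast
  with that assms(2) show ?thesis by (simp add: Hom_iff)
qed

text \<open>The axiom fills third components only, so both triangles are rotated first: the source
  is \<open>W -> 0 -> Sh W\<close>. The filler is an arrow between shifts, which full faithfulness
  brings back; the two rotation signs cancel.\<close>

lemma triangle_homological:
  assumes "is_triangle C X Y Z f g h" "v \<in> Hom C W Y" "g \<cdot> v = zero_arr C W Z"
  obtains u where "u \<in> Hom C W X" "f \<cdot> u = v"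
proof -
  note D = triangleD[OF assms(1)]
  obtain N where N: "zero_object C N" using zero_object_exists by auto
  note o = Hom_obj[OF D(1)] Hom_obj[OF D(2)] zero_objectD(1)[OF N] Hom_obj[OF assms(2)]
  have "zero_arr C N Z \<cdot> zero_arr C W N = g \<cdot> v" using assms o by simp
  then obtain w where w: "w \<in> Hom C (Sh C W) (Sh C X)"
    "sh C v \<cdot> neg C (sh C (ident C W)) = neg C (sh C f) \<cdot> w"
    using tri_fill[OF rotate[OF tri_ident[OF o(6) N]] rotate[OF assms(1)] assms(2) zero_Hom[OF o(5,4)]]
    by metis
  obtain u where u: "u \<in> Hom C W X" "sh C u = w" using sh_full[OF o(6) o(1) w(1)] .
  have "neg C (sh C v) = neg C (sh C (f \<cdot> u))"
    using w assms(2) u D(1) o by (simp add: Hom_iff sh_comp)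
  then have "sh C v = sh C (f \<cdot> u)"
    using neg_eq_iff sh_Hom[OF assms(2)] sh_Hom[OF comp_hom[OF u(1) D(1)]] by blast
  then show ?thesis using that u(1) sh_inj[OF assms(2) comp_hom[OF u(1) D(1)]] by metis
qed

text \<open>Rotating backwards requires the third object to be a shift. It is therefore replaced by
  the isomorphic \<open>Sh C F\<close>, and the connecting map is desuspended by fullness; the sign
  in the rotation axiom is absorbed by negating the result.\<close>

lemma unrotate:
  assumes tr: "is_triangle C L K Z f a b" and F: "F \<in> obj C" "t \<in> isos C (Sh C F) Z"
  obtains g h where "is_triangle C F L K g f h"
proof -
  note D = triangleD[OF tr]
  note o = Hom_obj[OF D(1)]
  obtain s where s: "t \<in> Hom C (Sh C F) Z" "s \<in> Hom C Z (Sh C F)" "s \<in> isos C Z (Sh C F)"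
    "s \<cdot> t = ident C (Sh C F)" "t \<cdot> s = ident C Z" using isosE[OF F(2)] by metis
  obtain g where g: "g \<in> Hom C F L" "sh C g = b \<cdot> t"
    using sh_full[OF F(1) o(1) comp_hom[OF s(1) D(3)]] .
  have "neg C (sh C (neg C g)) = b \<cdot> t"
    using g sh_neg[OF g(1)] neg_neg sh_Hom[OF g(1)] Hom_obj by metis
  moreover have "is_triangle C L K (Sh C F) f (s \<cdot> a) (b \<cdot> t)"
  proof (rule tri_iso[OF tr])
    show "is_candidate C L K (Sh C F) f (s \<cdot> a) (b \<cdot> t)"
      using D s comp_hom by (auto simp: is_candidate_def)
    show "ident C L \<in> isos C L L" "ident C K \<in> isos C K K" "s \<in> isos C Z (Sh C F)"
      using o s ident_iso by auto
    have "(b \<cdot> t) \<cdot> s = b \<cdot> (t \<cdot> s)" using D s(1,2) by (simp add: Hom_iff)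
    then show "sh C (ident C L) \<cdot> b = (b \<cdot> t) \<cdot> s" using o D s(5) by (simp add: Hom_iff)
  qed (use o D s in \<open>auto simp: Hom_iff\<close>)
  moreover have "is_candidate C F L K (neg C g) f (s \<cdot> a)"
    unfolding is_candidate_def using g(1) s(2) D by (simp add: Hom_iff)
  ultimately have "is_triangle C F L K (neg C g) f (s \<cdot> a)" using tri_rotate by simp
  then show ?thesis using that by blast
qed

lemma fibre_exists:
  assumes f: "f \<in> Hom C L K"
  obtains F g h where "is_triangle C F L K g f h"
proof -
  obtain Z a b where t: "is_triangle C L K Z f a b" using tri_complete[OF f] by blast
  obtain F where "F \<in> obj C" "isos C (Sh C F) Z \<noteq> {}"
    using shift_ess_surj[of Z] Hom_obj[OF triangleD(2)[OF t]] by blast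
  with unrotate[OF t] that show thesis by blast
qed

text \<open>Distinguished triangles are closed under isomorphism, so exactness passes along a
  natural isomorphism once the shift comparison is transported too. The intended \<open>F\<close> is
  the internal hom into the dual of the unit.\<close>

lemma exact_contravariant_functor_iso:
  assumes F: "exact_contravariant_functor C C F" and Q: "contravariant_functor C C Q"
    and s: "\<And>X. X \<in> obj C \<Longrightarrow> s X \<in> isos C (fobj Q X) (fobj F X)"
    and nat: "\<And>X Y f. f \<in> Hom C X Y \<Longrightarrow> s X \<cdot> farr Q f = farr F f \<cdot> s Y"
  shows "exact_contravariant_functor C C Q"
proof -
  have Fc: "contravariant_functor C C F" "Defs.additive C C F"
    using F unfolding exact_contravariant_functor_def by auto
  note QD = contravariant_functorD[OF Q] and FD = contravariant_functorD[OF Fc(1)]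
  obtain \<theta> where \<theta>: "\<And>X. X \<in> obj C \<Longrightarrow> \<theta> X \<in> isos C (fobj F X) (Sh C (fobj F (Sh C X)))"
    "\<And>X Y f. f \<in> Hom C X Y \<Longrightarrow> \<theta> X \<cdot> farr F f = sh C (farr F (sh C f)) \<cdot> \<theta> Y"
    "\<And>X Y Z f g h. is_triangle C X Y Z f g h \<Longrightarrow> is_triangle C (fobj F Z) (fobj F Y) (fobj F X)
               (farr F g) (farr F f) (sh C (farr F h) \<cdot> \<theta> X)"
    using F unfolding exact_contravariant_functor_def by metis
  have "\<exists>t. t \<in> isos C (fobj F X) (fobj Q X) \<and> t \<cdot> s X = ident C (fobj Q X) \<and> s X \<cdot> t = ident C (fobj F X)"
    if "X \<in> obj C" for X using isosE[OF s[OF that]] by metis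
  then obtain t where t: "\<And>X. X \<in> obj C \<Longrightarrow> t X \<in> isos C (fobj F X) (fobj Q X)"
    "\<And>X. X \<in> obj C \<Longrightarrow> t X \<cdot> s X = ident C (fobj Q X)"
    "\<And>X. X \<in> obj C \<Longrightarrow> s X \<cdot> t X = ident C (fobj F X)"
    by metis
  note sH = iso_Hom[OF s] and tH = iso_Hom[OF t(1)] and \<theta>H = iso_Hom[OF \<theta>(1)]
  have tn: "t X \<cdot> farr F f = farr Q f \<cdot> t Y" if f: "f \<in> Hom C X Y" for X Y f
  proof -
    note o = Hom_obj[OF f]
    have "t X \<cdot> farr F f = t X \<cdot> (farr F f \<cdot> (s Y \<cdot> t Y))"
      using FD(3)[OF f] t(3)[OF o(2)] by (simp add: Hom_iff)
    also have "\<dots> = t X \<cdot> ((farr F f \<cdot> s Y) \<cdot> t Y)"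
      using FD(3)[OF f] sH[OF o(2)] tH[OF o(2)] by (simp add: Hom_iff)
    also have "\<dots> = (t X \<cdot> s X) \<cdot> (farr Q f \<cdot> t Y)"
      unfolding nat[OF f, symmetric] using QD(3)[OF f] sH[OF o(1)] tH[OF o(1)] tH[OF o(2)] by (simp add: Hom_iff)
    also have "\<dots> = farr Q f \<cdot> t Y"
      using t(2)[OF o(1)] QD(3)[OF f] tH[OF o(2)] by (simp add: Hom_iff)
    finally show ?thesis .
  qed
  \<comment> \<open>The comparison for \<open>F\<close> conjugated by the natural isomorphism:
    \<open>Q X -> F X -> Sh (F (Sh X)) -> Sh (Q (Sh X))\<close>.\<close>
  define \<theta>' where "\<theta>' X = sh C (t (Sh C X)) \<cdot> (\<theta> X \<cdot> s X)" for X
  have \<theta>'i: "\<theta>' X \<in> isos C (fobj Q X) (Sh C (fobj Q (Sh C X)))" if "X \<in> obj C" for X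
    unfolding \<theta>'_def
    using iso_comp[OF iso_comp[OF s \<theta>(1)] covariant_functor_iso[OF shift_functor t(1)]] that by simp
  have "Defs.additive C C Q"
    unfolding Defs.additive_def
  proof (intro allI ballI)
    fix X Y f g assume f: "f \<in> Hom C X Y" and g: "g \<in> Hom C X Y"
    note o = Hom_obj[OF f]
    have fg: "f \<boxplus> g \<in> Hom C X Y" using add_Hom o f g by blast
    have "s X \<cdot> farr Q (f \<boxplus> g) = (farr F f \<boxplus> farr F g) \<cdot> s Y"
      using nat[OF fg] Fc(2) f g unfolding Defs.additive_def by metis
    also have "\<dots> = s X \<cdot> (farr Q f \<boxplus> farr Q g)"
      using FD(3)[OF f] FD(3)[OF g] QD(3)[OF f] QD(3)[OF g] sH[OF o(1)] sH[OF o(2)] nat[OF f] nat[OF g]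
      by (simp add: Hom_iff)
    finally show "farr Q (f \<boxplus> g) = farr Q f \<boxplus> farr Q g"
      using iso_monic[OF s[OF o(1)] QD(3)[OF fg]] add_Hom[OF QD(1) QD(1)] QD(3)[OF f] QD(3)[OF g] o by metis
  qed
  moreover have "\<theta>' X \<cdot> farr Q f = sh C (farr Q (sh C f)) \<cdot> \<theta>' Y" if f: "f \<in> Hom C X Y" for X Y f
  proof -
    note o = Hom_obj[OF f]
    have fs: "sh C f \<in> Hom C (Sh C X) (Sh C Y)" using sh_Hom[OF f] .
    have "\<theta>' X \<cdot> farr Q f = sh C (t (Sh C X)) \<cdot> (\<theta> X \<cdot> (s X \<cdot> farr Q f))"
      unfolding \<theta>'_def using QD(3)[OF f] sH[OF o(1)] \<theta>H[OF o(1)] tH[of "Sh C X"] o by (simp add: Hom_iff)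
    also have "\<dots> = sh C (t (Sh C X)) \<cdot> ((\<theta> X \<cdot> farr F f) \<cdot> s Y)"
      unfolding nat[OF f] using FD(3)[OF f] sH[OF o(2)] \<theta>H[OF o(1)] by (simp add: Hom_iff)
    also have "\<dots> = sh C (t (Sh C X) \<cdot> farr F (sh C f)) \<cdot> (\<theta> Y \<cdot> s Y)"
      unfolding \<theta>(2)[OF f] using FD(3)[OF fs] sH[OF o(2)] \<theta>H[OF o(2)] tH[of "Sh C X"] o
      by (simp add: Hom_iff sh_comp)
    also have "\<dots> = sh C (farr Q (sh C f)) \<cdot> \<theta>' Y"
      unfolding tn[OF fs] \<theta>'_def using QD(3)[OF fs] sH[OF o(2)] \<theta>H[OF o(2)] tH[of "Sh C Y"] o
      by (simp add: Hom_iff sh_comp)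
    finally show ?thesis .
  qed
  moreover have "is_triangle C (fobj Q Z) (fobj Q Y) (fobj Q X) (farr Q g) (farr Q f) (sh C (farr Q h) \<cdot> \<theta>' X)"
    if tr: "is_triangle C X Y Z f g h" for X Y Z f g h
  proof (rule tri_iso[OF \<theta>(3)[OF tr] _ t(1) t(1) t(1)])
    note D = triangleD[OF tr]
    note o = Hom_obj[OF D(1)] Hom_obj[OF D(2)]
    show "X \<in> obj C" "Y \<in> obj C" "Z \<in> obj C" using o by auto
    show "is_candidate C (fobj Q Z) (fobj Q Y) (fobj Q X) (farr Q g) (farr Q f) (sh C (farr Q h) \<cdot> \<theta>' X)"
      unfolding is_candidate_def
      using QD(3)[OF D(1)] QD(3)[OF D(2)] comp_hom[OF iso_Hom[OF \<theta>'i[OF o(1)]] sh_Hom[OF QD(3)[OF D(3)]]] by blast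
    show "t Y \<cdot> farr F g = farr Q g \<cdot> t Z" "t X \<cdot> farr F f = farr Q f \<cdot> t Y" using tn D by auto
    have "(sh C (farr Q h) \<cdot> \<theta>' X) \<cdot> t X = sh C (farr Q h \<cdot> t (Sh C X)) \<cdot> (\<theta> X \<cdot> (s X \<cdot> t X))"
      unfolding \<theta>'_def using QD(3)[OF D(3)] sH[OF o(1)] tH[OF o(1)] \<theta>H[OF o(1)] tH[of "Sh C X"] o
      by (simp add: Hom_iff sh_comp)
    also have "\<dots> = sh C (t Z \<cdot> farr F h) \<cdot> \<theta> X"
      unfolding tn[OF D(3), symmetric] t(3)[OF o(1)] using \<theta>H[OF o(1)] by (simp add: Hom_iff)
    also have "\<dots> = sh C (t Z) \<cdot> (sh C (farr F h) \<cdot> \<theta> X)"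
      using \<theta>H[OF o(1)] FD(3)[OF D(3)] tH[OF o(4)] by (simp add: Hom_iff sh_comp)
    finally show "sh C (t Z) \<cdot> (sh C (farr F h) \<cdot> \<theta> X) = (sh C (farr Q h) \<cdot> \<theta>' X) \<cdot> t X" by simp
  qed
  ultimately show ?thesis
    using Q \<theta>'i unfolding exact_contravariant_functor_def by blast
qed

end

section \<open>Compact objects\<close>

text \<open>
  A map to a coproduct factors through a finite partial coproduct if and only if it is fixed by one
  of the idempotents that are the identity on finitely many summands and zero on the others.
  Working with these idempotents avoids finite sums of morphisms in the closure properties below.
\<close>

definition is_truncation ::
  "('o, 'a, 'm) additive_category_scheme \<Rightarrow> 'i set \<Rightarrow> ('i \<Rightarrow> 'o) \<Rightarrow> 'o \<Rightarrow> ('i \<Rightarrow> 'a) \<Rightarrow> 'i set \<Rightarrow> 'a \<Rightarrow> bool"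
  where "is_truncation C J X P \<iota> F e \<longleftrightarrow> e \<in> Hom C P P \<and>
    (\<forall>j \<in> J. e \<cdot>\<^bsub>C\<^esub> \<iota> j = (if j \<in> F then \<iota> j else zero_arr C (X j) P))"

definition finitely_supported ::
  "('o, 'a, 'm) additive_category_scheme \<Rightarrow> 'i set \<Rightarrow> ('i \<Rightarrow> 'o) \<Rightarrow> 'o \<Rightarrow> ('i \<Rightarrow> 'a) \<Rightarrow> 'a \<Rightarrow> bool"
  where "finitely_supported C J X P \<iota> u \<longleftrightarrow>
    (\<exists>F e. finite F \<and> F \<subseteq> J \<and> is_truncation C J X P \<iota> F e \<and> e \<cdot>\<^bsub>C\<^esub> u = u)"

context additive_category
begin

lemma truncation_exists:
  assumes "is_coproduct C J X P \<iota>"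
  obtains e where "is_truncation C J X P \<iota> F e"
proof -
  note P = coproductD[OF assms]
  have "(if j \<in> F then \<iota> j else zero_arr C (X j) P) \<in> Hom C (X j) P" if "j \<in> J" for j
    using P that zero_Hom Hom_obj(1)[OF P(2)[OF that]] by auto
  from coproduct_lift[OF assms P(1) this] obtain e where "e \<in> Hom C P P"
    "\<And>j. j \<in> J \<Longrightarrow> e \<cdot> \<iota> j = (if j \<in> F then \<iota> j else zero_arr C (X j) P)" by blast
  with that show ?thesis unfolding is_truncation_def by blast
qed

text \<open>Arrows out of a coproduct are compared on the injections. The case \<open>F = F'\<close>
  gives both idempotence and uniqueness up to mutual absorption of truncations.\<close>

lemma truncation_comp:
  assumes "is_coproduct C J X P \<iota>" "is_truncation C J X P \<iota> F e" "is_truncation C J X P \<iota> F' e'"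
    "F \<subseteq> F'"
  shows "e' \<cdot> e = e"
proof (rule coproduct_eqI[OF assms(1)])
  have e: "e \<in> Hom C P P" "e' \<in> Hom C P P" using assms by (auto simp: is_truncation_def)
  show "e' \<cdot> e \<in> Hom C P P" "e \<in> Hom C P P" using e comp_hom by auto
  fix j assume j: "j \<in> J"
  note \<iota> = coproductD[OF assms(1)]
  have "(e' \<cdot> e) \<cdot> \<iota> j = e' \<cdot> (e \<cdot> \<iota> j)" using e \<iota>(2)[OF j] by (simp add: Hom_iff)
  also have "\<dots> = e \<cdot> \<iota> j"
    using assms(2-4) j e Hom_obj[OF \<iota>(2)[OF j]] by (auto simp: is_truncation_def Hom_iff)
  finally show "(e' \<cdot> e) \<cdot> \<iota> j = e \<cdot> \<iota> j" .
qed

lemma truncation_absorb: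
  assumes "is_coproduct C J X P \<iota>" "is_truncation C J X P \<iota> F e" "is_truncation C J X P \<iota> F' e'"
    "F \<subseteq> F'" "u \<in> Hom C K P" "e \<cdot> u = u"
  shows "e' \<cdot> u = u"
proof -
  have e: "e \<in> Hom C P P" "e' \<in> Hom C P P" using assms by (auto simp: is_truncation_def)
  have "(e' \<cdot> e) \<cdot> u = e' \<cdot> (e \<cdot> u)" using e assms(5) by (simp add: Hom_iff)
  then show ?thesis using truncation_comp[OF assms(1-4)] assms(6) by simp
qed

lemma finitely_supported_add:
  assumes c: "is_coproduct C J X P \<iota>" and "u \<in> Hom C K P" "v \<in> Hom C K P"
    and "finitely_supported C J X P \<iota> u" "finitely_supported C J X P \<iota> v"
  shows "finitely_supported C J X P \<iota> (u \<boxplus> v)"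
proof -
  obtain F e where 1: "finite F" "F \<subseteq> J" "is_truncation C J X P \<iota> F e" "e \<cdot> u = u"
    using assms(4) unfolding finitely_supported_def by blast
  obtain F' e' where 2: "finite F'" "F' \<subseteq> J" "is_truncation C J X P \<iota> F' e'" "e' \<cdot> v = v"
    using assms(5) unfolding finitely_supported_def by blast
  obtain d where d: "is_truncation C J X P \<iota> (F \<union> F') d" using truncation_exists[OF c] .
  have "d \<cdot> u = u" "d \<cdot> v = v"
    using truncation_absorb[OF c 1(3) d _ assms(2) 1(4)] truncation_absorb[OF c 2(3) d _ assms(3) 2(4)] by auto
  then have "d \<cdot> (u \<boxplus> v) = u \<boxplus> v" using d assms(2,3) by (simp add: is_truncation_def Hom_iff)
  then show ?thesis using d 1 2 unfolding finitely_supported_def by (intro exI[of _ "F \<union> F'"]) auto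
qed

lemma finitely_supported_comp:
  assumes "u \<in> Hom C K P" "k \<in> Hom C L K" "finitely_supported C J X P \<iota> u"
  shows "finitely_supported C J X P \<iota> (u \<cdot> k)"
proof -
  obtain F e where 1: "finite F" "F \<subseteq> J" "is_truncation C J X P \<iota> F e" "e \<cdot> u = u"
    using assms(3) unfolding finitely_supported_def by blast
  have "e \<in> Hom C P P" using 1 by (simp add: is_truncation_def)
  then have "e \<cdot> (u \<cdot> k) = (e \<cdot> u) \<cdot> k" using assms(1,2) by (auto simp: Hom_iff)
  then show ?thesis using 1 unfolding finitely_supported_def by auto
qed

lemma finitely_supported_truncation:
  assumes c: "is_coproduct C J X P \<iota>" and "is_truncation C J X P \<iota> F e" "finite F" "F \<subseteq> J" "u \<in> Hom C K P"
  shows "finitely_supported C J X P \<iota> (e \<cdot> u)"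
proof -
  have "e \<in> Hom C P P" using assms by (simp add: is_truncation_def)
  then have "e \<cdot> (e \<cdot> u) = (e \<cdot> e) \<cdot> u" using assms(5) by (auto simp: Hom_iff)
  then have "e \<cdot> (e \<cdot> u) = e \<cdot> u" using truncation_comp[OF c assms(2,2)] by simp
  then show ?thesis using assms unfolding finitely_supported_def by blast
qed

lemma comp_finprod:
  assumes "g \<in> Hom C P Q" "finite S" "f \<in> S \<rightarrow> Hom C K P" "K \<in> obj C"
  shows "g \<cdot> finprod (hom_group C K P) f S = finprod (hom_group C K Q) (\<lambda>j. g \<cdot> f j) S"
  using assms(2,3)
proof (induction S rule: finite_induct)
  note o = Hom_obj[OF assms(1)]
  interpret P: comm_group "hom_group C K P" by (intro hom_comm_group o assms)
  interpret Q: comm_group "hom_group C K Q" by (intro hom_comm_group o assms)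
  case empty
  then show ?case using assms(1,4) by (simp add: Hom_iff)
next
  note o = Hom_obj[OF assms(1)]
  interpret P: comm_group "hom_group C K P" by (intro hom_comm_group o assms)
  interpret Q: comm_group "hom_group C K Q" by (intro hom_comm_group o assms)
  case (insert j S)
  have f: "f j \<in> Hom C K P" "f \<in> S \<rightarrow> Hom C K P" using insert by auto
  have gf: "(\<lambda>j. g \<cdot> f j) \<in> S \<rightarrow> Hom C K Q" "g \<cdot> f j \<in> Hom C K Q"
    using comp_hom[OF _ assms(1)] f by (auto simp: Pi_iff)
  have fin: "finprod (hom_group C K P) f S \<in> Hom C K P" using P.finprod_closed[of f S] f by simp
  have "g \<cdot> finprod (hom_group C K P) f (insert j S) = g \<cdot> (f j \<boxplus> finprod (hom_group C K P) f S)"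
    using insert f by simp
  also have "\<dots> = g \<cdot> f j \<boxplus> g \<cdot> finprod (hom_group C K P) f S"
    using comp_add_right[OF f(1) fin assms(1)] .
  also have "\<dots> = finprod (hom_group C K Q) (\<lambda>j. g \<cdot> f j) (insert j S)"
    using insert gf f by simp
  finally show ?case .
qed

lemma coproduct_projections:
  assumes c: "is_coproduct C J X P \<iota>" and k: "k \<in> J"
  obtains p where "p \<in> Hom C P (X k)"
    "\<And>j. j \<in> J \<Longrightarrow> p \<cdot> \<iota> j = (if j = k then ident C (X k) else zero_arr C (X j) (X k))"
proof (rule coproduct_lift[OF c])
  have X: "X j \<in> obj C" if "j \<in> J" for j using Hom_obj(1)[OF coproductD(2)[OF c that]] .
  show "X k \<in> obj C" using X k .
  show "(if j = k then ident C (X k) else zero_arr C (X j) (X k)) \<in> Hom C (X j) (X k)" if "j \<in> J" for j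
    using X[OF that] X[OF k] zero_Hom ident_hom by auto
qed (rule that; assumption)

text \<open>Adding \<open>k\<close> to \<open>F\<close> adds the idempotent \<open>\<iota> k\<close>
  after \<open>p k\<close> to the truncation. This is the bridge between fixed points of truncations
  and the direct sums in the definition of compactness.\<close>

lemma truncation_finprod:
  assumes c: "is_coproduct C J X P \<iota>" and "finite F" "F \<subseteq> J"
    and p: "\<And>k. k \<in> J \<Longrightarrow> p k \<in> Hom C P (X k)"
      "\<And>k j. \<lbrakk>k \<in> J; j \<in> J\<rbrakk> \<Longrightarrow> p k \<cdot> \<iota> j = (if j = k then ident C (X k) else zero_arr C (X j) (X k))"
    and e: "is_truncation C J X P \<iota> F e" and u: "u \<in> Hom C K P"
  shows "e \<cdot> u = finprod (hom_group C K P) (\<lambda>j. \<iota> j \<cdot> (p j \<cdot> u)) F"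
  using assms(2,3) e
proof (induction F arbitrary: e rule: finite_induct)
  note P = coproductD[OF c]
  have X: "X j \<in> obj C" if "j \<in> J" for j using Hom_obj(1)[OF coproductD(2)[OF c that]] .
  interpret G: comm_group "hom_group C K P" by (intro hom_comm_group P Hom_obj[OF u])
  case empty
  have "e = zero_arr C P P"
  proof (rule coproduct_eqI[OF c])
    show "e \<in> Hom C P P" "zero_arr C P P \<in> Hom C P P"
      using empty.prems(2) zero_Hom P(1) by (auto simp: is_truncation_def)
    show "e \<cdot> \<iota> j = zero_arr C P P \<cdot> \<iota> j" if "j \<in> J" for j
      using empty.prems(2) P(1) P(2)[OF that] that by (simp add: is_truncation_def Hom_iff)
  qed
  then show ?case using u P(1) by (simp add: Hom_iff)
next
  note P = coproductD[OF c]
  have X: "X j \<in> obj C" if "j \<in> J" for j using Hom_obj(1)[OF coproductD(2)[OF c that]] .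
  interpret G: comm_group "hom_group C K P" by (intro hom_comm_group P Hom_obj[OF u])
  case (insert k F)
  have k: "k \<in> J" using insert by simp
  obtain d where d: "is_truncation C J X P \<iota> F d" using truncation_exists[OF c] .
  have dP: "d \<in> Hom C P P" using d by (simp add: is_truncation_def)
  have s: "\<iota> k \<cdot> p k \<in> Hom C P P" using comp_hom p(1) P(2) k by blast
  have "e = \<iota> k \<cdot> p k \<boxplus> d"
  proof (rule coproduct_eqI[OF c])
    show "e \<in> Hom C P P" using insert by (simp add: is_truncation_def)
    show "\<iota> k \<cdot> p k \<boxplus> d \<in> Hom C P P" using add_Hom s P(1) dP by blast
    fix j assume j: "j \<in> J"
    have "(\<iota> k \<cdot> p k \<boxplus> d) \<cdot> \<iota> j = \<iota> k \<cdot> (p k \<cdot> \<iota> j) \<boxplus> d \<cdot> \<iota> j"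
      using s dP P(2)[OF j] P(2)[OF k] p(1)[OF k] by (simp add: Hom_iff)
    then show "e \<cdot> \<iota> j = (\<iota> k \<cdot> p k \<boxplus> d) \<cdot> \<iota> j"
      using insert.prems(2) insert.hyps d j k p(2)[OF k j] P(2)[OF j] P(2)[OF k] X[OF j] X[OF k] P(1)
      by (auto simp: is_truncation_def Hom_iff add_zero_left add_zero_right)
  qed
  then have "e \<cdot> u = \<iota> k \<cdot> (p k \<cdot> u) \<boxplus> d \<cdot> u"
    using u s dP P(2)[OF k] p(1)[OF k] by (simp add: Hom_iff)
  moreover have "d \<cdot> u = finprod (hom_group C K P) (\<lambda>j. \<iota> j \<cdot> (p j \<cdot> u)) F"
    using insert.IH[OF _ d] insert.prems by auto
  moreover have "\<iota> j \<cdot> (p j \<cdot> u) \<in> Hom C K P" if "j \<in> J" for j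
    using comp_hom p(1) P(2) u that by blast
  ultimately show ?case using insert k by (subst G.finprod_insert) auto
qed

text \<open>Injectivity of the canonical map from the direct sum holds for every object
  \<open>K\<close>, by projecting to the summands. The content of compactness is surjectivity, and
  there a truncation fixing \<open>u\<close> exhibits \<open>u\<close> as the sum of its finitely
  many components.\<close>

lemma compactI:
  fixes sz :: "'i itself"
  assumes K: "K \<in> obj C"
    and fs: "\<And>(J :: 'i set) X P \<iota> u. \<lbrakk>small sz J; \<And>j. j \<in> J \<Longrightarrow> X j \<in> obj C; is_coproduct C J X P \<iota>;
      u \<in> Hom C K P\<rbrakk> \<Longrightarrow> finitely_supported C J X P \<iota> u"
  shows "compact_object sz C K"
  unfolding compact_object_def
proof (intro conjI allI impI K)
  fix J :: "'i set" and X P \<iota>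
  assume "small sz J \<and> (\<forall>j\<in>J. X j \<in> obj C) \<and> is_coproduct C J X P \<iota>"
  then have sm: "small sz J" and X: "\<And>j. j \<in> J \<Longrightarrow> X j \<in> obj C" and c: "is_coproduct C J X P \<iota>" by auto
  note P = coproductD[OF c]
  let ?G = "hom_group C K P" and ?S = "sum_group J (\<lambda>j. hom_group C K (X j))"
  let ?f = "\<lambda>x. gfinprod ?G (\<lambda>j. \<iota> j \<cdot> x j) J"
  interpret G: comm_group ?G by (intro hom_comm_group K P)
  have A: "group (hom_group C K (X j))" if "j \<in> J" for j
    using hom_comm_group[OF K X[OF that]] by (simp add: comm_group_def)
  interpret S: group ?S by (rule sum_group[OF A])
  have carr: "carrier ?S = {x \<in> \<Pi>\<^sub>E j\<in>J. Hom C K (X j). finite {j \<in> J. x j \<noteq> zero_arr C K (X j)}}"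
    using carrier_sum_group[of J "\<lambda>j. hom_group C K (X j)"] A by simp
  have hom: "?f \<in> hom ?S ?G"
  proof (rule G.hom_group_sum[OF _ A])
    fix j assume j: "j \<in> J"
    show "(\<lambda>x. \<iota> j \<cdot> x) \<in> hom (hom_group C K (X j)) ?G"
      using P(2)[OF j] comp_hom comp_add_right[OF _ _ P(2)[OF j]] by (auto intro!: homI)
  qed
  have "\<exists>p. \<forall>k\<in>J. p k \<in> Hom C P (X k) \<and>
    (\<forall>j\<in>J. p k \<cdot> \<iota> j = (if j = k then ident C (X k) else zero_arr C (X j) (X k)))"
    using coproduct_projections[OF c] by (intro bchoice) metis
  then obtain p where p: "\<And>k. k \<in> J \<Longrightarrow> p k \<in> Hom C P (X k)"
    "\<And>k j. \<lbrakk>k \<in> J; j \<in> J\<rbrakk> \<Longrightarrow> p k \<cdot> \<iota> j = (if j = k then ident C (X k) else zero_arr C (X j) (X k))"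
    by blast
  interpret f: group_hom ?S ?G ?f using hom by unfold_locales
  \<comment> \<open>The projection \<open>p k\<close> recovers the component \<open>x k\<close> from
    the sum, since all other summands are sent to zero.\<close>
  have "inj_on ?f (carrier ?S)"
  proof (rule f.inj_on_one_iff[THEN iffD2], intro allI impI)
    fix x assume x: "x \<in> carrier ?S" "?f x = \<one>\<^bsub>?G\<^esub>"
    have xj: "x j \<in> Hom C K (X j)" if "j \<in> J" for j using x(1) that carr by auto
    let ?F = "{j \<in> J. x j \<noteq> zero_arr C K (X j)}"
    have F: "finite ?F" using x(1) carr by auto
    have \<iota>x: "\<iota> j \<cdot> x j \<in> Hom C K P" if "j \<in> J" for j using comp_hom xj P(2) that by blast
    have "?f x = gfinprod ?G (\<lambda>j. \<iota> j \<cdot> x j) ?F"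
      by (rule G.gfinprod_mono_neutral_cong_right) (use \<iota>x P K in \<open>auto simp: Hom_iff\<close>)
    also have "\<dots> = finprod ?G (\<lambda>j. \<iota> j \<cdot> x j) ?F"
      by (rule G.gfinprod_eq_finprod[OF F]) (use \<iota>x in auto)
    finally have fx: "finprod ?G (\<lambda>j. \<iota> j \<cdot> x j) ?F = zero_arr C K P" using x(2) by simp
    have "x k = zero_arr C K (X k)" if k: "k \<in> J" for k
    proof (rule ccontr)
      assume kF: "x k \<noteq> zero_arr C K (X k)"
      interpret H: comm_group "hom_group C K (X k)" by (intro hom_comm_group K X k)
      have "zero_arr C K (X k) = p k \<cdot> finprod ?G (\<lambda>j. \<iota> j \<cdot> x j) ?F"
        using p(1)[OF k] K unfolding fx by (simp add: Hom_iff)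
      also have "\<dots> = finprod (hom_group C K (X k)) (\<lambda>j. p k \<cdot> \<iota> j \<cdot> x j) ?F"
        by (rule comp_finprod[OF p(1)[OF k] F _ K]) (use \<iota>x in auto)
      also have "\<dots> = finprod (hom_group C K (X k)) (\<lambda>j. if k = j then x k else \<one>\<^bsub>hom_group C K (X k)\<^esub>) ?F"
      proof (rule H.finprod_cong')
        show "(\<lambda>j. if k = j then x k else \<one>\<^bsub>hom_group C K (X k)\<^esub>) \<in> ?F \<rightarrow> carrier (hom_group C K (X k))"
          using xj[OF k] zero_Hom[OF K X[OF k]] by auto
        fix j assume "j \<in> ?F"
        then have j: "j \<in> J" by simp
        have "p k \<cdot> \<iota> j \<cdot> x j = (p k \<cdot> \<iota> j) \<cdot> x j" using p(1)[OF k] P(2)[OF j] xj[OF j] by (simp add: Hom_iff)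
        then show "p k \<cdot> \<iota> j \<cdot> x j = (if k = j then x k else \<one>\<^bsub>hom_group C K (X k)\<^esub>)"
          using p(2)[OF k j] xj[OF j] X[OF k] by (auto simp: Hom_iff)
      qed simp
      also have "\<dots> = x k"
        by (rule H.finprod_singleton[of k ?F "\<lambda>_. x k"]) (use F k kF xj in auto)
      finally show False using kF by simp
    qed
    then show "x = \<one>\<^bsub>?S\<^esub>" using x(1) carr by (auto simp: PiE_iff extensional_def)
  qed
  moreover have "u \<in> ?f ` carrier ?S" if u: "u \<in> carrier ?G" for u
  proof -
    have u: "u \<in> Hom C K P" using that by simp
    obtain F e where F: "finite F" "F \<subseteq> J" "is_truncation C J X P \<iota> F e" "e \<cdot> u = u"
      using fs[OF sm X c u] unfolding finitely_supported_def by blast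
    have pu: "p j \<cdot> u \<in> Hom C K (X j)" "\<iota> j \<cdot> (p j \<cdot> u) \<in> Hom C K P" if "j \<in> J" for j
      using comp_hom u p(1) P(2) that by blast+
    \<comment> \<open>The components off \<open>F\<close> are set to zero, which makes the support
      finite by construction; the sum over \<open>F\<close> already gives back
      \<open>u\<close>.\<close>
    define x where "x = (\<lambda>j\<in>J. if j \<in> F then p j \<cdot> u else zero_arr C K (X j))"
    have x: "x \<in> carrier ?S"
      unfolding carr x_def using pu zero_Hom[OF K X] F(1) by (auto intro: finite_subset)
    have \<iota>x: "\<iota> j \<cdot> x j \<in> Hom C K P" if "j \<in> J" for j using comp_hom P(2)[OF that] x carr that by blast
    have "?f x = gfinprod ?G (\<lambda>j. \<iota> j \<cdot> (p j \<cdot> u)) F"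
      by (rule G.gfinprod_mono_neutral_cong_right)
        (use F(2) \<iota>x P(2) K in \<open>auto simp: x_def Hom_iff subset_iff\<close>)
    also have "\<dots> = finprod ?G (\<lambda>j. \<iota> j \<cdot> (p j \<cdot> u)) F"
      by (rule G.gfinprod_eq_finprod[OF F(1)]) (use pu F(2) in auto)
    also have "\<dots> = u" using truncation_finprod[OF c F(1,2) p F(3) u] F(4) by simp
    finally show ?thesis using x by blast
  qed
  ultimately show "?f \<in> iso ?S ?G"
    using hom hom_carrier[OF hom] unfolding iso_def bij_betw_def by blast
qed

text \<open>Converse of \<open>compactI\<close>: the support of the preimage of \<open>u\<close> in
  the direct sum is a finite set whose truncation fixes every summand, and hence
  \<open>u\<close>.\<close>

lemma compact_finitely_supported:
  fixes sz :: "'i itself" and J :: "'i set"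
  assumes K: "compact_object sz C K" and J: "small sz J" "\<And>j. j \<in> J \<Longrightarrow> X j \<in> obj C"
    and c: "is_coproduct C J X P \<iota>" and u: "u \<in> Hom C K P"
  shows "finitely_supported C J X P \<iota> u"
proof -
  note P = coproductD[OF c]
  note Ko = Hom_obj(1)[OF u]
  let ?G = "hom_group C K P" and ?S = "sum_group J (\<lambda>j. hom_group C K (X j))"
  interpret G: comm_group ?G by (intro hom_comm_group Ko P)
  have "(\<lambda>x. gfinprod ?G (\<lambda>j. \<iota> j \<cdot> x j) J) \<in> iso ?S ?G"
    using K J c unfolding compact_object_def by blast
  then obtain x where x: "x \<in> carrier ?S" "u = gfinprod ?G (\<lambda>j. \<iota> j \<cdot> x j) J"
    using u unfolding iso_def bij_betw_def by auto
  have A: "group (hom_group C K (X j))" if "j \<in> J" for j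
    using hom_comm_group[OF Ko J(2)[OF that]] by (simp add: comm_group_def)
  have xs: "x j \<in> Hom C K (X j)" "finite {j \<in> J. x j \<noteq> zero_arr C K (X j)}" if "j \<in> J" for j
    using x(1) that carrier_sum_group[of J "\<lambda>j. hom_group C K (X j)"] A by auto
  have \<iota>x: "\<iota> j \<cdot> x j \<in> Hom C K P" if "j \<in> J" for j using comp_hom xs P(2) that by blast
  let ?F = "{j \<in> J. x j \<noteq> zero_arr C K (X j)}"
  have F: "finite ?F" using xs(2) by (cases "J = {}") auto
  have "u = gfinprod ?G (\<lambda>j. \<iota> j \<cdot> x j) ?F"
    unfolding x(2) by (rule G.gfinprod_mono_neutral_cong_right) (use \<iota>x P Ko in \<open>auto simp: Hom_iff\<close>)
  also have "\<dots> = finprod ?G (\<lambda>j. \<iota> j \<cdot> x j) ?F"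
    by (rule G.gfinprod_eq_finprod[OF F]) (use \<iota>x in auto)
  finally have ufp: "u = finprod ?G (\<lambda>j. \<iota> j \<cdot> x j) ?F" .
  obtain e where e: "is_truncation C J X P \<iota> ?F e" using truncation_exists[OF c] .
  have eP: "e \<in> Hom C P P" using e by (simp add: is_truncation_def)
  have "e \<cdot> u = finprod ?G (\<lambda>j. e \<cdot> \<iota> j \<cdot> x j) ?F"
    unfolding ufp by (rule comp_finprod[OF eP F _ Ko]) (use \<iota>x in auto)
  also have "\<dots> = finprod ?G (\<lambda>j. \<iota> j \<cdot> x j) ?F"
  proof (rule G.finprod_cong')
    fix j assume j: "j \<in> ?F"
    then have "e \<cdot> \<iota> j \<cdot> x j = (e \<cdot> \<iota> j) \<cdot> x j" using eP P(2) xs by (simp add: Hom_iff)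
    then show "e \<cdot> \<iota> j \<cdot> x j = \<iota> j \<cdot> x j" using e j by (simp add: is_truncation_def)
  qed (use \<iota>x in auto)
  finally have "e \<cdot> u = u" using ufp by simp
  then show ?thesis using e F unfolding finitely_supported_def by (intro exI[of _ ?F]) auto
qed

lemma compact_obj: "compact_object sz C K \<Longrightarrow> K \<in> obj C"
  by (simp add: compact_object_def)

text \<open>The decomposition of the identity of \<open>P\<close> writes any \<open>u\<close> as a
  sum of a map through \<open>K\<close> and a map through \<open>L\<close>; finite support survives
  precomposition and sums.\<close>

lemma compact_biproduct:
  fixes sz :: "'i itself"
  assumes K: "compact_object sz C K" and L: "compact_object sz C L"
    and b: "P \<in> obj C" "i \<in> Hom C K P" "j \<in> Hom C L P" "p \<in> Hom C P K" "q \<in> Hom C P L"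
      "(i \<cdot> p) \<boxplus> (j \<cdot> q) = ident C P"
  shows "compact_object sz C P"
proof (rule compactI[OF b(1)])
  fix J :: "'i set" and X Q \<iota> u
  assume a: "small sz J" "\<And>j. j \<in> J \<Longrightarrow> X j \<in> obj C" "is_coproduct C J X Q \<iota>" "u \<in> Hom C P Q"
  have h: "u \<cdot> i \<in> Hom C K Q" "u \<cdot> j \<in> Hom C L Q" using comp_hom a(4) b by blast+
  have f: "finitely_supported C J X Q \<iota> ((u \<cdot> i) \<cdot> p)" "finitely_supported C J X Q \<iota> ((u \<cdot> j) \<cdot> q)"
    using finitely_supported_comp[OF h(1) b(4) compact_finitely_supported[OF K a(1-3) h(1)]]
      finitely_supported_comp[OF h(2) b(5) compact_finitely_supported[OF L a(1-3) h(2)]] by simp_all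
  have "u = u \<cdot> ((i \<cdot> p) \<boxplus> (j \<cdot> q))" using a(4) by (simp add: b(6) Hom_iff)
  also have "\<dots> = (u \<cdot> i) \<cdot> p \<boxplus> (u \<cdot> j) \<cdot> q" using a(4) b(2-5) by (simp add: Hom_iff)
  finally show "finitely_supported C J X Q \<iota> u"
    using finitely_supported_add[OF a(3) comp_hom[OF b(4) h(1)] comp_hom[OF b(5) h(2)] f] by simp
qed

lemma compact_iso:
  fixes sz :: "'i itself"
  assumes K: "compact_object sz C K" and t: "t \<in> isos C L K"
  shows "compact_object sz C L"
proof (rule compactI)
  obtain s where s: "t \<in> Hom C L K" "s \<in> Hom C K L" "s \<cdot> t = ident C L" using isosE[OF t] by metis
  show "L \<in> obj C" using Hom_obj s(1) by blast
  fix J :: "'i set" and X Q \<iota> u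
  assume a: "small sz J" "\<And>j. j \<in> J \<Longrightarrow> X j \<in> obj C" "is_coproduct C J X Q \<iota>" "u \<in> Hom C L Q"
  have us: "u \<cdot> s \<in> Hom C K Q" using comp_hom s(2) a(4) by blast
  have "u \<cdot> (s \<cdot> t) = (u \<cdot> s) \<cdot> t" using s(1,2) a(4) by (simp add: Hom_iff)
  then have "(u \<cdot> s) \<cdot> t = u" using s(3) a(4) by (simp add: Hom_iff)
  then show "finitely_supported C J X Q \<iota> u"
    using finitely_supported_comp[OF us s(1) compact_finitely_supported[OF K a(1-3) us]] by simp
qed

end

section \<open>Compact objects under desuspension and fibres; the criterion for pure
  monomorphisms\<close>

context triangulated_category
begin

text \<open>An equivalence preserves coproducts. An arbitrary target \<open>Y\<close> is replaced by
  an isomorphic shift, so that cocones desuspend by fullness and uniqueness follows by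
  faithfulness.\<close>

lemma Sh_coproduct:
  assumes c: "is_coproduct C J X P \<iota>"
  shows "is_coproduct C J (\<lambda>j. Sh C (X j)) (Sh C P) (\<lambda>j. sh C (\<iota> j))"
  unfolding is_coproduct_def
proof (intro conjI ballI allI impI)
  note P = coproductD[OF c]
  show "Sh C P \<in> obj C" using P by simp
  show "sh C (\<iota> j) \<in> Hom C (Sh C (X j)) (Sh C P)" if "j \<in> J" for j using P that sh_Hom by blast
  fix Y f assume Y: "Y \<in> obj C" and f: "\<forall>j\<in>J. f j \<in> Hom C (Sh C (X j)) Y"
  obtain Z t where "Z \<in> obj C" and t: "t \<in> isos C (Sh C Z) Y" using shift_ess_surj[OF Y] by blast
  obtain s where s: "t \<in> Hom C (Sh C Z) Y" "s \<in> Hom C Y (Sh C Z)" "s \<in> isos C Y (Sh C Z)"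
    "s \<cdot> t = ident C (Sh C Z)" "t \<cdot> s = ident C Y" using isosE[OF t] by metis
  have X: "X j \<in> obj C" if "j \<in> J" for j using Hom_obj(1)[OF P(2)[OF that]] .
  have "\<exists>g. g \<in> Hom C (X j) Z \<and> sh C g = s \<cdot> f j" if "j \<in> J" for j
    using sh_full[OF X[OF that] \<open>Z \<in> obj C\<close>] comp_hom s(2) f that by metis
  then obtain g where g: "\<And>j. j \<in> J \<Longrightarrow> g j \<in> Hom C (X j) Z" "\<And>j. j \<in> J \<Longrightarrow> sh C (g j) = s \<cdot> f j"
    by metis
  obtain v where v: "v \<in> Hom C P Z" "\<And>j. j \<in> J \<Longrightarrow> v \<cdot> \<iota> j = g j"
    using coproduct_lift[OF c \<open>Z \<in> obj C\<close> g(1)] by blast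
  show "\<exists>!u. u \<in> Hom C (Sh C P) Y \<and> (\<forall>j\<in>J. u \<cdot> sh C (\<iota> j) = f j)"
  proof (intro ex1I[of _ "t \<cdot> sh C v"] conjI ballI)
    show "t \<cdot> sh C v \<in> Hom C (Sh C P) Y" using comp_hom sh_Hom v s(1) by blast
    fix j assume j: "j \<in> J"
    have "(t \<cdot> sh C v) \<cdot> sh C (\<iota> j) = t \<cdot> sh C (v \<cdot> \<iota> j)"
      using s(1) v(1) P(2)[OF j] by (simp add: Hom_iff sh_comp)
    also have "\<dots> = (t \<cdot> s) \<cdot> f j" using v(2)[OF j] g(2)[OF j] s(1,2) f j by (simp add: Hom_iff)
    finally show "(t \<cdot> sh C v) \<cdot> sh C (\<iota> j) = f j" using s(5) f j by (simp add: Hom_iff)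
  next
    fix u assume u: "u \<in> Hom C (Sh C P) Y \<and> (\<forall>j\<in>J. u \<cdot> sh C (\<iota> j) = f j)"
    obtain w where w: "w \<in> Hom C P Z" "sh C w = s \<cdot> u"
      using sh_full[OF P(1) \<open>Z \<in> obj C\<close>] comp_hom s(2) u by metis
    have "w = v"
    proof (rule coproduct_eqI[OF c w(1) v(1)])
      fix j assume j: "j \<in> J"
      have "sh C (w \<cdot> \<iota> j) = s \<cdot> (u \<cdot> sh C (\<iota> j))"
        using w u s(2) P(2)[OF j] by (simp add: Hom_iff sh_comp)
      then have "sh C (w \<cdot> \<iota> j) = sh C (v \<cdot> \<iota> j)" using u j g(2) v(2) by simp
      then show "w \<cdot> \<iota> j = v \<cdot> \<iota> j" using sh_inj comp_hom P(2)[OF j] w(1) v(1) by metis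
    qed
    then have "t \<cdot> sh C v = (t \<cdot> s) \<cdot> u" using w(2) u s(1,2) by (simp add: Hom_iff)
    then show "u = t \<cdot> sh C v" using s(5) u by (simp add: Hom_iff)
  qed
qed

lemma Sh_truncation:
  assumes c: "is_coproduct C J X P \<iota>" and e: "is_truncation C J X P \<iota> F e"
  shows "is_truncation C J (\<lambda>j. Sh C (X j)) (Sh C P) (\<lambda>j. sh C (\<iota> j)) F (sh C e)"
  unfolding is_truncation_def
proof (intro conjI ballI)
  note P = coproductD[OF c]
  have eP: "e \<in> Hom C P P" using e by (simp add: is_truncation_def)
  then show "sh C e \<in> Hom C (Sh C P) (Sh C P)" by (rule sh_Hom)
  fix j assume j: "j \<in> J"
  have "sh C e \<cdot> sh C (\<iota> j) = sh C (e \<cdot> \<iota> j)" using eP P(2)[OF j] by (simp add: Hom_iff sh_comp)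
  then show "sh C e \<cdot> sh C (\<iota> j) = (if j \<in> F then sh C (\<iota> j) else zero_arr C (Sh C (X j)) (Sh C P))"
    using e j P(1) Hom_obj(1)[OF P(2)[OF j]] by (simp add: is_truncation_def)
qed

text \<open>Shifting \<open>u\<close> gives a map from a compact object to the shifted coproduct,
  and the shift of a truncation is a truncation there.\<close>

lemma compact_desuspension:
  fixes sz :: "'i itself"
  assumes K: "compact_object sz C (Sh C A)" and A: "A \<in> obj C"
  shows "compact_object sz C A"
proof (rule compactI[OF A])
  fix J :: "'i set" and X P \<iota> u
  assume a: "small sz J" "\<And>j. j \<in> J \<Longrightarrow> X j \<in> obj C" "is_coproduct C J X P \<iota>" "u \<in> Hom C A P"
  note c' = Sh_coproduct[OF a(3)]
  have "finitely_supported C J (\<lambda>j. Sh C (X j)) (Sh C P) (\<lambda>j. sh C (\<iota> j)) (sh C u)"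
    by (rule compact_finitely_supported[OF K a(1) _ c' sh_Hom[OF a(4)]]) (use a(2) in simp)
  then obtain F d where F: "finite F" "F \<subseteq> J" "d \<cdot> sh C u = sh C u"
    "is_truncation C J (\<lambda>j. Sh C (X j)) (Sh C P) (\<lambda>j. sh C (\<iota> j)) F d"
    unfolding finitely_supported_def by blast
  obtain e where e: "is_truncation C J X P \<iota> F e" using truncation_exists[OF a(3)] .
  have eP: "e \<in> Hom C P P" using e by (simp add: is_truncation_def)
  \<comment> \<open>Compactness provides some truncation \<open>d\<close> of the shifted coproduct
    over \<open>F\<close>. Absorption replaces it by one that is the shift of \<open>e\<close>, so
    that faithfulness applies.\<close>
  have "sh C e \<cdot> sh C u = sh C u"
    using truncation_absorb[OF c' F(4) Sh_truncation[OF a(3) e] subset_refl sh_Hom[OF a(4)] F(3)] .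
  then have "sh C (e \<cdot> u) = sh C u" using eP a(4) by (simp add: Hom_iff sh_comp)
  then have "e \<cdot> u = u" using sh_inj comp_hom eP a(4) by metis
  then show "finitely_supported C J X P \<iota> u" using F e unfolding finitely_supported_def by blast
qed

lemma obtain_compact_desuspension:
  assumes K: "compact_object sz C K"
  obtains A t where "compact_object sz C A" "t \<in> isos C (Sh C A) K"
proof -
  obtain A t where "A \<in> obj C" "t \<in> isos C (Sh C A) K"
    using shift_ess_surj[OF compact_obj[OF K]] by blast
  with that compact_desuspension[OF compact_iso[OF K]] show thesis by blast
qed

text \<open>Rotating back gives a triangle \<open>A -> F -> L\<close> whose outer terms are compact.
  A truncation \<open>e\<close> that fixes the restriction of \<open>u\<close> to \<open>A\<close>
  makes \<open>u - e u\<close> vanish on \<open>A\<close>, so this difference factors through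
  \<open>L\<close> and is finitely supported; \<open>e u\<close> is finitely supported by
  construction.\<close>

lemma compact_fibre:
  fixes sz :: "'i itself"
  assumes K: "compact_object sz C K" and L: "compact_object sz C L"
    and tr: "is_triangle C F L K g f h"
  shows "compact_object sz C F"
proof (rule compactI)
  note D = triangleD[OF tr]
  show F: "F \<in> obj C" using Hom_obj D(1) by blast
  obtain A t where A: "compact_object sz C A" "t \<in> isos C (Sh C A) K"
    using obtain_compact_desuspension[OF K] .
  obtain k h' where tr': "is_triangle C A F L k g h'" using unrotate[OF tr compact_obj[OF A(1)] A(2)] .
  note k = triangleD(1)[OF tr']
  fix J :: "'i set" and X P \<iota> u
  assume a: "small sz J" "\<And>j. j \<in> J \<Longrightarrow> X j \<in> obj C" "is_coproduct C J X P \<iota>" "u \<in> Hom C F P"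
  note Po = coproductD(1)[OF a(3)]
  obtain S e where S: "finite S" "S \<subseteq> J" "is_truncation C J X P \<iota> S e" "e \<cdot> (u \<cdot> k) = u \<cdot> k"
    using compact_finitely_supported[OF A(1) a(1-3) comp_hom[OF k a(4)]]
    unfolding finitely_supported_def by blast
  have eP: "e \<in> Hom C P P" using S by (simp add: is_truncation_def)
  have eu: "e \<cdot> u \<in> Hom C F P" using comp_hom eP a(4) by blast
  have n: "neg C (e \<cdot> u) \<in> Hom C F P" using neg_Hom[OF F Po eu] .
  have d: "u \<boxplus> neg C (e \<cdot> u) \<in> Hom C F P" using add_Hom[OF F Po a(4) n] .
  have "(u \<boxplus> neg C (e \<cdot> u)) \<cdot> k = u \<cdot> k \<boxplus> neg C (e \<cdot> (u \<cdot> k))"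
    using k eP a(4) by (simp add: Hom_iff)
  also have "\<dots> = zero_arr C A P" using S(4) neg_right[OF _ Po comp_hom[OF k a(4)]] Hom_obj[OF k] by simp
  finally obtain w where w: "w \<in> Hom C L P" "w \<cdot> g = u \<boxplus> neg C (e \<cdot> u)"
    using triangle_cohomological[OF tr' d] by blast
  have "(u \<boxplus> neg C (e \<cdot> u)) \<boxplus> e \<cdot> u = u"
    using add_assoc[OF F Po a(4) n eu] neg_left[OF F Po eu] add_zero_right[OF F Po a(4)] by simp
  then have "u = w \<cdot> g \<boxplus> e \<cdot> u" using w by simp
  moreover have "finitely_supported C J X P \<iota> (w \<cdot> g \<boxplus> e \<cdot> u)"
    by (intro finitely_supported_add[OF a(3) comp_hom[OF D(1) w(1)] eu]
      finitely_supported_comp[OF w(1) D(1)] compact_finitely_supported[OF L a(1-3) w(1)]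
      finitely_supported_truncation[OF a(3) S(3,1,2) a(4)])
  ultimately show "finitely_supported C J X P \<iota> u" by simp
qed

text \<open>Injectivity on maps out of all compact objects is enough. Exactness in the middle holds
  in every triangle, and surjectivity onto \<open>Hom C K Z\<close> follows from injectivity applied
  to a desuspension of \<open>K\<close>, because \<open>\<gamma>\<close> after \<open>z\<close> is
  killed by the shift of \<open>\<alpha>\<close>.\<close>

lemma pure_monoI:
  assumes \<alpha>: "\<alpha> \<in> Hom C X Y"
    and mono: "\<And>K v. \<lbrakk>compact_object sz C K; v \<in> Hom C K X; \<alpha> \<cdot> v = zero_arr C K Y\<rbrakk> \<Longrightarrow> v = zero_arr C K X"
  shows "pure_mono sz C X Y \<alpha>"
proof -
  note o [simp] = Hom_obj[OF \<alpha>]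
  obtain Z \<beta> \<gamma> where tr: "is_triangle C X Y Z \<alpha> \<beta> \<gamma>" using tri_complete[OF \<alpha>] by blast
  note D = triangleD[OF tr]
  have Zo [simp]: "Z \<in> obj C" using Hom_obj D(2) by blast
  have A [simp]: "\<alpha> \<in> arr C" "src C \<alpha> = X" "tgt C \<alpha> = Y" "\<beta> \<in> arr C" "src C \<beta> = Y" "tgt C \<beta> = Z"
    "\<gamma> \<in> arr C" "src C \<gamma> = Z" "tgt C \<gamma> = Sh C X" using D by (auto simp: Hom_iff)
  have \<beta>\<alpha>: "\<beta> \<cdot> \<alpha> = zero_arr C X Z" using triangle_comp_zero[OF tr] .
  \<comment> \<open>After two rotations \<open>\<gamma>\<close> and the negated shift of
    \<open>\<alpha>\<close> are consecutive; the following lines remove the sign.\<close>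
  have "neg C (sh C \<alpha>) \<cdot> \<gamma> = zero_arr C Z (Sh C Y)" using triangle_comp_zero[OF rotate[OF rotate[OF tr]]] .
  then have "neg C (neg C (sh C \<alpha> \<cdot> \<gamma>)) = neg C (zero_arr C Z (Sh C Y))" by simp
  then have \<alpha>\<gamma>: "sh C \<alpha> \<cdot> \<gamma> = zero_arr C Z (Sh C Y)"
    using neg_neg[of Z "Sh C Y" "sh C \<alpha> \<cdot> \<gamma>"] neg_eqI[of Z "Sh C Y" "zero_arr C Z (Sh C Y)" "zero_arr C Z (Sh C Y)"]
      add_zero_left[of Z "Sh C Y" "zero_arr C Z (Sh C Y)"] by (simp add: Hom_iff)
  have "inj_on (\<lambda>u. \<alpha> \<cdot> u) (Hom C K X)" if K: "compact_object sz C K" for K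
  proof (rule inj_onI)
    fix u v assume u: "u \<in> Hom C K X" and v: "v \<in> Hom C K X" and e: "\<alpha> \<cdot> u = \<alpha> \<cdot> v"
    have Ko: "K \<in> obj C" using Hom_obj u by blast
    have d: "u \<boxplus> neg C v \<in> Hom C K X" using add_Hom neg_Hom u v Ko o by blast
    have "\<alpha> \<cdot> (u \<boxplus> neg C v) = \<alpha> \<cdot> v \<boxplus> neg C (\<alpha> \<cdot> v)" using u v by (simp add: Hom_iff flip: e)
    also have "\<dots> = zero_arr C K Y" by (rule neg_right[OF Ko o(2) comp_hom[OF v \<alpha>]])
    finally show "u = v" using mono[OF K d] eq_if_diff_zero[OF u v] by blast
  qed
  moreover have "(\<lambda>u. \<alpha> \<cdot> u) ` Hom C K X = {v \<in> Hom C K Y. \<beta> \<cdot> v = zero_arr C K Z}" (is "?L = ?R") for K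
  proof
    show "?L \<subseteq> ?R"
    proof
      fix v assume "v \<in> ?L"
      then obtain u where u: "u \<in> Hom C K X" "v = \<alpha> \<cdot> u" by auto
      have "\<beta> \<cdot> v = (\<beta> \<cdot> \<alpha>) \<cdot> u" using u by (simp add: Hom_iff)
      then show "v \<in> ?R" using u comp_hom[OF u(1) \<alpha>] by (auto simp: \<beta>\<alpha> Hom_iff)
    qed
    show "?R \<subseteq> ?L" using triangle_homological[OF tr] by (smt (verit, best) image_eqI mem_Collect_eq subsetI)
  qed
  moreover have "(\<lambda>v. \<beta> \<cdot> v) ` Hom C K Y = Hom C K Z" if K: "compact_object sz C K" for K
  proof
    show "(\<lambda>v. \<beta> \<cdot> v) ` Hom C K Y \<subseteq> Hom C K Z" using comp_hom[OF _ D(2)] by auto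
    show "Hom C K Z \<subseteq> (\<lambda>v. \<beta> \<cdot> v) ` Hom C K Y"
    proof
      fix z assume z: "z \<in> Hom C K Z"
      have Ko [simp]: "K \<in> obj C" using Hom_obj z by blast
      obtain L t where L: "compact_object sz C L" and t: "t \<in> isos C (Sh C L) K"
        using obtain_compact_desuspension[OF K] .
      note Lo [simp] = compact_obj[OF L] and tH = iso_Hom[OF t]
      have [simp]: "t \<in> arr C" "src C t = Sh C L" "tgt C t = K" "z \<in> arr C" "src C z = K" "tgt C z = Z"
        using tH z by (auto simp: Hom_iff)
      \<comment> \<open>Precomposing with \<open>t\<close> turns the obstruction to lifting
        \<open>z\<close> into a map between shifts. It desuspends to \<open>a : L -> X\<close>,
        which \<open>mono\<close> forces to be zero.\<close>
      have "\<gamma> \<cdot> (z \<cdot> t) \<in> Hom C (Sh C L) (Sh C X)" by (simp add: Hom_iff)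
      then obtain a where a: "a \<in> Hom C L X" "sh C a = \<gamma> \<cdot> (z \<cdot> t)"
        using sh_full[OF Lo o(1)] by blast
      have "sh C (\<alpha> \<cdot> a) = (sh C \<alpha> \<cdot> \<gamma>) \<cdot> (z \<cdot> t)"
        using a(1) by (simp add: sh_comp a(2) Hom_iff)
      also have "\<dots> = sh C (zero_arr C L Y)" by (simp add: \<alpha>\<gamma>)
      finally have "\<alpha> \<cdot> a = zero_arr C L Y" using sh_inj[OF comp_hom[OF a(1) \<alpha>] zero_Hom] by simp
      then have "a = zero_arr C L X" by (rule mono[OF L a(1)])
      then have "(\<gamma> \<cdot> z) \<cdot> t = zero_arr C K (Sh C X) \<cdot> t" using a(2) by simp
      then have "\<gamma> \<cdot> z = zero_arr C K (Sh C X)"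
        by (rule iso_epic[OF t, rotated 2]) (simp_all add: Hom_iff)
      then obtain u where "u \<in> Hom C K Y" "\<beta> \<cdot> u = z" using triangle_homological[OF rotate[OF tr] z] by blast
      then show "z \<in> (\<lambda>v. \<beta> \<cdot> v) ` Hom C K Y" by blast
    qed
  qed
  ultimately show ?thesis unfolding pure_mono_def using tr by blast
qed

end

section \<open>Closed symmetric monoidal categories\<close>

context symmetric_monoidal
begin

declare tensor_obj [simp]
declare unit_obj [simp]

lemma tensor_simps [simp]:
  assumes "f \<in> arr C" "g \<in> arr C"
  shows "f \<star> g \<in> arr C" "src C (f \<star> g) = src C f \<boxtimes> src C g" "tgt C (f \<star> g) = tgt C f \<boxtimes> tgt C g"
  using tensor_hom[of f "src C f" "tgt C f" g "src C g" "tgt C g"] assms by (auto simp: Hom_iff)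

lemma tensor_comp':
  "\<lbrakk>f \<in> arr C; f' \<in> arr C; g \<in> arr C; g' \<in> arr C; tgt C f = src C f'; tgt C g = src C g'\<rbrakk>
    \<Longrightarrow> (f' \<star> g') \<cdot> (f \<star> g) = (f' \<cdot> f) \<star> (g' \<cdot> g)"
  using tensor_comp[of f "src C f" "tgt C f" f' "tgt C f'" g "src C g" "tgt C g" g' "tgt C g'"]
  by (auto simp: Hom_iff)

lemma swap_simps [simp]:
  assumes "X \<in> obj C" "Y \<in> obj C"
  shows "swap C X Y \<in> arr C" "src C (swap C X Y) = X \<boxtimes> Y" "tgt C (swap C X Y) = Y \<boxtimes> X"
  using iso_Hom[OF swap_iso[OF assms]] by (auto simp: Hom_iff)

lemma lunit_simps [simp]:
  assumes "X \<in> obj C"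
  shows "lunit C X \<in> arr C" "src C (lunit C X) = unit C \<boxtimes> X" "tgt C (lunit C X) = X"
  using iso_Hom[OF lunit_iso[OF assms]] by (auto simp: Hom_iff)

text \<open>Composites are bracketed to the right, so naturality is needed with a further arrow
  \<open>u\<close> behind it; the primed lemmas below have the same purpose.\<close>

lemma swap_nat':
  assumes "f \<in> arr C" "g \<in> arr C" "u \<in> arr C" "tgt C u = src C f \<boxtimes> src C g"
  shows "swap C (tgt C f) (tgt C g) \<cdot> ((f \<star> g) \<cdot> u) = (g \<star> f) \<cdot> (swap C (src C f) (src C g) \<cdot> u)"
proof -
  note o = src_obj[OF assms(1)] src_obj[OF assms(2)] tgt_obj[OF assms(1)] tgt_obj[OF assms(2)]
  have "swap C (tgt C f) (tgt C g) \<cdot> ((f \<star> g) \<cdot> u) = (swap C (tgt C f) (tgt C g) \<cdot> (f \<star> g)) \<cdot> u"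
    using assms o by simp
  also have "swap C (tgt C f) (tgt C g) \<cdot> (f \<star> g) = (g \<star> f) \<cdot> swap C (src C f) (src C g)"
    using assms(1,2) by (intro swap_nat) (auto simp: Hom_iff)
  finally show ?thesis using assms o by simp
qed

lemma swap_swap':
  assumes "X \<in> obj C" "Y \<in> obj C" "u \<in> arr C" "tgt C u = X \<boxtimes> Y"
  shows "swap C Y X \<cdot> (swap C X Y \<cdot> u) = u"
proof -
  have "swap C Y X \<cdot> (swap C X Y \<cdot> u) = (swap C Y X \<cdot> swap C X Y) \<cdot> u" using assms by simp
  then show ?thesis using swap_swap[OF assms(1,2)] assms by simp
qed

lemma lunit_nat':
  assumes "f \<in> arr C" "u \<in> arr C" "tgt C u = unit C \<boxtimes> src C f"
  shows "lunit C (tgt C f) \<cdot> ((ident C (unit C) \<star> f) \<cdot> u) = f \<cdot> (lunit C (src C f) \<cdot> u)"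
proof -
  note o = src_obj[OF assms(1)] tgt_obj[OF assms(1)]
  have "lunit C (tgt C f) \<cdot> ((ident C (unit C) \<star> f) \<cdot> u) = (lunit C (tgt C f) \<cdot> (ident C (unit C) \<star> f)) \<cdot> u"
    using assms o by simp
  also have "lunit C (tgt C f) \<cdot> (ident C (unit C) \<star> f) = f \<cdot> lunit C (src C f)"
    using assms(1) by (intro lunit_nat) (auto simp: Hom_iff)
  finally show ?thesis using assms o by simp
qed

end

context closed_symmetric_monoidal
begin

declare ihom_obj [simp]

lemma ev_simps [simp]:
  assumes "X \<in> obj C" "Y \<in> obj C"
  shows "ev C X Y \<in> arr C" "src C (ev C X Y) = ihom C X Y \<boxtimes> X" "tgt C (ev C X Y) = Y"
  using ev_hom[OF assms] by (auto simp: Hom_iff)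

lemma transpose_arr:
  assumes "X \<in> obj C" "Y \<in> obj C" "Z \<in> obj C" "f \<in> Hom C (Z \<boxtimes> X) Y"
  shows "transpose_arr C Z X Y f \<in> Hom C Z (ihom C X Y)"
    "ev C X Y \<cdot> (transpose_arr C Z X Y f \<star> ident C X) = f"
  using theI'[OF ev_universal[OF assms]] unfolding transpose_arr_def by auto

lemma ev_eqI:
  assumes "X \<in> obj C" "Y \<in> obj C" "g \<in> Hom C Z (ihom C X Y)" "h \<in> Hom C Z (ihom C X Y)"
    "ev C X Y \<cdot> (g \<star> ident C X) = ev C X Y \<cdot> (h \<star> ident C X)"
  shows "g = h"
proof -
  have Z: "Z \<in> obj C" using Hom_obj assms(3) by blast
  have "ev C X Y \<cdot> (g \<star> ident C X) \<in> Hom C (Z \<boxtimes> X) Y" using assms Z by (simp add: Hom_iff)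
  from ev_universal[OF assms(1,2) Z this] show ?thesis using assms(3-5) by metis
qed

end

section \<open>Rigid objects, and homological exactness of the tensor product\<close>

context tt_category
begin

lemma zero_tensor:
  assumes "X \<in> obj C" "Y \<in> obj C" "W \<in> obj C"
  shows "zero_arr C X Y \<star> ident C W = zero_arr C (X \<boxtimes> W) (Y \<boxtimes> W)"
proof (rule self_add_zero)
  have z: "zero_arr C X Y \<in> Hom C X Y" using zero_Hom assms by simp
  show "zero_arr C X Y \<star> ident C W \<in> Hom C (X \<boxtimes> W) (Y \<boxtimes> W)" using assms by (simp add: Hom_iff)
  show "zero_arr C X Y \<star> ident C W \<boxplus> zero_arr C X Y \<star> ident C W = zero_arr C X Y \<star> ident C W"
    using tensor_add[OF z z assms(3)] add_zero_left[OF assms(1,2) z] by simp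
qed

lemma assoc_simps [simp]:
  assumes "X \<in> obj C" "Y \<in> obj C" "Z \<in> obj C"
  shows "assoc C X Y Z \<in> arr C" "src C (assoc C X Y Z) = (X \<boxtimes> Y) \<boxtimes> Z" "tgt C (assoc C X Y Z) = X \<boxtimes> (Y \<boxtimes> Z)"
  using iso_Hom[OF assoc_iso[OF assms]] by (auto simp: Hom_iff)

lemma assoc_inv:
  assumes "X \<in> obj C" "Y \<in> obj C" "Z \<in> obj C"
  shows "assoc_inv C X Y Z \<in> Hom C (X \<boxtimes> (Y \<boxtimes> Z)) ((X \<boxtimes> Y) \<boxtimes> Z)"
    "assoc_inv C X Y Z \<cdot> assoc C X Y Z = ident C ((X \<boxtimes> Y) \<boxtimes> Z)"
    "assoc C X Y Z \<cdot> assoc_inv C X Y Z = ident C (X \<boxtimes> (Y \<boxtimes> Z))"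
proof -
  let ?P = "\<lambda>g. g \<in> Hom C (X \<boxtimes> (Y \<boxtimes> Z)) ((X \<boxtimes> Y) \<boxtimes> Z) \<and>
        g \<cdot> assoc C X Y Z = ident C ((X \<boxtimes> Y) \<boxtimes> Z) \<and> assoc C X Y Z \<cdot> g = ident C (X \<boxtimes> (Y \<boxtimes> Z))"
  obtain g where g: "?P g" using isosE[OF assoc_iso[OF assms]] by metis
  have "h = g" if "?P h" for h
    using iso_monic[OF assoc_iso[OF assms]] g that by metis
  with g have "?P (assoc_inv C X Y Z)" unfolding assoc_inv_def by (rule theI)
  then show "assoc_inv C X Y Z \<in> Hom C (X \<boxtimes> (Y \<boxtimes> Z)) ((X \<boxtimes> Y) \<boxtimes> Z)"
    "assoc_inv C X Y Z \<cdot> assoc C X Y Z = ident C ((X \<boxtimes> Y) \<boxtimes> Z)"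
    "assoc C X Y Z \<cdot> assoc_inv C X Y Z = ident C (X \<boxtimes> (Y \<boxtimes> Z))" by auto
qed

lemma assoc_inv_simps [simp]:
  assumes "X \<in> obj C" "Y \<in> obj C" "Z \<in> obj C"
  shows "assoc_inv C X Y Z \<in> arr C" "src C (assoc_inv C X Y Z) = X \<boxtimes> (Y \<boxtimes> Z)"
    "tgt C (assoc_inv C X Y Z) = (X \<boxtimes> Y) \<boxtimes> Z"
  using assoc_inv(1)[OF assms] by (auto simp: Hom_iff)

lemma assoc_inv_nat:
  assumes f: "f \<in> Hom C X X'" and g: "g \<in> Hom C Y Y'" and h: "h \<in> Hom C Z Z'"
  shows "assoc_inv C X' Y' Z' \<cdot> (f \<star> (g \<star> h)) = ((f \<star> g) \<star> h) \<cdot> assoc_inv C X Y Z"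
proof -
  note [simp] = Hom_obj[OF f] Hom_obj[OF g] Hom_obj[OF h]
  have [simp]: "f \<in> arr C" "src C f = X" "tgt C f = X'" "g \<in> arr C" "src C g = Y" "tgt C g = Y'"
    "h \<in> arr C" "src C h = Z" "tgt C h = Z'" using f g h by (auto simp: Hom_iff)
  have "assoc_inv C X' Y' Z' \<cdot> (f \<star> (g \<star> h))
      = assoc_inv C X' Y' Z' \<cdot> (((f \<star> (g \<star> h)) \<cdot> assoc C X Y Z) \<cdot> assoc_inv C X Y Z)"
    by (simp add: assoc_inv(3))
  also have "\<dots> = (assoc_inv C X' Y' Z' \<cdot> assoc C X' Y' Z') \<cdot> (((f \<star> g) \<star> h) \<cdot> assoc_inv C X Y Z)"
    unfolding assoc_nat[OF f g h, symmetric] by simp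
  finally show ?thesis by (simp add: assoc_inv(2))
qed

text \<open>The arrow whose transpose is \<open>rigid_map\<close>. Its naturality in
  \<open>Y\<close> can be checked on the composite itself, without passing through the internal
  hom.\<close>

definition pre_rigid_map :: "'o \<Rightarrow> 'o \<Rightarrow> 'a" where
  "pre_rigid_map X Y = (let D = ihom C X (unit C) in
     lunit C Y \<cdot> (ev C X (unit C) \<star> ident C Y) \<cdot> assoc_inv C D X Y \<cdot> (ident C D \<star> swap C Y X) \<cdot> assoc C D Y X)"

lemma pre_rigid_map_Hom:
  assumes "X \<in> obj C" "Y \<in> obj C"
  shows "pre_rigid_map X Y \<in> Hom C ((ihom C X (unit C) \<boxtimes> Y) \<boxtimes> X) Y"
  unfolding pre_rigid_map_def Let_def using assms by (simp add: Hom_iff)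

lemma rigid_map:
  assumes "X \<in> obj C" "Y \<in> obj C"
  shows "rigid_map C X Y \<in> Hom C (ihom C X (unit C) \<boxtimes> Y) (ihom C X Y)"
    "ev C X Y \<cdot> (rigid_map C X Y \<star> ident C X) = pre_rigid_map X Y"
proof -
  have e: "rigid_map C X Y = transpose_arr C (ihom C X (unit C) \<boxtimes> Y) X Y (pre_rigid_map X Y)"
    unfolding rigid_map_def pre_rigid_map_def Let_def by simp
  show "rigid_map C X Y \<in> Hom C (ihom C X (unit C) \<boxtimes> Y) (ihom C X Y)"
    "ev C X Y \<cdot> (rigid_map C X Y \<star> ident C X) = pre_rigid_map X Y"
    unfolding e using transpose_arr[OF assms _ pre_rigid_map_Hom[OF assms]] assms by simp_all
qed

text \<open>The arrow \<open>v\<close> is moved through the five factors one at a time: associator,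
  swap and inverse associator by naturality, evaluation by interchange, left unitor by
  naturality.\<close>

lemma pre_rigid_map_nat:
  assumes X [simp]: "X \<in> obj C" and v: "v \<in> Hom C Y Z"
  shows "pre_rigid_map X Z \<cdot> ((ident C (ihom C X (unit C)) \<star> v) \<star> ident C X) = v \<cdot> pre_rigid_map X Y"
proof -
  define D where "D = ihom C X (unit C)"
  have [simp]: "D \<in> obj C" by (simp add: D_def)
  note [simp] = Hom_obj[OF v]
  have V [simp]: "v \<in> arr C" "src C v = Y" "tgt C v = Z" using v by (auto simp: Hom_iff)
  have e [simp]: "ev C X (unit C) \<in> arr C" "src C (ev C X (unit C)) = D \<boxtimes> X" "tgt C (ev C X (unit C)) = unit C"
    by (simp_all add: D_def)
  let ?e = "ev C X (unit C)"
  have i: "ident C X \<in> Hom C X X" "ident C D \<in> Hom C D D" by (simp_all add: Hom_iff)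
  have "pre_rigid_map X Z \<cdot> ((ident C D \<star> v) \<star> ident C X)
      = lunit C Z \<cdot> ((?e \<star> ident C Z) \<cdot> (assoc_inv C D X Z \<cdot> ((ident C D \<star> swap C Z X) \<cdot>
         (assoc C D Z X \<cdot> ((ident C D \<star> v) \<star> ident C X)))))"
    unfolding pre_rigid_map_def Let_def D_def[symmetric] by simp
  also have "assoc C D Z X \<cdot> ((ident C D \<star> v) \<star> ident C X) = (ident C D \<star> (v \<star> ident C X)) \<cdot> assoc C D Y X"
    using assoc_nat[OF i(2) v i(1)] .
  also have "(ident C D \<star> swap C Z X) \<cdot> ((ident C D \<star> (v \<star> ident C X)) \<cdot> assoc C D Y X)
      = (ident C D \<star> (swap C Z X \<cdot> (v \<star> ident C X))) \<cdot> assoc C D Y X"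
    by (simp add: tensor_comp' flip: comp_assoc')
  also have "swap C Z X \<cdot> (v \<star> ident C X) = (ident C X \<star> v) \<cdot> swap C Y X"
    using swap_nat[OF v i(1)] .
  also have "(ident C D \<star> ((ident C X \<star> v) \<cdot> swap C Y X)) \<cdot> assoc C D Y X
      = (ident C D \<star> (ident C X \<star> v)) \<cdot> ((ident C D \<star> swap C Y X) \<cdot> assoc C D Y X)"
    by (simp add: tensor_comp' flip: comp_assoc')
  also have "assoc_inv C D X Z \<cdot> \<dots>
      = (assoc_inv C D X Z \<cdot> (ident C D \<star> (ident C X \<star> v))) \<cdot> ((ident C D \<star> swap C Y X) \<cdot> assoc C D Y X)"
    by simp
  also have "assoc_inv C D X Z \<cdot> (ident C D \<star> (ident C X \<star> v)) = (ident C (D \<boxtimes> X) \<star> v) \<cdot> assoc_inv C D X Y"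
    using assoc_inv_nat[OF i(2) i(1) v] by (simp add: tensor_ident)
  also have "(?e \<star> ident C Z) \<cdot> (((ident C (D \<boxtimes> X) \<star> v) \<cdot> assoc_inv C D X Y) \<cdot> ((ident C D \<star> swap C Y X) \<cdot> assoc C D Y X))
      = ((?e \<star> ident C Z) \<cdot> (ident C (D \<boxtimes> X) \<star> v)) \<cdot> (assoc_inv C D X Y \<cdot> ((ident C D \<star> swap C Y X) \<cdot> assoc C D Y X))"
    by simp
  also have "(?e \<star> ident C Z) \<cdot> (ident C (D \<boxtimes> X) \<star> v) = (ident C (unit C) \<star> v) \<cdot> (?e \<star> ident C Y)"
    by (simp add: tensor_comp')
  also have "lunit C Z \<cdot> (((ident C (unit C) \<star> v) \<cdot> (?e \<star> ident C Y)) \<cdot>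
        (assoc_inv C D X Y \<cdot> ((ident C D \<star> swap C Y X) \<cdot> assoc C D Y X)))
      = (lunit C Z \<cdot> (ident C (unit C) \<star> v)) \<cdot> ((?e \<star> ident C Y) \<cdot>
        (assoc_inv C D X Y \<cdot> ((ident C D \<star> swap C Y X) \<cdot> assoc C D Y X)))"
    by simp
  also have "lunit C Z \<cdot> (ident C (unit C) \<star> v) = v \<cdot> lunit C Y" using lunit_nat[OF v] .
  also have "(v \<cdot> lunit C Y) \<cdot> ((?e \<star> ident C Y) \<cdot>
        (assoc_inv C D X Y \<cdot> ((ident C D \<star> swap C Y X) \<cdot> assoc C D Y X))) = v \<cdot> pre_rigid_map X Y"
    unfolding pre_rigid_map_def Let_def D_def[symmetric] by simp
  finally show ?thesis unfolding D_def .
qed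

text \<open>
  The coevaluation of a rigid object detects morphisms; this is the one consequence of the
  triangle identities that is needed.
\<close>

lemma rigid_coevaluation:
  assumes "rigid_object C K"
  obtains D \<eta> where "D \<in> obj C" "\<eta> \<in> Hom C (unit C) (D \<boxtimes> K)"
    "\<And>X v. \<lbrakk>v \<in> Hom C K X; (ident C D \<star> v) \<cdot> \<eta> = zero_arr C (unit C) (D \<boxtimes> X)\<rbrakk> \<Longrightarrow> v = zero_arr C K X"
proof -
  have K [simp]: "K \<in> obj C" using assms by (simp add: rigid_object_def)
  define D where "D = ihom C K (unit C)"
  have D [simp]: "D \<in> obj C" by (simp add: D_def)
  have ri: "rigid_map C K K \<in> isos C (D \<boxtimes> K) (ihom C K K)"
    using assms K unfolding rigid_object_def D_def by blast
  obtain g where g: "g \<in> Hom C (ihom C K K) (D \<boxtimes> K)" "rigid_map C K K \<cdot> g = ident C (ihom C K K)"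
    using isosE[OF ri] by metis
  note rm = rigid_map[OF K K, folded D_def]
  have lu: "lunit C K \<in> Hom C (unit C \<boxtimes> K) K" by (simp add: Hom_iff)
  \<comment> \<open>The arrow from the unit to \<open>ihom C K K\<close> that names the identity of
    \<open>K\<close>.\<close>
  define j where "j = transpose_arr C (unit C) K K (lunit C K)"
  have j: "j \<in> Hom C (unit C) (ihom C K K)" "ev C K K \<cdot> (j \<star> ident C K) = lunit C K"
    unfolding j_def using transpose_arr[OF K K unit_obj lu] by auto
  \<comment> \<open>Rigidity inverts \<open>rigid_map C K K\<close>, which lifts the name of the
    identity to the coevaluation.\<close>
  define \<eta> where "\<eta> = g \<cdot> j"
  have \<eta>: "\<eta> \<in> Hom C (unit C) (D \<boxtimes> K)" unfolding \<eta>_def using comp_hom j(1) g(1) by blast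
  have rj: "rigid_map C K K \<cdot> \<eta> = j"
  proof -
    have "rigid_map C K K \<cdot> \<eta> = (rigid_map C K K \<cdot> g) \<cdot> j"
      unfolding \<eta>_def using rm(1) g(1) j(1) by (simp add: Hom_iff)
    then show ?thesis using g(2) j(1) by (simp add: Hom_iff)
  qed
  \<comment> \<open>The triangle identity for \<open>\<eta>\<close>, in the form that the composite
    from \<open>unit C \<boxtimes> K\<close> to \<open>K\<close> is the unitor.\<close>
  have pre: "pre_rigid_map K K \<cdot> (\<eta> \<star> ident C K) = lunit C K"
  proof -
    have "pre_rigid_map K K \<cdot> (\<eta> \<star> ident C K) = ev C K K \<cdot> ((rigid_map C K K \<star> ident C K) \<cdot> (\<eta> \<star> ident C K))"
      unfolding rm(2)[symmetric] using rm(1) \<eta> by (simp add: Hom_iff)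
    also have "\<dots> = ev C K K \<cdot> (j \<star> ident C K)"
      unfolding rj[symmetric] using rm(1) \<eta> by (simp add: Hom_iff tensor_comp')
    finally show ?thesis using j(2) by simp
  qed
  have "v = zero_arr C K X" if v: "v \<in> Hom C K X" and z: "(ident C D \<star> v) \<cdot> \<eta> = zero_arr C (unit C) (D \<boxtimes> X)" for X v
  proof -
    note [simp] = Hom_obj(2)[OF v]
    note p = pre_rigid_map_Hom[OF K K, folded D_def] pre_rigid_map_Hom[OF K Hom_obj(2)[OF v], folded D_def]
    \<comment> \<open>The triangle identity inserts \<open>\<eta>\<close> and naturality moves
      \<open>v\<close> next to it. So \<open>v\<close> is determined by its transpose
      \<open>z\<close>, which vanishes.\<close>
    have "v \<cdot> lunit C K = (v \<cdot> pre_rigid_map K K) \<cdot> (\<eta> \<star> ident C K)"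
      unfolding pre[symmetric] using v p(1) \<eta> by (simp add: Hom_iff)
    also have "\<dots> = (pre_rigid_map K X \<cdot> ((ident C D \<star> v) \<star> ident C K)) \<cdot> (\<eta> \<star> ident C K)"
      using pre_rigid_map_nat[OF K v] by (simp add: D_def)
    also have "\<dots> = pre_rigid_map K X \<cdot> (((ident C D \<star> v) \<cdot> \<eta>) \<star> ident C K)"
      using v p(2) \<eta> by (simp add: Hom_iff tensor_comp')
    also have "\<dots> = zero_arr C K X \<cdot> lunit C K"
      unfolding z using p(2) by (simp add: zero_tensor Hom_iff)
    finally show ?thesis using iso_epic[OF lunit_iso[OF K] v zero_Hom] by simp
  qed
  with that[OF D \<eta>] show thesis by blast
qed

text \<open>The axiom \<open>tensor_exact\<close> tensors with the fixed object on the right, while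
  the defining characters have \<open>X\<close> on the left; conjugation by the swap reconciles the
  two.\<close>

lemma tensor_homological:
  assumes tr: "is_triangle C F L K g f h" and X [simp]: "X \<in> obj C"
    and u: "u \<in> Hom C W (X \<boxtimes> L)" and z: "(ident C X \<star> f) \<cdot> u = zero_arr C W (X \<boxtimes> K)"
  obtains w where "w \<in> Hom C W (X \<boxtimes> F)" "(ident C X \<star> g) \<cdot> w = u"
proof -
  note D = triangleD[OF tr]
  note [simp] = Hom_obj[OF D(1)] Hom_obj[OF D(2)] Hom_obj[OF u]
  have [simp]: "f \<in> arr C" "src C f = L" "tgt C f = K" "g \<in> arr C" "src C g = F" "tgt C g = L"
    "u \<in> arr C" "src C u = W" "tgt C u = X \<boxtimes> L" using D u by (auto simp: Hom_iff)
  have s: "swap C X L \<cdot> u \<in> Hom C W (L \<boxtimes> X)" by (simp add: Hom_iff)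
  have "(f \<star> ident C X) \<cdot> (swap C X L \<cdot> u) = swap C X K \<cdot> ((ident C X \<star> f) \<cdot> u)"
    using swap_nat'[of "ident C X" f u] by simp
  also have "\<dots> = zero_arr C W (K \<boxtimes> X)" unfolding z by simp
  finally obtain w where w: "w \<in> Hom C W (F \<boxtimes> X)" "(g \<star> ident C X) \<cdot> w = swap C X L \<cdot> u"
    using triangle_homological[OF tensor_exact[OF tr X] s] by blast
  have [simp]: "w \<in> arr C" "src C w = W" "tgt C w = F \<boxtimes> X" using w(1) by (auto simp: Hom_iff)
  show thesis
  proof
    show "swap C F X \<cdot> w \<in> Hom C W (X \<boxtimes> F)" by (simp add: Hom_iff)
    have "(ident C X \<star> g) \<cdot> (swap C F X \<cdot> w) = swap C L X \<cdot> ((g \<star> ident C X) \<cdot> w)"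
      using swap_nat'[of g "ident C X" w] by simp
    then show "(ident C X \<star> g) \<cdot> (swap C F X \<cdot> w) = u" unfolding w(2) by (simp add: swap_swap')
  qed
qed

end

section \<open>Brown--Comenetz duality\<close>

locale brown_comenetz = tt_category C
  for C :: "('o, 'a, 'm) tt_category_scheme" (structure) +
  fixes I :: "('o, 'a, 'o, 'a) functr" and r :: "'o \<Rightarrow> 'o \<Rightarrow> 'a \<Rightarrow> 'a \<Rightarrow> rat set"
  assumes I: "contravariant_functor C C I"
    and r_iso: "\<lbrakk>X \<in> obj C; Y \<in> obj C\<rbrakk>
      \<Longrightarrow> r X Y \<in> iso (hom_group C Y (fobj I X)) (character_group (hom_group C (unit C) (X \<boxtimes> Y)))"
    and r_nat_right: "\<lbrakk>X \<in> obj C; k \<in> Hom C Y' Y; g \<in> Hom C Y (fobj I X); u \<in> Hom C (unit C) (X \<boxtimes> Y')\<rbrakk>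
      \<Longrightarrow> r X Y' (g \<cdot> k) u = r X Y g ((ident C X \<star> k) \<cdot> u)"
    and r_nat_left: "\<lbrakk>Y \<in> obj C; f \<in> Hom C X X'; g \<in> Hom C Y (fobj I X'); u \<in> Hom C (unit C) (X \<boxtimes> Y)\<rbrakk>
      \<Longrightarrow> r X Y (farr I f \<cdot> g) u = r X' Y g ((f \<star> ident C Y) \<cdot> u)"
begin

abbreviation dual :: "'o \<Rightarrow> 'o" where "dual \<equiv> fobj I"
abbreviation dual_arr :: "'a \<Rightarrow> 'a" where "dual_arr \<equiv> farr I"
abbreviation global :: "'o \<Rightarrow> 'a set" where "global X \<equiv> Hom C (unit C) X"

lemmas dualD = contravariant_functorD[OF I]
lemmas dual_obj [simp] = dualD(1)

lemma dual_arr_simps [simp]: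
  assumes "f \<in> arr C"
  shows "dual_arr f \<in> arr C" "src C (dual_arr f) = dual (tgt C f)" "tgt C (dual_arr f) = dual (src C f)"
  using dualD(3)[of f "src C f" "tgt C f"] assms by (auto simp: Hom_iff)

lemma dual_comp:
  "\<lbrakk>f \<in> arr C; g \<in> arr C; tgt C f = src C g\<rbrakk> \<Longrightarrow> dual_arr (g \<cdot> f) = dual_arr f \<cdot> dual_arr g"
  using dualD(4)[of f "src C f" "src C g" g "tgt C g"] by (auto simp: Hom_iff)

lemma r_character:
  assumes "g \<in> Hom C Y (dual X)" "X \<in> obj C"
  shows "r X Y g \<in> carrier (character_group (hom_group C (unit C) (X \<boxtimes> Y)))"
  using hom_in_carrier[of "r X Y"] r_iso[OF assms(2) Hom_obj(1)[OF assms(1)]] assms(1)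
  by (auto simp: iso_def hom_def)

lemma r_hom:
  assumes "g \<in> Hom C Y (dual X)" "X \<in> obj C"
  shows "r X Y g \<in> hom (hom_group C (unit C) (X \<boxtimes> Y)) QZ"
  using r_character[OF assms] by (simp add: character_group_def)

lemma r_add_right:
  assumes "g \<in> Hom C Y (dual X)" "X \<in> obj C" "u \<in> global (X \<boxtimes> Y)" "v \<in> global (X \<boxtimes> Y)"
  shows "r X Y g (u \<boxplus> v) = r X Y g u \<otimes>\<^bsub>QZ\<^esub> r X Y g v"
  using hom_mult[OF r_hom[OF assms(1,2)]] assms(3,4) by simp

lemma r_closed: "\<lbrakk>g \<in> Hom C Y (dual X); X \<in> obj C; u \<in> global (X \<boxtimes> Y)\<rbrakk> \<Longrightarrow> r X Y g u \<in> carrier QZ"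
  using hom_in_carrier[OF r_hom] by simp

lemma r_add_left:
  assumes "g \<in> Hom C Y (dual X)" "g' \<in> Hom C Y (dual X)" "X \<in> obj C" "u \<in> global (X \<boxtimes> Y)"
  shows "r X Y (g \<boxplus> g') u = r X Y g u \<otimes>\<^bsub>QZ\<^esub> r X Y g' u"
proof -
  have "r X Y \<in> hom (hom_group C Y (dual X)) (character_group (hom_group C (unit C) (X \<boxtimes> Y)))"
    using r_iso[OF assms(3) Hom_obj(1)[OF assms(1)]] by (simp add: iso_def)
  from hom_mult[OF this] assms show ?thesis by (simp add: character_group_def)
qed

text \<open>The main tool of this section: equality of arrows into a dual is tested on the values of
  their characters.\<close>

lemma r_eqI:
  assumes "g \<in> Hom C Y (dual X)" "g' \<in> Hom C Y (dual X)" "X \<in> obj C"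
    "\<And>u. u \<in> global (X \<boxtimes> Y) \<Longrightarrow> r X Y g u = r X Y g' u"
  shows "g = g'"
proof -
  have "r X Y g = r X Y g'"
    by (rule character_group_eqI[OF r_character[OF assms(1,3)] r_character[OF assms(2,3)]]) (use assms(4) in simp)
  moreover have "inj_on (r X Y) (Hom C Y (dual X))"
    using r_iso[OF assms(3) Hom_obj(1)[OF assms(1)]] by (simp add: iso_def bij_betw_def)
  ultimately show ?thesis using assms(1,2) by (simp add: inj_on_def)
qed

lemma r_surj:
  assumes "X \<in> obj C" "Y \<in> obj C" "\<chi> \<in> hom (hom_group C (unit C) (X \<boxtimes> Y)) QZ"
  obtains g where "g \<in> Hom C Y (dual X)" "\<And>u. u \<in> global (X \<boxtimes> Y) \<Longrightarrow> r X Y g u = \<chi> u"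
proof -
  have "group (hom_group C (unit C) (X \<boxtimes> Y))"
    using hom_comm_group[of "unit C" "X \<boxtimes> Y"] assms by (simp add: comm_group_def)
  from character_groupI[OF this assms(3)]
  have "restrict \<chi> (global (X \<boxtimes> Y)) \<in> r X Y ` Hom C Y (dual X)"
    using r_iso[OF assms(1,2)] by (simp add: iso_def bij_betw_def)
  then obtain g where g: "g \<in> Hom C Y (dual X)" "restrict \<chi> (global (X \<boxtimes> Y)) = r X Y g" by auto
  show thesis by (rule that[OF g(1)]) (simp add: g(2)[symmetric])
qed

lemma r_zero_left:
  assumes "X \<in> obj C" "Y \<in> obj C" "u \<in> global (X \<boxtimes> Y)"
  shows "r X Y (zero_arr C Y (dual X)) u = \<one>\<^bsub>QZ\<^esub>"
proof -
  interpret Q: comm_group QZ by (rule comm_group_QZ)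
  have z: "zero_arr C Y (dual X) \<in> Hom C Y (dual X)" using zero_Hom assms by simp
  have "zero_arr C Y (dual X) \<boxplus> zero_arr C Y (dual X) = zero_arr C Y (dual X)"
    using add_zero_left[OF _ _ z] assms by simp
  with r_add_left[OF z z assms(1,3)] show ?thesis
    using Q.r_cancel_one r_closed[OF z assms(1,3)] by simp
qed

text \<open>The universal element of the representation. By Yoneda it determines all of
  \<open>r\<close> (\<open>r_pairing\<close>).\<close>

definition pairing :: "'o \<Rightarrow> 'a \<Rightarrow> rat set" where
  "pairing X = r X (dual X) (ident C (dual X))"

lemma r_pairing:
  assumes "X \<in> obj C" "g \<in> Hom C Y (dual X)" "u \<in> global (X \<boxtimes> Y)"
  shows "r X Y g u = pairing X ((ident C X \<star> g) \<cdot> u)"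
  using r_nat_right[OF assms(1,2) ident_hom assms(3)] assms unfolding pairing_def by (simp add: Hom_iff)

text \<open>Together with \<open>r_pairing\<close> this says that \<open>f\<close> and
  \<open>dual_arr f\<close> are adjoint for the pairings, which is the form in which naturality of
  \<open>r\<close> in \<open>X\<close> is used.\<close>

lemma r_dual_arr:
  assumes "f \<in> Hom C X X'" "u \<in> global (X \<boxtimes> dual X')"
  shows "r X (dual X') (dual_arr f) u = pairing X' ((f \<star> ident C (dual X')) \<cdot> u)"
  using r_nat_left[OF _ assms(1) ident_hom assms(2)] assms Hom_obj[OF assms(1)]
  unfolding pairing_def by (simp add: Hom_iff)

text \<open>The character required of \<open>i\<close> is the pairing read with its two factors
  exchanged. By \<open>r_eqI\<close> at most one arrow has it, so the choice is harmless.\<close>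

definition bidual :: "'o \<Rightarrow> 'a" where
  "bidual X = (SOME i. i \<in> Hom C X (dual (dual X)) \<and>
     (\<forall>u \<in> global (dual X \<boxtimes> X). r (dual X) X i u = pairing X (swap C (dual X) X \<cdot> u)))"

lemma postcomp_hom:
  assumes "f \<in> Hom C X Y" "W \<in> obj C"
  shows "(\<lambda>u. f \<cdot> u) \<in> hom (hom_group C W X) (hom_group C W Y)"
  using assms comp_hom[OF _ assms(1)] comp_add_right[OF _ _ assms(1)] by (auto intro!: homI)

lemma pairing_hom: "X \<in> obj C \<Longrightarrow> pairing X \<in> hom (hom_group C (unit C) (X \<boxtimes> dual X)) QZ"
  unfolding pairing_def by (intro r_hom ident_hom) auto

lemma bidual:
  assumes X: "X \<in> obj C"
  shows "bidual X \<in> Hom C X (dual (dual X))"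
    "u \<in> global (dual X \<boxtimes> X) \<Longrightarrow> r (dual X) X (bidual X) u = pairing X (swap C (dual X) X \<cdot> u)"
proof -
  have s: "swap C (dual X) X \<in> Hom C (dual X \<boxtimes> X) (X \<boxtimes> dual X)" using X by (simp add: Hom_iff)
  have "pairing X \<circ> (\<lambda>u. swap C (dual X) X \<cdot> u) \<in> hom (hom_group C (unit C) (dual X \<boxtimes> X)) QZ"
    using hom_compose[OF postcomp_hom[OF s unit_obj] pairing_hom[OF X]] .
  then obtain g where "g \<in> Hom C X (dual (dual X))"
    "\<And>u. u \<in> global (dual X \<boxtimes> X) \<Longrightarrow> r (dual X) X g u = pairing X (swap C (dual X) X \<cdot> u)"
    using r_surj[of "dual X" X] X by (metis comp_apply dual_obj)
  then have "\<exists>i. i \<in> Hom C X (dual (dual X)) \<and>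
     (\<forall>u \<in> global (dual X \<boxtimes> X). r (dual X) X i u = pairing X (swap C (dual X) X \<cdot> u))" by blast
  from someI_ex[OF this] show "bidual X \<in> Hom C X (dual (dual X))"
    "u \<in> global (dual X \<boxtimes> X) \<Longrightarrow> r (dual X) X (bidual X) u = pairing X (swap C (dual X) X \<cdot> u)"
    unfolding bidual_def by auto
qed

lemma bidual_simps [simp]:
  assumes "X \<in> obj C"
  shows "bidual X \<in> arr C" "src C (bidual X) = X" "tgt C (bidual X) = dual (dual X)"
  using bidual(1)[OF assms] by (auto simp: Hom_iff)

text \<open>Compared as characters, the left side pairs with \<open>dual_arr f\<close> applied to
  the dual factor and the right side with \<open>f\<close> applied to the other; adjointness of
  \<open>f\<close> and \<open>dual_arr f\<close> identifies them.\<close>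

lemma bidual_natural:
  assumes f: "f \<in> Hom C X Y"
  shows "dual_arr (dual_arr f) \<cdot> bidual X = bidual Y \<cdot> f"
proof (rule r_eqI[of _ X "dual Y"])
  note o [simp] = Hom_obj[OF f]
  have F [simp]: "f \<in> arr C" "src C f = X" "tgt C f = Y" using f by (auto simp: Hom_iff)
  have df: "dual_arr f \<in> Hom C (dual Y) (dual X)" using dualD(3)[OF f] .
  show "dual_arr (dual_arr f) \<cdot> bidual X \<in> Hom C X (dual (dual Y))"
    "bidual Y \<cdot> f \<in> Hom C X (dual (dual Y))" "dual Y \<in> obj C" by (simp_all add: Hom_iff)
  fix u assume u: "u \<in> global (dual Y \<boxtimes> X)"
  then have U [simp]: "u \<in> arr C" "src C u = unit C" "tgt C u = dual Y \<boxtimes> X" by (auto simp: Hom_iff)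
  have "r (dual Y) X (dual_arr (dual_arr f) \<cdot> bidual X) u
      = r (dual X) X (bidual X) ((dual_arr f \<star> ident C X) \<cdot> u)"
    by (rule r_nat_left[OF o(1) df bidual(1) u]) simp
  also have "\<dots> = pairing X (swap C (dual X) X \<cdot> ((dual_arr f \<star> ident C X) \<cdot> u))"
    by (rule bidual(2)) (simp_all add: Hom_iff)
  also have "\<dots> = pairing X ((ident C X \<star> dual_arr f) \<cdot> (swap C (dual Y) X \<cdot> u))"
    using swap_nat'[of "dual_arr f" "ident C X" u] by simp
  also have "\<dots> = r X (dual Y) (dual_arr f) (swap C (dual Y) X \<cdot> u)"
    by (rule r_pairing[symmetric]) (simp_all add: Hom_iff)
  also have "\<dots> = pairing Y ((f \<star> ident C (dual Y)) \<cdot> (swap C (dual Y) X \<cdot> u))"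
    by (rule r_dual_arr) (simp_all add: Hom_iff)
  also have "\<dots> = pairing Y (swap C (dual Y) Y \<cdot> ((ident C (dual Y) \<star> f) \<cdot> u))"
    using swap_nat'[of "ident C (dual Y)" f u] by simp
  also have "\<dots> = r (dual Y) Y (bidual Y) ((ident C (dual Y) \<star> f) \<cdot> u)"
    by (rule bidual(2)[symmetric]) (simp_all add: Hom_iff)
  also have "\<dots> = r (dual Y) X (bidual Y \<cdot> f) u"
    by (rule r_nat_right[symmetric]) (simp_all add: Hom_iff)
  finally show "r (dual Y) X (dual_arr (dual_arr f) \<cdot> bidual X) u = r (dual Y) X (bidual Y \<cdot> f) u" .
qed

text \<open>Each of the two units contributes one swap, and the swaps are mutually inverse by the
  symmetry axiom. What remains is the pairing, the character of the identity.\<close>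

lemma bidual_triangle:
  assumes X [simp]: "X \<in> obj C"
  shows "dual_arr (bidual X) \<cdot> bidual (dual X) = ident C (dual X)"
proof (rule r_eqI[of _ "dual X" X])
  show "dual_arr (bidual X) \<cdot> bidual (dual X) \<in> Hom C (dual X) (dual X)"
    "ident C (dual X) \<in> Hom C (dual X) (dual X)" "X \<in> obj C" by (simp_all add: Hom_iff)
  fix u assume u: "u \<in> global (X \<boxtimes> dual X)"
  then have U [simp]: "u \<in> arr C" "src C u = unit C" "tgt C u = X \<boxtimes> dual X" by (auto simp: Hom_iff)
  have "r X (dual X) (dual_arr (bidual X) \<cdot> bidual (dual X)) u
      = r (dual (dual X)) (dual X) (bidual (dual X)) ((bidual X \<star> ident C (dual X)) \<cdot> u)"
    by (rule r_nat_left[OF _ bidual(1) bidual(1) u]) simp_all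
  also have "\<dots> = pairing (dual X) (swap C (dual (dual X)) (dual X) \<cdot> ((bidual X \<star> ident C (dual X)) \<cdot> u))"
    by (rule bidual(2)) (simp_all add: Hom_iff)
  also have "\<dots> = pairing (dual X) ((ident C (dual X) \<star> bidual X) \<cdot> (swap C X (dual X) \<cdot> u))"
    using swap_nat'[of "bidual X" "ident C (dual X)" u] by simp
  also have "\<dots> = r (dual X) X (bidual X) (swap C X (dual X) \<cdot> u)"
    by (rule r_pairing[symmetric]) (simp_all add: Hom_iff)
  also have "\<dots> = pairing X (swap C (dual X) X \<cdot> (swap C X (dual X) \<cdot> u))"
    by (rule bidual(2)) (simp_all add: Hom_iff)
  also have "\<dots> = r X (dual X) (ident C (dual X)) u"
    by (simp add: swap_swap' pairing_def)
  finally show "r X (dual X) (dual_arr (bidual X) \<cdot> bidual (dual X)) u = r X (dual X) (ident C (dual X)) u" .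
qed

text \<open>
  The functor is adjoint to itself on the right: \<open>g \<mapsto> \<I>g \<circ> i\<^sub>X\<close> is a bijection from
  \<open>Hom(Y, \<I>X)\<close> to \<open>Hom(X, \<I>Y)\<close>, and it is its own inverse.
\<close>

definition adjunct :: "'o \<Rightarrow> 'a \<Rightarrow> 'a" where
  "adjunct X g = dual_arr g \<cdot> bidual X"

lemma adjunct_Hom: "\<lbrakk>g \<in> Hom C Y (dual X); X \<in> obj C\<rbrakk> \<Longrightarrow> adjunct X g \<in> Hom C X (dual Y)"
  unfolding adjunct_def by (simp add: Hom_iff)

text \<open>Naturality of \<open>bidual\<close> at \<open>g\<close> reduces the double transpose to
  the triangle identity.\<close>

lemma adjunct_adjunct:
  assumes g: "g \<in> Hom C Y (dual X)" and X [simp]: "X \<in> obj C"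
  shows "adjunct Y (adjunct X g) = g"
proof -
  have G [simp]: "g \<in> arr C" "src C g = Y" "tgt C g = dual X" using g by (auto simp: Hom_iff)
  have Y [simp]: "Y \<in> obj C" using Hom_obj g by blast
  have "adjunct Y (adjunct X g) = dual_arr (bidual X) \<cdot> (dual_arr (dual_arr g) \<cdot> bidual Y)"
    unfolding adjunct_def by (simp add: dual_comp)
  also have "\<dots> = (dual_arr (bidual X) \<cdot> bidual (dual X)) \<cdot> g"
    unfolding bidual_natural[OF g] by simp
  finally show ?thesis using bidual_triangle by simp
qed

lemma adjunct_dual_arr:
  assumes f: "f \<in> Hom C X X'" and g: "g \<in> Hom C Y (dual X')"
  shows "adjunct X (dual_arr f \<cdot> g) = adjunct X' g \<cdot> f"
proof -
  note o [simp] = Hom_obj[OF f]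
  have F [simp]: "f \<in> arr C" "src C f = X" "tgt C f = X'" using f by (auto simp: Hom_iff)
  have G [simp]: "g \<in> arr C" "src C g = Y" "tgt C g = dual X'" using g by (auto simp: Hom_iff)
  have "adjunct X (dual_arr f \<cdot> g) = dual_arr g \<cdot> (dual_arr (dual_arr f) \<cdot> bidual X)"
    unfolding adjunct_def by (simp add: dual_comp)
  also have "\<dots> = adjunct X' g \<cdot> f" unfolding bidual_natural[OF f] adjunct_def by simp
  finally show ?thesis .
qed

text \<open>Transposition turns a cone \<open>Y -> dual (X j)\<close> into a cocone
  \<open>X j -> dual Y\<close>, to which the universal property of \<open>P\<close> applies.\<close>

lemma dual_coproduct:
  assumes c: "is_coproduct C J X P \<iota>"
  shows "is_product C J (\<lambda>j. dual (X j)) (dual P) (\<lambda>j. dual_arr (\<iota> j))"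
  unfolding is_product_def
proof (intro conjI ballI allI impI)
  note P = coproductD[OF c]
  show "dual P \<in> obj C" using P by simp
  show "dual_arr (\<iota> j) \<in> Hom C (dual P) (dual (X j))" if "j \<in> J" for j using dualD(3) P(2) that by blast
  have X: "X j \<in> obj C" if "j \<in> J" for j using Hom_obj(1)[OF P(2)[OF that]] .
  fix Y f assume Y: "Y \<in> obj C" and f: "\<forall>j\<in>J. f j \<in> Hom C Y (dual (X j))"
  have a: "adjunct (X j) (f j) \<in> Hom C (X j) (dual Y)" if "j \<in> J" for j
    using adjunct_Hom f X that by blast
  obtain v where v: "v \<in> Hom C P (dual Y)" "\<And>j. j \<in> J \<Longrightarrow> v \<cdot> \<iota> j = adjunct (X j) (f j)"
    using coproduct_lift[OF c dual_obj[OF Y] a] by blast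
  show "\<exists>!u. u \<in> Hom C Y (dual P) \<and> (\<forall>j\<in>J. dual_arr (\<iota> j) \<cdot> u = f j)"
  proof (intro ex1I[of _ "adjunct Y v"] conjI ballI)
    show av: "adjunct Y v \<in> Hom C Y (dual P)" using adjunct_Hom v(1) Y by blast
    fix j assume j: "j \<in> J"
    have d: "dual_arr (\<iota> j) \<cdot> adjunct Y v \<in> Hom C Y (dual (X j))"
      using comp_hom av dualD(3)[OF P(2)[OF j]] by blast
    have "adjunct (X j) (dual_arr (\<iota> j) \<cdot> adjunct Y v) = adjunct (X j) (f j)"
      using adjunct_dual_arr[OF P(2)[OF j] av] adjunct_adjunct[OF v(1) Y] v(2)[OF j] by simp
    then show "dual_arr (\<iota> j) \<cdot> adjunct Y v = f j"
      using adjunct_adjunct[OF d X[OF j]] adjunct_adjunct[of "f j" Y "X j"] f j X[OF j] by metis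
  next
    fix u assume u: "u \<in> Hom C Y (dual P) \<and> (\<forall>j\<in>J. dual_arr (\<iota> j) \<cdot> u = f j)"
    have "adjunct P u = v"
    proof (rule coproduct_eqI[OF c])
      show "adjunct P u \<in> Hom C P (dual Y)" using adjunct_Hom u P(1) by blast
      show "v \<in> Hom C P (dual Y)" by (rule v)
      show "adjunct P u \<cdot> \<iota> j = v \<cdot> \<iota> j" if "j \<in> J" for j
        using adjunct_dual_arr[OF P(2)[OF that]] u v(2)[OF that] that by metis
    qed
    then show "u = adjunct Y v" using adjunct_adjunct[of u Y P] u P(1) by metis
  qed
qed

text \<open>The counit that will exhibit \<open>dual X\<close> as an internal hom into
  \<open>dual (unit C)\<close>. The unitor appears because characters of arrows into the dual of the
  unit live on Hom(1, 1 tensor -).\<close>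

definition evaluation :: "'o \<Rightarrow> 'a" where
  "evaluation X = (SOME \<epsilon>. \<epsilon> \<in> Hom C (dual X \<boxtimes> X) (dual (unit C)) \<and>
     (\<forall>u \<in> global (unit C \<boxtimes> (dual X \<boxtimes> X)). r (unit C) (dual X \<boxtimes> X) \<epsilon> u
        = pairing X (swap C (dual X) X \<cdot> (lunit C (dual X \<boxtimes> X) \<cdot> u))))"

lemma evaluation:
  assumes X [simp]: "X \<in> obj C"
  shows "evaluation X \<in> Hom C (dual X \<boxtimes> X) (dual (unit C))"
    "u \<in> global (unit C \<boxtimes> (dual X \<boxtimes> X)) \<Longrightarrow> r (unit C) (dual X \<boxtimes> X) (evaluation X) u
        = pairing X (swap C (dual X) X \<cdot> (lunit C (dual X \<boxtimes> X) \<cdot> u))"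
proof -
  have s: "swap C (dual X) X \<in> Hom C (dual X \<boxtimes> X) (X \<boxtimes> dual X)"
    and l: "lunit C (dual X \<boxtimes> X) \<in> Hom C (unit C \<boxtimes> (dual X \<boxtimes> X)) (dual X \<boxtimes> X)" by (simp_all add: Hom_iff)
  have h: "pairing X \<circ> ((\<lambda>u. swap C (dual X) X \<cdot> u) \<circ> (\<lambda>u. lunit C (dual X \<boxtimes> X) \<cdot> u))
      \<in> hom (hom_group C (unit C) (unit C \<boxtimes> (dual X \<boxtimes> X))) QZ"
    using hom_compose[OF hom_compose[OF postcomp_hom[OF l unit_obj] postcomp_hom[OF s unit_obj]] pairing_hom[OF X]]
    by (simp add: comp_assoc)
  obtain g where "g \<in> Hom C (dual X \<boxtimes> X) (dual (unit C))"
    "\<And>u. u \<in> global (unit C \<boxtimes> (dual X \<boxtimes> X)) \<Longrightarrow> r (unit C) (dual X \<boxtimes> X) g u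
      = pairing X (swap C (dual X) X \<cdot> (lunit C (dual X \<boxtimes> X) \<cdot> u))"
    by (rule r_surj[OF unit_obj _ h]) (auto simp: comp_def)
  then have "\<exists>\<epsilon>. \<epsilon> \<in> Hom C (dual X \<boxtimes> X) (dual (unit C)) \<and>
     (\<forall>u \<in> global (unit C \<boxtimes> (dual X \<boxtimes> X)). r (unit C) (dual X \<boxtimes> X) \<epsilon> u
        = pairing X (swap C (dual X) X \<cdot> (lunit C (dual X \<boxtimes> X) \<cdot> u)))" by blast
  from someI_ex[OF this] show "evaluation X \<in> Hom C (dual X \<boxtimes> X) (dual (unit C))"
    "u \<in> global (unit C \<boxtimes> (dual X \<boxtimes> X)) \<Longrightarrow> r (unit C) (dual X \<boxtimes> X) (evaluation X) u
        = pairing X (swap C (dual X) X \<cdot> (lunit C (dual X \<boxtimes> X) \<cdot> u))"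
    unfolding evaluation_def by auto
qed

lemma evaluation_simps [simp]:
  assumes "X \<in> obj C"
  shows "evaluation X \<in> arr C" "src C (evaluation X) = dual X \<boxtimes> X" "tgt C (evaluation X) = dual (unit C)"
  using evaluation(1)[OF assms] by (auto simp: Hom_iff)

text \<open>Passing from \<open>g\<close> to its image under the counit does not change its
  character, up to the isomorphism from Hom(1, 1 tensor (Y tensor X)) to Hom(1, X tensor Y).\<close>

lemma evaluation_comp:
  assumes X [simp]: "X \<in> obj C" and g: "g \<in> Hom C Y (dual X)" and u: "u \<in> global (unit C \<boxtimes> (Y \<boxtimes> X))"
  shows "r (unit C) (Y \<boxtimes> X) (evaluation X \<cdot> (g \<star> ident C X)) u
    = r X Y g (swap C Y X \<cdot> (lunit C (Y \<boxtimes> X) \<cdot> u))"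
proof -
  have [simp]: "Y \<in> obj C" using Hom_obj g by blast
  have [simp]: "g \<in> arr C" "src C g = Y" "tgt C g = dual X" using g by (auto simp: Hom_iff)
  have [simp]: "u \<in> arr C" "src C u = unit C" "tgt C u = unit C \<boxtimes> (Y \<boxtimes> X)" using u by (auto simp: Hom_iff)
  have "r (unit C) (Y \<boxtimes> X) (evaluation X \<cdot> (g \<star> ident C X)) u
      = r (unit C) (dual X \<boxtimes> X) (evaluation X) ((ident C (unit C) \<star> (g \<star> ident C X)) \<cdot> u)"
    by (rule r_nat_right[OF unit_obj _ evaluation(1)[OF X] u]) (simp add: Hom_iff)
  also have "\<dots> = pairing X (swap C (dual X) X \<cdot> (lunit C (dual X \<boxtimes> X) \<cdot> ((ident C (unit C) \<star> (g \<star> ident C X)) \<cdot> u)))"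
    by (rule evaluation(2)[OF X]) (simp add: Hom_iff)
  also have "\<dots> = pairing X (swap C (dual X) X \<cdot> ((g \<star> ident C X) \<cdot> (lunit C (Y \<boxtimes> X) \<cdot> u)))"
    using lunit_nat'[of "g \<star> ident C X" u] by simp
  also have "\<dots> = pairing X ((ident C X \<star> g) \<cdot> (swap C Y X \<cdot> (lunit C (Y \<boxtimes> X) \<cdot> u)))"
    using swap_nat'[of g "ident C X" "lunit C (Y \<boxtimes> X) \<cdot> u"] by simp
  also have "\<dots> = r X Y g (swap C Y X \<cdot> (lunit C (Y \<boxtimes> X) \<cdot> u))"
    by (rule r_pairing[OF X g, symmetric]) (simp add: Hom_iff)
  finally show ?thesis .
qed

text \<open>Both Hom sets are in bijection, through \<open>r\<close>, with the characters of
  isomorphic groups. Hence \<open>evaluation X\<close> has the universal property of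
  \<open>ev\<close>, which identifies the two objects.\<close>

lemma evaluation_bij:
  assumes X [simp]: "X \<in> obj C" and Y [simp]: "Y \<in> obj C"
  shows "bij_betw (\<lambda>g. evaluation X \<cdot> (g \<star> ident C X)) (Hom C Y (dual X)) (Hom C (Y \<boxtimes> X) (dual (unit C)))"
  unfolding bij_betw_def
proof
  have YX: "Y \<boxtimes> X \<in> obj C" by simp
  obtain l where l: "l \<in> Hom C (Y \<boxtimes> X) (unit C \<boxtimes> (Y \<boxtimes> X))"
    "lunit C (Y \<boxtimes> X) \<cdot> l = ident C (Y \<boxtimes> X)" "l \<cdot> lunit C (Y \<boxtimes> X) = ident C (unit C \<boxtimes> (Y \<boxtimes> X))"
    using isosE[OF lunit_iso[OF YX]] by metis
  have L [simp]: "l \<in> arr C" "src C l = Y \<boxtimes> X" "tgt C l = unit C \<boxtimes> (Y \<boxtimes> X)" using l(1) by (auto simp: Hom_iff)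
  show "inj_on (\<lambda>g. evaluation X \<cdot> (g \<star> ident C X)) (Hom C Y (dual X))"
  proof (rule inj_onI)
    fix g g' assume g: "g \<in> Hom C Y (dual X)" "g' \<in> Hom C Y (dual X)"
      and e: "evaluation X \<cdot> (g \<star> ident C X) = evaluation X \<cdot> (g' \<star> ident C X)"
    show "g = g'"
    proof (rule r_eqI[OF g X])
      fix w assume w: "w \<in> global (X \<boxtimes> Y)"
      then have W [simp]: "w \<in> arr C" "src C w = unit C" "tgt C w = X \<boxtimes> Y" by (auto simp: Hom_iff)
      define u where "u = l \<cdot> (swap C X Y \<cdot> w)"
      have u: "u \<in> global (unit C \<boxtimes> (Y \<boxtimes> X))" by (simp add: u_def Hom_iff)
      have "lunit C (Y \<boxtimes> X) \<cdot> u = (lunit C (Y \<boxtimes> X) \<cdot> l) \<cdot> (swap C X Y \<cdot> w)" by (simp add: u_def)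
      then have "swap C Y X \<cdot> (lunit C (Y \<boxtimes> X) \<cdot> u) = w" by (simp add: l(2) swap_swap')
      then show "r X Y g w = r X Y g' w"
        using evaluation_comp[OF X g(1) u] evaluation_comp[OF X g(2) u] e by simp
    qed
  qed
  show "(\<lambda>g. evaluation X \<cdot> (g \<star> ident C X)) ` Hom C Y (dual X) = Hom C (Y \<boxtimes> X) (dual (unit C))"
  proof
    show "(\<lambda>g. evaluation X \<cdot> (g \<star> ident C X)) ` Hom C Y (dual X) \<subseteq> Hom C (Y \<boxtimes> X) (dual (unit C))"
      by (auto simp: Hom_iff)
    show "Hom C (Y \<boxtimes> X) (dual (unit C)) \<subseteq> (\<lambda>g. evaluation X \<cdot> (g \<star> ident C X)) ` Hom C Y (dual X)"
    proof
      fix h assume h: "h \<in> Hom C (Y \<boxtimes> X) (dual (unit C))"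
      have s: "swap C X Y \<in> Hom C (X \<boxtimes> Y) (Y \<boxtimes> X)" by (simp add: Hom_iff)
      have c: "r (unit C) (Y \<boxtimes> X) h \<circ> ((\<lambda>u. l \<cdot> u) \<circ> (\<lambda>u. swap C X Y \<cdot> u)) \<in> hom (hom_group C (unit C) (X \<boxtimes> Y)) QZ"
        using hom_compose[OF hom_compose[OF postcomp_hom[OF s unit_obj] postcomp_hom[OF l(1) unit_obj]] r_hom[OF h unit_obj]]
        by (simp add: comp_assoc)
      obtain g where g: "g \<in> Hom C Y (dual X)"
        "\<And>w. w \<in> global (X \<boxtimes> Y) \<Longrightarrow> r X Y g w = r (unit C) (Y \<boxtimes> X) h (l \<cdot> (swap C X Y \<cdot> w))"
        by (rule r_surj[OF X Y c]) (auto simp: comp_def)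
      have "h = evaluation X \<cdot> (g \<star> ident C X)"
      proof (rule r_eqI[OF h _ unit_obj])
        show "evaluation X \<cdot> (g \<star> ident C X) \<in> Hom C (Y \<boxtimes> X) (dual (unit C))"
          using g(1) by (simp add: Hom_iff)
        fix u assume u: "u \<in> global (unit C \<boxtimes> (Y \<boxtimes> X))"
        then have U [simp]: "u \<in> arr C" "src C u = unit C" "tgt C u = unit C \<boxtimes> (Y \<boxtimes> X)" by (auto simp: Hom_iff)
        have "swap C X Y \<cdot> (swap C Y X \<cdot> (lunit C (Y \<boxtimes> X) \<cdot> u)) = lunit C (Y \<boxtimes> X) \<cdot> u"
          by (simp add: swap_swap')
        moreover have "l \<cdot> (lunit C (Y \<boxtimes> X) \<cdot> u) = (l \<cdot> lunit C (Y \<boxtimes> X)) \<cdot> u" by simp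
        ultimately have "l \<cdot> (swap C X Y \<cdot> (swap C Y X \<cdot> (lunit C (Y \<boxtimes> X) \<cdot> u))) = u" by (simp add: l(3))
        then show "r (unit C) (Y \<boxtimes> X) h u = r (unit C) (Y \<boxtimes> X) (evaluation X \<cdot> (g \<star> ident C X)) u"
          unfolding evaluation_comp[OF X g(1) u] by (subst g(2)) (simp_all add: Hom_iff)
      qed
      then show "h \<in> (\<lambda>g. evaluation X \<cdot> (g \<star> ident C X)) ` Hom C Y (dual X)" using g(1) by blast
    qed
  qed
qed

definition to_ihom :: "'o \<Rightarrow> 'a" where
  "to_ihom X = transpose_arr C (dual X) X (dual (unit C)) (evaluation X)"

lemma to_ihom:
  assumes X [simp]: "X \<in> obj C"
  shows "to_ihom X \<in> Hom C (dual X) (ihom C X (dual (unit C)))"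
    "ev C X (dual (unit C)) \<cdot> (to_ihom X \<star> ident C X) = evaluation X"
  unfolding to_ihom_def using transpose_arr[OF X _ _ evaluation(1)[OF X]] by simp_all

text \<open>By \<open>to_ihom\<close> and the universal properties of \<open>ev\<close> and
  \<open>evaluation\<close>, postcomposition is bijective on every Hom set, and Yoneda
  applies.\<close>

lemma to_ihom_iso:
  assumes X [simp]: "X \<in> obj C"
  shows "to_ihom X \<in> isos C (dual X) (ihom C X (dual (unit C)))"
proof (rule iso_through_mono[OF to_ihom(1)[OF X]])
  let ?J = "dual (unit C)" let ?s = "to_ihom X"
  have [simp]: "?s \<in> arr C" "src C ?s = dual X" "tgt C ?s = ihom C X ?J" using to_ihom(1)[OF X] by (auto simp: Hom_iff)
  fix Y assume Y [simp]: "Y \<in> obj C"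
  have c: "ev C X ?J \<cdot> ((?s \<cdot> g) \<star> ident C X) = evaluation X \<cdot> (g \<star> ident C X)" if "g \<in> Hom C Y (dual X)" for g
  proof -
    have "ev C X ?J \<cdot> ((?s \<cdot> g) \<star> ident C X) = ev C X ?J \<cdot> ((?s \<star> ident C X) \<cdot> (g \<star> ident C X))"
      using that by (simp add: Hom_iff tensor_comp')
    also have "\<dots> = (ev C X ?J \<cdot> (?s \<star> ident C X)) \<cdot> (g \<star> ident C X)" using that by (simp add: Hom_iff)
    finally show ?thesis by (simp add: to_ihom(2))
  qed
  note b = evaluation_bij[OF X Y]
  show "bij_betw (\<lambda>u. ?s \<cdot> u) (Hom C Y (dual X)) (Hom C Y (ihom C X ?J))"
    unfolding bij_betw_def
  proof
    show "inj_on (\<lambda>u. ?s \<cdot> u) (Hom C Y (dual X))"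
    proof (rule inj_onI)
      fix g h assume g: "g \<in> Hom C Y (dual X)" and h: "h \<in> Hom C Y (dual X)" and e: "?s \<cdot> g = ?s \<cdot> h"
      show "g = h"
        by (rule inj_onD[OF bij_betw_imp_inj_on[OF b] _ g h]) (use c[OF g] c[OF h] e in simp)
    qed
    have "h \<in> (\<lambda>u. ?s \<cdot> u) ` Hom C Y (dual X)" if h: "h \<in> Hom C Y (ihom C X ?J)" for h
    proof -
      have "ev C X ?J \<cdot> (h \<star> ident C X) \<in> Hom C (Y \<boxtimes> X) ?J" using h by (simp add: Hom_iff)
      then have "ev C X ?J \<cdot> (h \<star> ident C X) \<in> (\<lambda>g. evaluation X \<cdot> (g \<star> ident C X)) ` Hom C Y (dual X)"
        unfolding bij_betw_imp_surj_on[OF b] .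
      then obtain g where g: "g \<in> Hom C Y (dual X)" "ev C X ?J \<cdot> (h \<star> ident C X) = evaluation X \<cdot> (g \<star> ident C X)"
        by (rule imageE)
      have "h = ?s \<cdot> g"
        by (rule ev_eqI[OF X _ h comp_hom[OF g(1) to_ihom(1)[OF X]]]) (simp_all add: g(2) c[OF g(1)])
      then show ?thesis using g(1) by blast
    qed
    then show "(\<lambda>u. ?s \<cdot> u) ` Hom C Y (dual X) = Hom C Y (ihom C X ?J)"
      using comp_hom[OF _ to_ihom(1)[OF X]] by auto
  qed
qed

text \<open>Extranaturality in \<open>X\<close>, inherited from the adjointness of \<open>f\<close>
  and \<open>dual_arr f\<close> for the pairings.\<close>

lemma evaluation_nat:
  assumes f: "f \<in> Hom C X X'"
  shows "evaluation X \<cdot> (dual_arr f \<star> ident C X) = evaluation X' \<cdot> (ident C (dual X') \<star> f)"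
proof (rule r_eqI[OF _ _ unit_obj])
  note [simp] = Hom_obj[OF f]
  note o = Hom_obj[OF f]
  have [simp]: "f \<in> arr C" "src C f = X" "tgt C f = X'" using f by (auto simp: Hom_iff)
  show "evaluation X \<cdot> (dual_arr f \<star> ident C X) \<in> Hom C (dual X' \<boxtimes> X) (dual (unit C))"
    "evaluation X' \<cdot> (ident C (dual X') \<star> f) \<in> Hom C (dual X' \<boxtimes> X) (dual (unit C))"
    by (simp_all add: Hom_iff)
  fix u assume u: "u \<in> global (unit C \<boxtimes> (dual X' \<boxtimes> X))"
  then have [simp]: "u \<in> arr C" "src C u = unit C" "tgt C u = unit C \<boxtimes> (dual X' \<boxtimes> X)" by (auto simp: Hom_iff)
  have "r (unit C) (dual X' \<boxtimes> X) (evaluation X \<cdot> (dual_arr f \<star> ident C X)) u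
      = r X (dual X') (dual_arr f) (swap C (dual X') X \<cdot> (lunit C (dual X' \<boxtimes> X) \<cdot> u))"
    by (rule evaluation_comp[OF o(1) dualD(3)[OF f] u])
  also have "\<dots> = pairing X' ((f \<star> ident C (dual X')) \<cdot> (swap C (dual X') X \<cdot> (lunit C (dual X' \<boxtimes> X) \<cdot> u)))"
    by (rule r_dual_arr[OF f]) (simp add: Hom_iff)
  also have "\<dots> = pairing X' (swap C (dual X') X' \<cdot> ((ident C (dual X') \<star> f) \<cdot> (lunit C (dual X' \<boxtimes> X) \<cdot> u)))"
    using swap_nat'[of "ident C (dual X')" f "lunit C (dual X' \<boxtimes> X) \<cdot> u"] by simp
  also have "\<dots> = pairing X' (swap C (dual X') X' \<cdot> (lunit C (dual X' \<boxtimes> X') \<cdot> ((ident C (unit C) \<star> (ident C (dual X') \<star> f)) \<cdot> u)))"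
    using lunit_nat'[of "ident C (dual X') \<star> f" u] by simp
  also have "\<dots> = r (unit C) (dual X' \<boxtimes> X') (evaluation X') ((ident C (unit C) \<star> (ident C (dual X') \<star> f)) \<cdot> u)"
    by (rule evaluation(2)[OF o(2), symmetric]) (simp add: Hom_iff)
  also have "\<dots> = r (unit C) (dual X' \<boxtimes> X) (evaluation X' \<cdot> (ident C (dual X') \<star> f)) u"
    by (rule r_nat_right[OF unit_obj _ evaluation(1)[OF o(2)] u, symmetric]) (simp add: Hom_iff)
  finally show "r (unit C) (dual X' \<boxtimes> X) (evaluation X \<cdot> (dual_arr f \<star> ident C X)) u
    = r (unit C) (dual X' \<boxtimes> X) (evaluation X' \<cdot> (ident C (dual X') \<star> f)) u" .
qed

text \<open>Both sides are arrows into an internal hom and are compared after evaluation, where the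
  claim becomes \<open>evaluation_nat\<close>.\<close>

lemma to_ihom_nat:
  assumes f: "f \<in> Hom C X X'"
  shows "to_ihom X \<cdot> dual_arr f = farr (ihom_into C (dual (unit C))) f \<cdot> to_ihom X'"
proof -
  note [simp] = Hom_obj[OF f]
  note o = Hom_obj[OF f]
  let ?J = "dual (unit C)" and ?F = "farr (ihom_into C (dual (unit C))) f"
  have [simp]: "f \<in> arr C" "src C f = X" "tgt C f = X'" using f by (auto simp: Hom_iff)
  have [simp]: "to_ihom Z \<in> arr C" "src C (to_ihom Z) = dual Z" "tgt C (to_ihom Z) = ihom C Z ?J" if "Z \<in> obj C" for Z
    using to_ihom(1)[OF that] by (auto simp: Hom_iff)
  have e: "ev C X' ?J \<cdot> (ident C (ihom C X' ?J) \<star> f) \<in> Hom C (ihom C X' ?J \<boxtimes> X) ?J" by (simp add: Hom_iff)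
  have F: "?F \<in> Hom C (ihom C X' ?J) (ihom C X ?J)"
    "ev C X ?J \<cdot> (?F \<star> ident C X) = ev C X' ?J \<cdot> (ident C (ihom C X' ?J) \<star> f)"
    using transpose_arr[OF o(1) _ _ e] by (simp_all add: ihom_into_def)
  then have [simp]: "?F \<in> arr C" "src C ?F = ihom C X' ?J" "tgt C ?F = ihom C X ?J" by (auto simp: Hom_iff)
  have "ev C X ?J \<cdot> ((?F \<cdot> to_ihom X') \<star> ident C X) = (ev C X ?J \<cdot> (?F \<star> ident C X)) \<cdot> (to_ihom X' \<star> ident C X)"
    by (simp add: tensor_comp')
  also have "\<dots> = (ev C X' ?J \<cdot> (to_ihom X' \<star> ident C X')) \<cdot> (ident C (dual X') \<star> f)"
    by (simp add: F(2) tensor_comp')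
  also have "\<dots> = (ev C X ?J \<cdot> (to_ihom X \<star> ident C X)) \<cdot> (dual_arr f \<star> ident C X)"
    using evaluation_nat[OF f] by (simp only: to_ihom(2) o)
  also have "\<dots> = ev C X ?J \<cdot> ((to_ihom X \<cdot> dual_arr f) \<star> ident C X)"
    by (simp add: tensor_comp')
  finally have e: "ev C X ?J \<cdot> ((?F \<cdot> to_ihom X') \<star> ident C X)
    = ev C X ?J \<cdot> ((to_ihom X \<cdot> dual_arr f) \<star> ident C X)" .
  show ?thesis
    by (rule ev_eqI[OF o(1) _ _ _ e[symmetric], of "dual X'"]) (simp_all add: Hom_iff)
qed

lemma dual_exact: "exact_contravariant_functor C C I"
proof (rule exact_contravariant_functor_iso[OF ihom_into_exact I])
  show "dual (unit C) \<in> obj C" by simp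
  show "to_ihom X \<in> isos C (dual X) (fobj (ihom_into C (dual (unit C))) X)" if "X \<in> obj C" for X
    using to_ihom_iso[OF that] by (simp add: ihom_into_def)
qed (rule to_ihom_nat)

lemma bidual_mono:
  assumes K: "rigid_object C K" and v: "v \<in> Hom C K X"
    and z: "bidual X \<cdot> v = zero_arr C K (dual (dual X))"
  shows "v = zero_arr C K X"
proof -
  obtain D \<eta> where D [simp]: "D \<in> obj C" and \<eta>: "\<eta> \<in> Hom C (unit C) (D \<boxtimes> K)"
    and det: "\<And>X v. \<lbrakk>v \<in> Hom C K X; (ident C D \<star> v) \<cdot> \<eta> = zero_arr C (unit C) (D \<boxtimes> X)\<rbrakk> \<Longrightarrow> v = zero_arr C K X"
    using rigid_coevaluation[OF K] by blast
  note [simp] = Hom_obj[OF v]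
  note o = Hom_obj[OF v]
  have [simp]: "v \<in> arr C" "src C v = K" "tgt C v = X" using v by (auto simp: Hom_iff)
  have [simp]: "\<eta> \<in> arr C" "src C \<eta> = unit C" "tgt C \<eta> = D \<boxtimes> K" using \<eta> by (auto simp: Hom_iff)
  \<comment> \<open>The transpose of \<open>v\<close> under the duality of \<open>K\<close> and
    \<open>D\<close>, an element of Hom(1, X tensor D).\<close>
  let ?w = "swap C D X \<cdot> ((ident C D \<star> v) \<cdot> \<eta>)"
  have w: "?w \<in> global (X \<boxtimes> D)" by (simp add: Hom_iff)
  \<comment> \<open>Interchanging \<open>g\<close> with \<open>v\<close> turns the value of
    \<open>g\<close> at the transpose of \<open>v\<close> into the value of \<open>bidual X\<close>
    after \<open>v\<close> at the element
    \<open>(g \<star> ident C K) \<cdot> \<eta>\<close>.\<close>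
  have triv: "r X D g ?w = \<one>\<^bsub>QZ\<^esub>" if g: "g \<in> Hom C D (dual X)" for g
  proof -
    have [simp]: "g \<in> arr C" "src C g = D" "tgt C g = dual X" using g by (auto simp: Hom_iff)
    have u: "(g \<star> ident C K) \<cdot> \<eta> \<in> global (dual X \<boxtimes> K)" by (simp add: Hom_iff)
    have "r X D g ?w = pairing X ((ident C X \<star> g) \<cdot> ?w)" by (rule r_pairing[OF o(2) g w])
    also have "\<dots> = pairing X (swap C (dual X) X \<cdot> ((g \<star> ident C X) \<cdot> ((ident C D \<star> v) \<cdot> \<eta>)))"
      using swap_nat'[of g "ident C X" "(ident C D \<star> v) \<cdot> \<eta>"] by simp
    also have "(g \<star> ident C X) \<cdot> ((ident C D \<star> v) \<cdot> \<eta>) = (ident C (dual X) \<star> v) \<cdot> ((g \<star> ident C K) \<cdot> \<eta>)"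
      by (simp add: tensor_comp' flip: comp_assoc')
    also have "pairing X (swap C (dual X) X \<cdot> \<dots>) = r (dual X) X (bidual X) ((ident C (dual X) \<star> v) \<cdot> ((g \<star> ident C K) \<cdot> \<eta>))"
      by (rule bidual(2)[OF o(2), symmetric]) (simp add: Hom_iff)
    also have "\<dots> = r (dual X) K (bidual X \<cdot> v) ((g \<star> ident C K) \<cdot> \<eta>)"
      by (rule r_nat_right[OF _ v bidual(1)[OF o(2)] u, symmetric]) simp
    also have "\<dots> = \<one>\<^bsub>QZ\<^esub>" unfolding z by (rule r_zero_left[OF _ o(1) u]) simp
    finally show ?thesis .
  qed
  have "?w = zero_arr C (unit C) (X \<boxtimes> D)"
  proof (rule ccontr)
    assume "?w \<noteq> zero_arr C (unit C) (X \<boxtimes> D)"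
    then obtain \<chi> where \<chi>: "\<chi> \<in> hom (hom_group C (unit C) (X \<boxtimes> D)) QZ" "\<chi> ?w \<noteq> \<one>\<^bsub>QZ\<^esub>"
      using characters_separate_points[OF hom_comm_group[of "unit C" "X \<boxtimes> D"], of ?w] w by auto
    obtain g where "g \<in> Hom C D (dual X)" "\<And>u. u \<in> global (X \<boxtimes> D) \<Longrightarrow> r X D g u = \<chi> u"
      using r_surj[OF o(2) D \<chi>(1)] by blast
    then show False using triv w \<chi>(2) by metis
  qed
  then have "swap C D X \<cdot> ((ident C D \<star> v) \<cdot> \<eta>) = swap C D X \<cdot> zero_arr C (unit C) (D \<boxtimes> X)" by simp
  then have "(ident C D \<star> v) \<cdot> \<eta> = zero_arr C (unit C) (D \<boxtimes> X)"
    by (rule iso_monic[OF swap_iso[OF D o(2)], rotated 2]) (simp_all add: Hom_iff)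
  then show ?thesis by (rule det[OF v])
qed

end

section \<open>Pure injectivity\<close>

lemma tc_moduleD:
  assumes "is_tc_module sz C M" "compact_object sz C K" "compact_object sz C L"
  shows "comm_group (val M K)"
    and "x \<in> carrier (val M K) \<Longrightarrow> act M (ident C K) x = x"
    and "f \<in> Hom C K L \<Longrightarrow> act M f \<in> hom (val M L) (val M K)"
    and "\<lbrakk>f \<in> Hom C K L; g \<in> Hom C K L; x \<in> carrier (val M L)\<rbrakk>
      \<Longrightarrow> act M (f \<boxplus>\<^bsub>C\<^esub> g) x = act M f x \<otimes>\<^bsub>val M K\<^esub> act M g x"
    and "\<lbrakk>compact_object sz C N; f \<in> Hom C K L; g \<in> Hom C L N; x \<in> carrier (val M N)\<rbrakk>
      \<Longrightarrow> act M (g \<cdot>\<^bsub>C\<^esub> f) x = act M f (act M g x)"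
  using assms unfolding is_tc_module_def by simp_all

text \<open>
  \<open>W\<close> is the graph of a map from a subfunctor of \<open>Hom(-, K)\<close>, restricted to compact objects,
  to \<open>Hom(-, E)\<close>; the common source of the two arrows of a pair is the argument of the functors.
\<close>

definition partial_cyclic_map ::
  "'i itself \<Rightarrow> ('o, 'a, 'm) additive_category_scheme \<Rightarrow> 'o \<Rightarrow> 'o \<Rightarrow> ('a \<times> 'a) set \<Rightarrow> bool" where
  "partial_cyclic_map sz C E K W \<longleftrightarrow>
     (\<forall>f e. (f, e) \<in> W \<longrightarrow> compact_object sz C (src C f) \<and> f \<in> Hom C (src C f) K \<and> e \<in> Hom C (src C f) E) \<and>
     (\<forall>f e f' e'. (f, e) \<in> W \<and> (f', e') \<in> W \<and> src C f = src C f' \<longrightarrow> (f \<boxplus>\<^bsub>C\<^esub> f', e \<boxplus>\<^bsub>C\<^esub> e') \<in> W) \<and>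
     (\<forall>f e L g. (f, e) \<in> W \<and> compact_object sz C L \<and> g \<in> Hom C L (src C f) \<longrightarrow> (f \<cdot>\<^bsub>C\<^esub> g, e \<cdot>\<^bsub>C\<^esub> g) \<in> W) \<and>
     (\<forall>L e. (zero_arr C L K, e) \<in> W \<and> L \<in> obj C \<longrightarrow> e = zero_arr C L E) \<and>
     (zero_arr C K K, zero_arr C K E) \<in> W"

text \<open>By Yoneda, an extension of the partial map to all of Hom(-, K) is postcomposition with a
  single arrow \<open>e0\<close>.\<close>

definition baer ::
  "'i itself \<Rightarrow> ('o, 'a, 'm) additive_category_scheme \<Rightarrow> 'o \<Rightarrow> bool" where
  "baer sz C E \<longleftrightarrow> (\<forall>K W. compact_object sz C K \<and> partial_cyclic_map sz C E K W \<longrightarrow>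
     (\<exists>e0 \<in> Hom C K E. \<forall>f e. (f, e) \<in> W \<longrightarrow> e = e0 \<cdot>\<^bsub>C\<^esub> f))"

context additive_category
begin

lemma inv_hom_group: "f \<in> Hom C X Y \<Longrightarrow> inv\<^bsub>hom_group C X Y\<^esub> f = neg C f"
  by (auto simp: neg_def Hom_iff)

lemma tc_module_restricted_yoneda:
  assumes E: "E \<in> obj C"
  shows "is_tc_module sz C (restricted_yoneda C E)"
  unfolding is_tc_module_def restricted_yoneda_def
proof (intro conjI allI impI ballI; (elim conjE)?; simp)
  fix K assume K: "compact_object sz C K"
  show "comm_group (hom_group C K E)" using hom_comm_group[OF compact_obj[OF K] E] .
next
  fix K L f assume "compact_object sz C K" "compact_object sz C L" and f: "f \<in> Hom C K L"
  then show "(\<lambda>g. g \<cdot> f) \<in> hom (hom_group C L E) (hom_group C K E)"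
    using comp_hom[OF f] comp_add_left[OF f] by (auto intro!: homI)
qed (auto simp: Hom_iff)

end

text \<open>The module counterpart of \<open>partial_hom\<close>: a triple \<open>(K, n, e)\<close>
  records that the element \<open>n\<close> of \<open>N\<close> at \<open>K\<close> is sent to
  \<open>e\<close>. The domain is a submodule of \<open>N\<close>, and \<open>functional\<close>
  again speaks only of the fibre over the neutral element.\<close>

locale partial_module_map = additive_category C
  for C :: "('o, 'a, 'm) additive_category_scheme" (structure) +
  fixes sz :: "'i itself" and N :: "('o, 'a, 'u) tc_module" and E :: 'o and R :: "('o \<times> 'u \<times> 'a) set"
  assumes N: "is_tc_module sz C N" and E: "E \<in> obj C"
    and carr: "(K, n, e) \<in> R \<Longrightarrow> compact_object sz C K \<and> n \<in> carrier (val N K) \<and> e \<in> Hom C K E"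
    and add: "\<lbrakk>(K, n, e) \<in> R; (K, n', e') \<in> R\<rbrakk> \<Longrightarrow> (K, n \<otimes>\<^bsub>val N K\<^esub> n', e \<boxplus> e') \<in> R"
    and act: "\<lbrakk>(K, n, e) \<in> R; compact_object sz C L; f \<in> Hom C L K\<rbrakk> \<Longrightarrow> (L, act N f n, e \<cdot> f) \<in> R"
    and functional: "(K, \<one>\<^bsub>val N K\<^esub>, e) \<in> R \<Longrightarrow> e = zero_arr C K E"
    and zero: "compact_object sz C K \<Longrightarrow> (K, \<one>\<^bsub>val N K\<^esub>, zero_arr C K E) \<in> R"
begin

lemmas ND = tc_moduleD[OF N]

lemma act_closed:
  "\<lbrakk>compact_object sz C K; compact_object sz C L; f \<in> Hom C K L; n \<in> carrier (val N L)\<rbrakk>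
    \<Longrightarrow> act N f n \<in> carrier (val N K)"
  using ND(3) hom_in_carrier by metis

lemma act_zero:
  assumes K: "compact_object sz C K" and L: "compact_object sz C L" and n: "n \<in> carrier (val N L)"
  shows "act N (zero_arr C K L) n = \<one>\<^bsub>val N K\<^esub>"
proof -
  interpret G: comm_group "val N K" by (rule ND(1)[OF K K])
  note o = compact_obj[OF K] compact_obj[OF L]
  note z = zero_Hom[OF o]
  have "act N (zero_arr C K L) n = act N (zero_arr C K L) n \<otimes>\<^bsub>val N K\<^esub> act N (zero_arr C K L) n"
    using ND(4)[OF K L z z n] add_zero_left[OF o z] by simp
  then show ?thesis using act_closed[OF K L z n] by (metis G.r_cancel_one)
qed

text \<open>The action of minus the identity is inversion, so closure under the action gives closure
  under inverses.\<close>

lemma inverse: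
  assumes R: "(K, n, e) \<in> R"
  shows "(K, inv\<^bsub>val N K\<^esub> n, neg C e) \<in> R"
proof -
  have K: "compact_object sz C K" and n: "n \<in> carrier (val N K)" and e: "e \<in> Hom C K E"
    using carr[OF R] by auto
  interpret G: comm_group "val N K" by (rule ND(1)[OF K K])
  note o [simp] = compact_obj[OF K]
  have i: "ident C K \<in> Hom C K K" "neg C (ident C K) \<in> Hom C K K" by (simp_all add: Hom_iff)
  have "act N (neg C (ident C K)) n \<otimes>\<^bsub>val N K\<^esub> n = act N (neg C (ident C K) \<boxplus> ident C K) n"
    using ND(4)[OF K K i(2) i(1) n] ND(2)[OF K K n] by simp
  also have "\<dots> = \<one>\<^bsub>val N K\<^esub>" using neg_left[OF o o i(1)] act_zero[OF K K n] by simp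
  finally have "inv\<^bsub>val N K\<^esub> n = act N (neg C (ident C K)) n"
    using G.inv_equality n act_closed[OF K K i(2) n] by simp
  moreover have "e \<cdot> neg C (ident C K) = neg C e" using e by (simp add: Hom_iff)
  ultimately show ?thesis using act[OF R K i(2)] by simp
qed

lemma single_valued:
  assumes "(K, n, e) \<in> R" "(K, n, e') \<in> R"
  shows "e = e'"
proof -
  have K: "compact_object sz C K" and n: "n \<in> carrier (val N K)" and e: "e \<in> Hom C K E" "e' \<in> Hom C K E"
    using carr assms by auto
  interpret G: comm_group "val N K" by (rule ND(1)[OF K K])
  have "(K, n \<otimes>\<^bsub>val N K\<^esub> inv\<^bsub>val N K\<^esub> n, e \<boxplus> neg C e') \<in> R"
    using add[OF assms(1) inverse[OF assms(2)]] .
  then have "e \<boxplus> neg C e' = zero_arr C K E" using functional n by simp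
  then show ?thesis using eq_if_diff_zero[OF e] by simp
qed

text \<open>By Yoneda \<open>n\<close> is a map from Hom(-, K) to \<open>N\<close>. The part of
  Hom(-, K) that lands in the domain of \<open>R\<close> is a subfunctor, and the Baer property
  extends the map that \<open>R\<close> induces on it.\<close>

lemma extend_by_element:
  assumes B: "baer sz C E" and K: "compact_object sz C K" and n: "n \<in> carrier (val N K)"
  obtains R' e0 where "partial_module_map C sz N E R'" "R \<subseteq> R'" "(K, n, e0) \<in> R'"
proof -
  note Ko [simp] = compact_obj[OF K]
  \<comment> \<open>The pullback of the graph \<open>R\<close> along the map Hom(-, K) -> N given by
    \<open>n\<close>.\<close>
  define W where "W = {(f, e). (src C f, act N f n, e) \<in> R \<and> f \<in> Hom C (src C f) K}"
  have WD: "compact_object sz C (src C f)" "f \<in> Hom C (src C f) K" "e \<in> Hom C (src C f) E"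
    "(src C f, act N f n, e) \<in> R" if "(f, e) \<in> W" for f e
    using that carr unfolding W_def by auto
  have "partial_cyclic_map sz C E K W"
    unfolding partial_cyclic_map_def
  proof (intro conjI allI impI; (elim conjE)?)
    fix f e f' e' assume w: "(f, e) \<in> W" "(f', e') \<in> W" and s: "src C f = src C f'"
    note f = WD[OF w(1)] and f' = WD[OF w(2), folded s]
    have ff: "f \<boxplus> f' \<in> Hom C (src C f) K" using add_Hom[OF compact_obj[OF f(1)] Ko f(2) f'(2)] .
    moreover have "src C (f \<boxplus> f') = src C f" using ff by (simp add: Hom_iff)
    ultimately show "(f \<boxplus> f', e \<boxplus> e') \<in> W"
      using add[OF f(4) f'(4)] ND(4)[OF f(1) K f(2) f'(2) n] unfolding W_def by simp
  next
    fix f e L g assume w: "(f, e) \<in> W" and L: "compact_object sz C L" and g: "g \<in> Hom C L (src C f)"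
    note f = WD[OF w]
    have fg: "f \<cdot> g \<in> Hom C L K" using comp_hom[OF g f(2)] .
    then have "src C (f \<cdot> g) = L" by (simp add: Hom_iff)
    then show "(f \<cdot> g, e \<cdot> g) \<in> W"
      using act[OF f(4) L g] ND(5)[OF L f(1) K g f(2) n] fg unfolding W_def by simp
  next
    fix L e assume w: "(zero_arr C L K, e) \<in> W" and L: "L \<in> obj C"
    then have "(L, act N (zero_arr C L K) n, e) \<in> R" using WD(4)[OF w] L by simp
    moreover have "compact_object sz C L" using WD(1)[OF w] L by simp
    ultimately show "e = zero_arr C L E" using act_zero[OF _ K n] functional by simp
  next
    show "(zero_arr C K K, zero_arr C K E) \<in> W"
      using zero[OF K] act_zero[OF K K n] by (simp add: W_def Hom_iff)
  qed (use WD in auto)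
  then obtain e0 where e0: "e0 \<in> Hom C K E" "\<And>f e. (f, e) \<in> W \<Longrightarrow> e = e0 \<cdot> f"
    using B K unfolding baer_def by blast
  \<comment> \<open>The sum of \<open>R\<close> and the submodule generated by \<open>n\<close>,
    with \<open>n\<close> sent to \<open>e0\<close>.\<close>
  define R' where "R' = {(L, n' \<otimes>\<^bsub>val N L\<^esub> act N f n, e \<boxplus> e0 \<cdot> f) | L n' e f. (L, n', e) \<in> R \<and> f \<in> Hom C L K}"
  have R'I: "(L, m, e') \<in> R'" if "(L, n', e) \<in> R" "f \<in> Hom C L K"
    "m = n' \<otimes>\<^bsub>val N L\<^esub> act N f n" "e' = e \<boxplus> e0 \<cdot> f" for L n' e f m e'
    using that unfolding R'_def by blast
  have R'E: "\<exists>n' e f. (L, n', e) \<in> R \<and> f \<in> Hom C L K \<and> m = n' \<otimes>\<^bsub>val N L\<^esub> act N f n \<and> e' = e \<boxplus> e0 \<cdot> f"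
    if "(L, m, e') \<in> R'" for L m e'
    using that unfolding R'_def by blast
  have sub: "R \<subseteq> R'"
  proof clarify
    fix L m e assume R: "(L, m, e) \<in> R"
    have L: "compact_object sz C L" and m: "m \<in> carrier (val N L)" and e: "e \<in> Hom C L E" using carr[OF R] by auto
    interpret G: comm_group "val N L" by (rule ND(1)[OF L L])
    note Lo [simp] = compact_obj[OF L]
    show "(L, m, e) \<in> R'"
    proof (rule R'I[OF R zero_Hom[OF Lo Ko]])
      show "m = m \<otimes>\<^bsub>val N L\<^esub> act N (zero_arr C L K) n" using m by (simp add: act_zero[OF L K n])
      show "e = e \<boxplus> e0 \<cdot> zero_arr C L K" using e e0(1) add_zero_right[OF Lo E e] by (simp add: Hom_iff)
    qed
  qed
  have mem: "(K, n, e0) \<in> R'"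
  proof (rule R'I[OF zero[OF K] ident_hom[OF Ko]])
    interpret G: comm_group "val N K" by (rule ND(1)[OF K K])
    show "n = \<one>\<^bsub>val N K\<^esub> \<otimes>\<^bsub>val N K\<^esub> act N (ident C K) n" using n by (simp add: ND(2)[OF K K n])
    show "e0 = zero_arr C K E \<boxplus> e0 \<cdot> ident C K"
      using e0(1) add_zero_left[OF Ko E e0(1)] by (simp add: Hom_iff)
  qed
  have "partial_module_map C sz N E R'"
  proof (intro partial_module_map.intro additive_category_axioms partial_module_map_axioms.intro N E)
    fix L m e' assume "(L, m, e') \<in> R'"
    then obtain n' e f where R: "(L, n', e) \<in> R" and f: "f \<in> Hom C L K"
      and m: "m = n' \<otimes>\<^bsub>val N L\<^esub> act N f n" "e' = e \<boxplus> e0 \<cdot> f" using R'E by blast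
    have L: "compact_object sz C L" and n': "n' \<in> carrier (val N L)" and e: "e \<in> Hom C L E" using carr[OF R] by auto
    interpret G: comm_group "val N L" by (rule ND(1)[OF L L])
    show "compact_object sz C L \<and> m \<in> carrier (val N L) \<and> e' \<in> Hom C L E"
      using L n' act_closed[OF L K f n] add_Hom[OF compact_obj[OF L] E e comp_hom[OF f e0(1)]] m by simp
  next
    fix L m1 e1 m2 e2 assume a: "(L, m1, e1) \<in> R'" "(L, m2, e2) \<in> R'"
    obtain n1 d1 f1 where R1: "(L, n1, d1) \<in> R" and f1: "f1 \<in> Hom C L K"
      and m1: "m1 = n1 \<otimes>\<^bsub>val N L\<^esub> act N f1 n" "e1 = d1 \<boxplus> e0 \<cdot> f1" using R'E[OF a(1)] by blast
    obtain n2 d2 f2 where R2: "(L, n2, d2) \<in> R" and f2: "f2 \<in> Hom C L K"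
      and m2: "m2 = n2 \<otimes>\<^bsub>val N L\<^esub> act N f2 n" "e2 = d2 \<boxplus> e0 \<cdot> f2" using R'E[OF a(2)] by blast
    have L: "compact_object sz C L" and n: "n1 \<in> carrier (val N L)" "n2 \<in> carrier (val N L)"
      and d: "d1 \<in> Hom C L E" "d2 \<in> Hom C L E" using carr[OF R1] carr[OF R2] by auto
    interpret G: comm_group "val N L" by (rule ND(1)[OF L L])
    note Lo = compact_obj[OF L]
    interpret H: comm_group "hom_group C L E" by (rule hom_comm_group[OF Lo E])
    have af: "act N f1 n \<in> carrier (val N L)" "act N f2 n \<in> carrier (val N L)"
      using act_closed[OF L K _ \<open>n \<in> carrier (val N K)\<close>] f1 f2 by auto
    have ef: "e0 \<cdot> f1 \<in> Hom C L E" "e0 \<cdot> f2 \<in> Hom C L E" using comp_hom e0(1) f1 f2 by auto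
    show "(L, m1 \<otimes>\<^bsub>val N L\<^esub> m2, e1 \<boxplus> e2) \<in> R'"
    proof (rule R'I[OF add[OF R1 R2] add_Hom[OF Lo Ko f1 f2]])
      show "m1 \<otimes>\<^bsub>val N L\<^esub> m2 = n1 \<otimes>\<^bsub>val N L\<^esub> n2 \<otimes>\<^bsub>val N L\<^esub> act N (f1 \<boxplus> f2) n"
        using n af by (simp add: m1 m2 ND(4)[OF L K f1 f2 \<open>n \<in> carrier (val N K)\<close>] G.m_ac)
      show "e1 \<boxplus> e2 = d1 \<boxplus> d2 \<boxplus> e0 \<cdot> (f1 \<boxplus> f2)"
        unfolding m1 m2 comp_add_right[OF f1 f2 e0(1)] using d ef
        by (simp add: H.m_ac[unfolded hom_group_simps] H.m_closed[unfolded hom_group_simps])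
    qed
  next
    fix L m e' L' g assume a: "(L, m, e') \<in> R'" and L': "compact_object sz C L'" and g: "g \<in> Hom C L' L"
    obtain n' e f where R: "(L, n', e) \<in> R" and f: "f \<in> Hom C L K"
      and m: "m = n' \<otimes>\<^bsub>val N L\<^esub> act N f n" "e' = e \<boxplus> e0 \<cdot> f" using R'E[OF a] by blast
    have L: "compact_object sz C L" and n': "n' \<in> carrier (val N L)" and e: "e \<in> Hom C L E" using carr[OF R] by auto
    show "(L', act N g m, e' \<cdot> g) \<in> R'"
    proof (rule R'I[OF act[OF R L' g] comp_hom[OF g f]])
      show "act N g m = act N g n' \<otimes>\<^bsub>val N L'\<^esub> act N (f \<cdot> g) n"
        unfolding m ND(5)[OF L' L K g f n] using hom_mult[OF ND(3)[OF L' L g]] n' act_closed[OF L K f n] by simp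
      show "e' \<cdot> g = e \<cdot> g \<boxplus> e0 \<cdot> (f \<cdot> g)" unfolding m using e f g e0(1) by (simp add: Hom_iff)
    qed
  next
    fix L e' assume a: "(L, \<one>\<^bsub>val N L\<^esub>, e') \<in> R'"
    obtain n' e f where R: "(L, n', e) \<in> R" and f: "f \<in> Hom C L K"
      and m: "\<one>\<^bsub>val N L\<^esub> = n' \<otimes>\<^bsub>val N L\<^esub> act N f n" "e' = e \<boxplus> e0 \<cdot> f" using R'E[OF a] by blast
    have L: "compact_object sz C L" and n': "n' \<in> carrier (val N L)" and e: "e \<in> Hom C L E" using carr[OF R] by auto
    interpret G: comm_group "val N L" by (rule ND(1)[OF L L])
    note Lo = compact_obj[OF L]
    have "inv\<^bsub>val N L\<^esub> n' = act N f n"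
      using m(1) n' act_closed[OF L K f n] by (metis G.inv_equality G.m_comm)
    \<comment> \<open>A sum that is neutral in \<open>N\<close> puts the action of \<open>f\<close>
      on \<open>n\<close> into the domain of \<open>R\<close>, with value \<open>-e\<close>. The
      pair is thus in \<open>W\<close>, where \<open>e0\<close> is already known to agree with
      \<open>R\<close>.\<close>
    then have "(L, act N f n, neg C e) \<in> R" using inverse[OF R] by simp
    moreover have "src C f = L" using f by (simp add: Hom_iff)
    ultimately have "(f, neg C e) \<in> W" unfolding W_def using f by simp
    then have "neg C e = e0 \<cdot> f" using e0(2) by blast
    then show "e' = zero_arr C L E" using m(2) neg_right[OF Lo E e] by simp
  next
    fix L assume "compact_object sz C L"
    then show "(L, \<one>\<^bsub>val N L\<^esub>, zero_arr C L E) \<in> R'" using sub zero by blast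
  qed
  then show thesis using that sub mem by blast
qed

end

context additive_category
begin

lemma chain_Union_partial_module_map:
  fixes sz :: "'i itself" and N :: "('o, 'a, 'u) tc_module"
  assumes ne: "\<C> \<noteq> {}" and pm: "\<And>S. S \<in> \<C> \<Longrightarrow> partial_module_map C sz N E S"
    and ch: "\<And>S S'. \<lbrakk>S \<in> \<C>; S' \<in> \<C>\<rbrakk> \<Longrightarrow> S \<subseteq> S' \<or> S' \<subseteq> S"
  shows "partial_module_map C sz N E (\<Union>\<C>)"
proof -
  obtain S0 where S0: "S0 \<in> \<C>" using ne by blast
  show ?thesis
  proof (intro partial_module_map.intro additive_category_axioms partial_module_map_axioms.intro)
    show "is_tc_module sz C N" by (rule partial_module_map.N[OF pm[OF S0]])
    show "E \<in> obj C" by (rule partial_module_map.E[OF pm[OF S0]])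
    show "compact_object sz C K \<and> n \<in> carrier (val N K) \<and> e \<in> Hom C K E" if "(K, n, e) \<in> \<Union>\<C>" for K n e
      using that by (auto dest: partial_module_map.carr[OF pm])
    show "(K, n \<otimes>\<^bsub>val N K\<^esub> n', e \<boxplus> e') \<in> \<Union>\<C>" if "(K, n, e) \<in> \<Union>\<C>" "(K, n', e') \<in> \<Union>\<C>" for K n e n' e'
    proof -
      from that obtain S S' where "S \<in> \<C>" "S' \<in> \<C>" "(K, n, e) \<in> S" "(K, n', e') \<in> S'" by auto
      then obtain U where "U \<in> \<C>" "(K, n, e) \<in> U" "(K, n', e') \<in> U" using ch[of S S'] by auto
      then show ?thesis by (auto dest: partial_module_map.add[OF pm])
    qed
    show "(L, act N f n, e \<cdot> f) \<in> \<Union>\<C>" if "(K, n, e) \<in> \<Union>\<C>" "compact_object sz C L" "f \<in> Hom C L K" for K n e L f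
      using that by (auto dest: partial_module_map.act[OF pm])
    show "e = zero_arr C K E" if "(K, \<one>\<^bsub>val N K\<^esub>, e) \<in> \<Union>\<C>" for K e
      using that by (auto dest: partial_module_map.functional[OF pm])
    show "(K, \<one>\<^bsub>val N K\<^esub>, zero_arr C K E) \<in> \<Union>\<C>" if "compact_object sz C K" for K
      using S0 partial_module_map.zero[OF pm[OF S0] that] by blast
  qed
qed

text \<open>The argument of \<open>extends_to_hom\<close> for modules: a maximal graph is total,
  because every element of \<open>N\<close> at a compact object can be adjoined.\<close>

lemma baer_extension:
  fixes sz :: "'i itself" and N :: "('o, 'a, 'u) tc_module"
  assumes B: "baer sz C E" and R: "partial_module_map C sz N E R"
  obtains \<psi> where "is_tc_module_map sz C N (restricted_yoneda C E) \<psi>"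
    "\<And>K n e. (K, n, e) \<in> R \<Longrightarrow> \<psi> K n = e"
proof -
  let ?A = "{S. partial_module_map C sz N E S \<and> R \<subseteq> S}"
  have "\<exists>M\<in>?A. \<forall>X\<in>?A. M \<subseteq> X \<longrightarrow> X = M"
  proof (rule subset_Zorn_nonempty)
    show "?A \<noteq> {}" using R by auto
    fix \<C> assume C: "\<C> \<noteq> {}" "subset.chain ?A \<C>"
    then have sub: "partial_module_map C sz N E S" "R \<subseteq> S" if "S \<in> \<C>" for S
      using that by (auto simp: subset.chain_def)
    have "partial_module_map C sz N E (\<Union>\<C>)"
    proof (rule chain_Union_partial_module_map[OF C(1) sub(1)])
      show "S \<subseteq> S' \<or> S' \<subseteq> S" if "S \<in> \<C>" "S' \<in> \<C>" for S S'
        using C(2) that subset_chain_def[of ?A \<C>] by simp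
    qed
    then show "\<Union>\<C> \<in> ?A" using sub(2) C(1) by auto
  qed
  then obtain M where M: "partial_module_map C sz N E M" "R \<subseteq> M"
    and max: "\<And>X. partial_module_map C sz N E X \<Longrightarrow> M \<subseteq> X \<Longrightarrow> X = M"
    by (smt (verit) mem_Collect_eq subset_trans)
  interpret M: partial_module_map C sz N E M by (rule M)
  have tot: "\<exists>e. (K, n, e) \<in> M" if K: "compact_object sz C K" and n: "n \<in> carrier (val N K)" for K n
    using M.extend_by_element[OF B K n] max by metis
  define \<psi> where "\<psi> K n = (THE e. (K, n, e) \<in> M)" for K n
  have val: "\<psi> K n = e" if "(K, n, e) \<in> M" for K n e
    unfolding \<psi>_def using that M.single_valued by blast
  have mem: "(K, n, \<psi> K n) \<in> M" if K: "compact_object sz C K" and n: "n \<in> carrier (val N K)" for K n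
    using tot[OF K n] val by metis
  have "is_tc_module_map sz C N (restricted_yoneda C E) \<psi>"
    unfolding is_tc_module_map_def restricted_yoneda_def
  proof (intro conjI allI impI ballI; (elim conjE)?; simp)
    fix K assume K: "compact_object sz C K"
    show "\<psi> K \<in> hom (val N K) (hom_group C K E)"
    proof (rule homI)
      show "\<psi> K x \<in> carrier (hom_group C K E)" if "x \<in> carrier (val N K)" for x
        using M.carr[OF mem[OF K that]] by simp
      show "\<psi> K (x \<otimes>\<^bsub>val N K\<^esub> y) = \<psi> K x \<otimes>\<^bsub>hom_group C K E\<^esub> \<psi> K y"
        if "x \<in> carrier (val N K)" "y \<in> carrier (val N K)" for x y
        using val[OF M.add[OF mem[OF K that(1)] mem[OF K that(2)]]] by simp
    qed
  next
    fix K L f x assume K: "compact_object sz C K" and L: "compact_object sz C L" and f: "f \<in> Hom C K L"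
      and x: "x \<in> carrier (val N L)"
    show "\<psi> K (tc_module.act N f x) = \<psi> L x \<cdot> f" using M.act[OF mem[OF L x] K f] val by blast
  qed
  then show thesis using that val M(2) by blast
qed

lemma baer_pure_injective:
  fixes sz :: "'i itself" and vals :: "'u itself"
  assumes B: "baer sz C E" and E: "E \<in> obj C"
  shows "pure_injective sz vals C E"
  unfolding pure_injective_def injective_tc_module_def
proof (intro conjI allI impI E tc_module_restricted_yoneda[OF E]; elim conjE)
  fix M N :: "('o, 'a, 'u) tc_module" and j \<phi>
  assume M: "is_tc_module sz C M" and N: "is_tc_module sz C N" and j: "is_tc_module_map sz C M N j"
    and inj: "\<forall>K. compact_object sz C K \<longrightarrow> inj_on (j K) (carrier (val M K))"
    and \<phi>: "is_tc_module_map sz C M (restricted_yoneda C E) \<phi>"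
  have jh: "j K \<in> hom (val M K) (val N K)" "\<phi> K \<in> hom (val M K) (hom_group C K E)"
    if "compact_object sz C K" for K
    using j \<phi> that by (auto simp: is_tc_module_map_def restricted_yoneda_def)
  have jn: "j K (act M f x) = act N f (j L x)" "\<phi> K (act M f x) = \<phi> L x \<cdot> f"
    if "compact_object sz C K" "compact_object sz C L" "f \<in> Hom C K L" "x \<in> carrier (val M L)" for K L f x
    using j \<phi> that by (auto simp: is_tc_module_map_def restricted_yoneda_def)
  \<comment> \<open>The graph of \<open>\<phi>\<close> after the inverse of \<open>j\<close> on the
    image of \<open>j\<close>; it is functional because \<open>j\<close> is injective.\<close>
  define R where "R = {(K, j K m, \<phi> K m) | K m. compact_object sz C K \<and> m \<in> carrier (val M K)}"
  have RI: "(K, n, e) \<in> R" if "compact_object sz C K" "m \<in> carrier (val M K)" "n = j K m" "e = \<phi> K m" for K n e m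
    using that unfolding R_def by blast
  have RE: "\<exists>m. compact_object sz C K \<and> m \<in> carrier (val M K) \<and> n = j K m \<and> e = \<phi> K m" if "(K, n, e) \<in> R" for K n e
    using that unfolding R_def by blast
  have one: "j K \<one>\<^bsub>val M K\<^esub> = \<one>\<^bsub>val N K\<^esub>" "\<phi> K \<one>\<^bsub>val M K\<^esub> = zero_arr C K E" "\<one>\<^bsub>val M K\<^esub> \<in> carrier (val M K)"
    if K: "compact_object sz C K" for K
  proof -
    interpret m: comm_group "val M K" by (rule tc_moduleD(1)[OF M K K])
    interpret n: comm_group "val N K" by (rule tc_moduleD(1)[OF N K K])
    interpret h: comm_group "hom_group C K E" by (rule hom_comm_group[OF compact_obj[OF K] E])
    show "j K \<one>\<^bsub>val M K\<^esub> = \<one>\<^bsub>val N K\<^esub>" "\<phi> K \<one>\<^bsub>val M K\<^esub> = zero_arr C K E" "\<one>\<^bsub>val M K\<^esub> \<in> carrier (val M K)"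
      using hom_one[OF jh(1)[OF K] m.is_group n.is_group] hom_one[OF jh(2)[OF K] m.is_group h.is_group] by simp_all
  qed
  have "partial_module_map C sz N E R"
  proof (intro partial_module_map.intro additive_category_axioms partial_module_map_axioms.intro N E)
    fix K n e assume "(K, n, e) \<in> R"
    then obtain m where "compact_object sz C K" "m \<in> carrier (val M K)" "n = j K m" "e = \<phi> K m" using RE by blast
    then show "compact_object sz C K \<and> n \<in> carrier (val N K) \<and> e \<in> Hom C K E"
      using hom_in_carrier[OF jh(1)] hom_in_carrier[OF jh(2)] by auto
  next
    fix K n e n' e' assume a: "(K, n, e) \<in> R" "(K, n', e') \<in> R"
    obtain m where m: "compact_object sz C K" "m \<in> carrier (val M K)" "n = j K m" "e = \<phi> K m" using RE[OF a(1)] by blast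
    obtain m' where m': "m' \<in> carrier (val M K)" "n' = j K m'" "e' = \<phi> K m'" using RE[OF a(2)] by blast
    interpret m: comm_group "val M K" by (rule tc_moduleD(1)[OF M m(1) m(1)])
    show "(K, n \<otimes>\<^bsub>val N K\<^esub> n', e \<boxplus> e') \<in> R"
      by (rule RI[OF m(1) m.m_closed[OF m(2) m'(1)]])
        (use m m' hom_mult[OF jh(1)[OF m(1)]] hom_mult[OF jh(2)[OF m(1)]] in auto)
  next
    fix K n e L f assume a: "(K, n, e) \<in> R" and L: "compact_object sz C L" and f: "f \<in> Hom C L K"
    obtain m where m: "compact_object sz C K" "m \<in> carrier (val M K)" "n = j K m" "e = \<phi> K m" using RE[OF a(1)] by blast
    show "(L, act N f n, e \<cdot> f) \<in> R"
      by (rule RI[OF L hom_in_carrier[OF tc_moduleD(3)[OF M L m(1) f] m(2)]])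
        (use m jn[OF L m(1) f m(2)] in auto)
  next
    fix K e assume a: "(K, \<one>\<^bsub>val N K\<^esub>, e) \<in> R"
    obtain m where m: "compact_object sz C K" "m \<in> carrier (val M K)" "\<one>\<^bsub>val N K\<^esub> = j K m" "e = \<phi> K m" using RE[OF a] by blast
    have "m = \<one>\<^bsub>val M K\<^esub>"
      by (rule inj_onD[OF inj[rule_format, OF m(1)] _ m(2) one(3)[OF m(1)]]) (use m(3) one(1)[OF m(1)] in simp)
    then show "e = zero_arr C K E" using m(4) one(2)[OF m(1)] by simp
  next
    fix K assume K: "compact_object sz C K"
    show "(K, \<one>\<^bsub>val N K\<^esub>, zero_arr C K E) \<in> R" by (rule RI[OF K one(3)[OF K]]) (simp_all add: one[OF K])
  qed
  then obtain \<psi> where "is_tc_module_map sz C N (restricted_yoneda C E) \<psi>"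
    "\<And>K n e. (K, n, e) \<in> R \<Longrightarrow> \<psi> K n = e" using baer_extension[OF B] by blast
  then show "\<exists>\<psi>. is_tc_module_map sz C N (restricted_yoneda C E) \<psi> \<and>
      (\<forall>K. compact_object sz C K \<longrightarrow> (\<forall>x\<in>carrier (val M K). \<psi> K (j K x) = \<phi> K x))"
    using RI by blast
qed

end

section \<open>The Baer property of dual objects, and the duality triple\<close>

context brown_comenetz
begin

text \<open>
  The map prescribed on a subfunctor of \<open>Hom(-, K)\<close> induces a character of the subgroup of
  \<open>Hom(\<one>, X \<otimes> K)\<close> generated by the images of its members.  It is well defined because
  \<open>Hom(\<one>, X \<otimes> -)\<close> is homological and the fibre of a map of compact objects is compact.
\<close>

lemma baer_dual:
  fixes sz :: "'i itself"
  assumes X [simp]: "X \<in> obj C"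
  shows "baer sz C (dual X)"
  unfolding baer_def
proof (intro allI impI; elim conjE)
  fix K W assume K: "compact_object sz C K" and W: "partial_cyclic_map sz C (dual X) K W"
  note Ko [simp] = compact_obj[OF K]
  note W' = W[unfolded partial_cyclic_map_def]
  have WD: "compact_object sz C (src C f)" "f \<in> Hom C (src C f) K" "e \<in> Hom C (src C f) (dual X)"
    if "(f, e) \<in> W" for f e using W' that by simp_all
  have Wadd: "(f \<boxplus> f', e \<boxplus> e') \<in> W" if "(f, e) \<in> W" "(f', e') \<in> W" "src C f = src C f'" for f e f' e'
    using W' that by simp
  have Wcomp: "(f \<cdot> g, e \<cdot> g) \<in> W" if "(f, e) \<in> W" "compact_object sz C L" "g \<in> Hom C L (src C f)" for f e L g
    using W' that by metis
  have Wfun: "e = zero_arr C L (dual X)" if "(zero_arr C L K, e) \<in> W" "L \<in> obj C" for L e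
    using W' that by metis
  have Wzero: "(zero_arr C K K, zero_arr C K (dual X)) \<in> W" using W' by simp
  let ?G = "hom_group C (unit C) (X \<boxtimes> K)"
  interpret G: comm_group ?G by (rule hom_comm_group) simp_all
  interpret Q: comm_group QZ by (rule comm_group_QZ)
  \<comment> \<open>The graph of the character sought: if \<open>e0\<close> with
    \<open>e = e0 f\<close> exists, its character takes at the image of \<open>h\<close> under
    \<open>f\<close> the value of \<open>e\<close> at \<open>h\<close>.\<close>
  define R where "R = {((ident C X \<star> f) \<cdot> h, r X (src C f) e h) | f e h.
    (f, e) \<in> W \<and> h \<in> global (X \<boxtimes> src C f)}"
  have RI: "(x, q) \<in> R" if "(f, e) \<in> W" "src C f = L" "h \<in> global (X \<boxtimes> L)"
    "x = (ident C X \<star> f) \<cdot> h" "q = r X L e h" for f e h x q L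
    using that unfolding R_def by blast
  have RE: "\<exists>f e h. (f, e) \<in> W \<and> h \<in> global (X \<boxtimes> src C f) \<and> x = (ident C X \<star> f) \<cdot> h \<and> q = r X (src C f) e h"
    if "(x, q) \<in> R" for x q using that unfolding R_def by blast
  have push: "(ident C X \<star> f) \<cdot> h \<in> global (X \<boxtimes> K)" if "f \<in> Hom C L K" "h \<in> global (X \<boxtimes> L)" for f L h
    using that by (simp add: Hom_iff)
  have "subgroup R (?G \<times>\<times> QZ)"
  proof
    show "R \<subseteq> carrier (?G \<times>\<times> QZ)"
    proof clarify
      fix x q assume "(x, q) \<in> R"
      then obtain f e h where a: "(f, e) \<in> W" "h \<in> global (X \<boxtimes> src C f)" "x = (ident C X \<star> f) \<cdot> h" "q = r X (src C f) e h"
        using RE by blast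
      show "(x, q) \<in> carrier (?G \<times>\<times> QZ)"
        using push[OF WD(2)[OF a(1)] a(2)] r_closed[OF WD(3)[OF a(1)] X a(2)] a by simp
    qed
  next
    fix p p' assume p: "p \<in> R" "p' \<in> R"
    obtain x q x' q' where pp: "p = (x, q)" "p' = (x', q')" by fastforce
    obtain f e h where a: "(f, e) \<in> W" "h \<in> global (X \<boxtimes> src C f)" "x = (ident C X \<star> f) \<cdot> h" "q = r X (src C f) e h"
      using RE p(1) pp by blast
    obtain f' e' h' where a': "(f', e') \<in> W" "h' \<in> global (X \<boxtimes> src C f')" "x' = (ident C X \<star> f') \<cdot> h'"
      "q' = r X (src C f') e' h'" using RE p(2) pp by blast
    define L L' where "L = src C f" and "L' = src C f'"
    note f = WD[OF a(1), folded L_def] and f' = WD[OF a'(1), folded L'_def]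
    note Lo [simp] = compact_obj[OF f(1)] compact_obj[OF f'(1)]
    \<comment> \<open>The two members may have different sources. Passing to the biproduct combines
      them into one pair \<open>(f s + f' t, e s + e' t)\<close> of \<open>W\<close>, so
      \<open>R\<close> is closed under products without generating a larger subgroup.\<close>
    obtain P i j s t where P: "P \<in> obj C" and i: "i \<in> Hom C L P" and j: "j \<in> Hom C L' P" and s: "s \<in> Hom C P L"
      and t: "t \<in> Hom C P L'" and e1: "s \<cdot> i = ident C L" "t \<cdot> j = ident C L'" "s \<cdot> j = zero_arr C L' L"
      "t \<cdot> i = zero_arr C L L'" "(i \<cdot> s) \<boxplus> (j \<cdot> t) = ident C P"
      using obtain_biproduct[OF Lo] by metis
    have cP: "compact_object sz C P" by (rule compact_biproduct[OF f(1) f'(1) P i j s t e1(5)])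
    note [simp] = P
    have [simp]: "i \<in> arr C" "src C i = L" "tgt C i = P" "j \<in> arr C" "src C j = L'" "tgt C j = P"
      "s \<in> arr C" "src C s = P" "tgt C s = L" "t \<in> arr C" "src C t = P" "tgt C t = L'"
      "f \<in> arr C" "src C f = L" "tgt C f = K" "f' \<in> arr C" "src C f' = L'" "tgt C f' = K"
      "e \<in> arr C" "src C e = L" "tgt C e = dual X" "e' \<in> arr C" "src C e' = L'" "tgt C e' = dual X"
      using i j s t f f' by (auto simp: Hom_iff)
    have H [simp]: "h \<in> arr C" "src C h = unit C" "tgt C h = X \<boxtimes> L" "h' \<in> arr C" "src C h' = unit C" "tgt C h' = X \<boxtimes> L'"
      using a(2) a'(2) by (auto simp: Hom_iff)
    let ?f = "f \<cdot> s \<boxplus> f' \<cdot> t" and ?e = "e \<cdot> s \<boxplus> e' \<cdot> t"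
    let ?a = "(ident C X \<star> i) \<cdot> h" and ?b = "(ident C X \<star> j) \<cdot> h'"
    have w: "(?f, ?e) \<in> W"
      by (rule Wadd[OF Wcomp[OF a(1) cP] Wcomp[OF a'(1) cP]]) (simp_all add: Hom_iff)
    have d: "d \<cdot> s \<boxplus> d' \<cdot> t \<in> Hom C P Z" "(d \<cdot> s \<boxplus> d' \<cdot> t) \<cdot> i = d" "(d \<cdot> s \<boxplus> d' \<cdot> t) \<cdot> j = d'"
      if "d \<in> Hom C L Z" "d' \<in> Hom C L' Z" for d d' Z
    proof -
      have [simp]: "Z \<in> obj C" "d \<in> arr C" "src C d = L" "tgt C d = Z" "d' \<in> arr C" "src C d' = L'" "tgt C d' = Z"
        using that Hom_obj(2)[OF that(1)] by (auto simp: Hom_iff)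
      show "d \<cdot> s \<boxplus> d' \<cdot> t \<in> Hom C P Z" by (simp add: Hom_iff)
      show "(d \<cdot> s \<boxplus> d' \<cdot> t) \<cdot> i = d" "(d \<cdot> s \<boxplus> d' \<cdot> t) \<cdot> j = d'"
        using add_zero_left[of L' Z d'] add_zero_right[of L Z d] that by (simp_all add: e1)
    qed
    note df = d[OF f(2) f'(2)] and de = d[OF f(3) f'(3)]
    have ab: "?a \<in> global (X \<boxtimes> P)" "?b \<in> global (X \<boxtimes> P)" by (simp_all add: Hom_iff)
    have "p \<otimes>\<^bsub>?G \<times>\<times> QZ\<^esub> p' = (x \<boxplus> x', q \<otimes>\<^bsub>QZ\<^esub> q')" by (simp add: pp)
    moreover have "(x \<boxplus> x', q \<otimes>\<^bsub>QZ\<^esub> q') \<in> R"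
    proof (rule RI[OF w])
      show "src C ?f = P" by simp
      show "?a \<boxplus> ?b \<in> global (X \<boxtimes> P)" using add_Hom[OF _ _ ab] by simp
      have "(ident C X \<star> ?f) \<cdot> (?a \<boxplus> ?b) = (ident C X \<star> (?f \<cdot> i)) \<cdot> h \<boxplus> (ident C X \<star> (?f \<cdot> j)) \<cdot> h'"
        by (simp add: tensor_comp' del: comp_distrib_right flip: comp_assoc')
      then show "x \<boxplus> x' = (ident C X \<star> ?f) \<cdot> (?a \<boxplus> ?b)"
        unfolding df(2,3) a(3) a'(3) by simp
      have "r X P ?e (?a \<boxplus> ?b) = r X P ?e ?a \<otimes>\<^bsub>QZ\<^esub> r X P ?e ?b"
        by (rule r_add_right[OF de(1) X ab])
      also have "r X P ?e ?a = r X L (?e \<cdot> i) h"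
        by (rule r_nat_right[OF X i de(1), symmetric]) (simp add: Hom_iff)
      also have "r X P ?e ?b = r X L' (?e \<cdot> j) h'"
        by (rule r_nat_right[OF X j de(1), symmetric]) (simp add: Hom_iff)
      finally show "q \<otimes>\<^bsub>QZ\<^esub> q' = r X P ?e (?a \<boxplus> ?b)"
        unfolding de(2,3) a(4) a'(4) by simp
    qed
    ultimately show "p \<otimes>\<^bsub>?G \<times>\<times> QZ\<^esub> p' \<in> R" by simp
  next
    have z: "zero_arr C (unit C) (X \<boxtimes> K) \<in> global (X \<boxtimes> K)" by (simp add: Hom_iff)
    show "\<one>\<^bsub>?G \<times>\<times> QZ\<^esub> \<in> R"
      unfolding one_DirProd
    proof (rule RI[OF Wzero _ z])
      show "\<one>\<^bsub>?G\<^esub> = (ident C X \<star> zero_arr C K K) \<cdot> zero_arr C (unit C) (X \<boxtimes> K)" by simp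
      show "\<one>\<^bsub>QZ\<^esub> = r X K (zero_arr C K (dual X)) (zero_arr C (unit C) (X \<boxtimes> K))"
        using r_zero_left[OF X Ko z] by simp
    qed simp
  next
    fix p assume p: "p \<in> R"
    obtain x q where pp: "p = (x, q)" by fastforce
    obtain f e h where a: "(f, e) \<in> W" "h \<in> global (X \<boxtimes> src C f)" "x = (ident C X \<star> f) \<cdot> h" "q = r X (src C f) e h"
      using RE p pp by blast
    define L where "L = src C f"
    note f = WD[OF a(1), folded L_def]
    note Lo [simp] = compact_obj[OF f(1)]
    have h: "h \<in> global (X \<boxtimes> L)" using a(2) by (simp add: L_def)
    have nh: "neg C h \<in> global (X \<boxtimes> L)" using neg_Hom[OF _ _ h] by simp
    interpret H: comm_group "hom_group C (unit C) (X \<boxtimes> L)" by (rule hom_comm_group) simp_all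
    interpret rh: group_hom "hom_group C (unit C) (X \<boxtimes> L)" QZ "r X L e"
      using r_hom[OF f(3) X] by unfold_locales
    \<comment> \<open>The inverse of a member is realised by the same pair of \<open>W\<close>, with
      \<open>h\<close> negated.\<close>
    have "r X L e (neg C h) = inv\<^bsub>QZ\<^esub> q"
      using rh.hom_inv[of h] h a(4) by (simp add: inv_hom_group L_def)
    moreover have "(ident C X \<star> f) \<cdot> neg C h = neg C x"
      using f(2) h a(3) by (simp add: Hom_iff)
    moreover have x: "x \<in> global (X \<boxtimes> K)" using push[OF f(2) h] a(3) by simp
    moreover have "q \<in> carrier QZ" using r_closed[OF f(3) X h] a(4) by (simp add: L_def)
    ultimately have "inv\<^bsub>?G \<times>\<times> QZ\<^esub> p = ((ident C X \<star> f) \<cdot> neg C h, r X L e (neg C h))"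
      by (simp add: pp inv_hom_group G.is_group Q.is_group)
    then show "inv\<^bsub>?G \<times>\<times> QZ\<^esub> p \<in> R" using RI[OF a(1) L_def[symmetric] nh refl refl] by simp
  qed
  moreover have "q = \<one>\<^bsub>QZ\<^esub>" if R1: "(\<one>\<^bsub>?G\<^esub>, q) \<in> R" for q
  proof -
    obtain f e h where a: "(f, e) \<in> W" "h \<in> global (X \<boxtimes> src C f)" "\<one>\<^bsub>?G\<^esub> = (ident C X \<star> f) \<cdot> h" "q = r X (src C f) e h"
      using RE[OF R1] by blast
    define L where "L = src C f"
    note f = WD[OF a(1), folded L_def]
    obtain F g k where tr: "is_triangle C F L K g f k" using fibre_exists[OF f(2)] .
    have F: "compact_object sz C F" by (rule compact_fibre[OF K f(1) tr])
    note Fo [simp] = compact_obj[OF F]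
    note g = triangleD(1)[OF tr]
    obtain w where w: "w \<in> global (X \<boxtimes> F)" "(ident C X \<star> g) \<cdot> w = h"
      using tensor_homological[OF tr X a(2)[folded L_def]] a(3) by auto
    have "f \<cdot> g = zero_arr C F K" using triangle_comp_zero[OF tr] .
    \<comment> \<open>The restriction of \<open>(f, e)\<close> along \<open>g\<close> is a member of
      \<open>W\<close> over the zero arrow, so \<open>e\<close> vanishes on \<open>g\<close>. As
      \<open>h\<close> comes from \<open>w\<close> on the fibre, so does the value
      \<open>q\<close>.\<close>
    then have "(zero_arr C F K, e \<cdot> g) \<in> W" using Wcomp[OF a(1) F g[unfolded L_def]] by simp
    then have eg: "e \<cdot> g = zero_arr C F (dual X)" using Wfun by simp
    have "q = r X F (e \<cdot> g) w"
      using r_nat_right[OF X g f(3) w(1)] w(2) a(4) by (simp add: L_def)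
    then show ?thesis unfolding eg using r_zero_left[OF X Fo w(1)] by simp
  qed
  ultimately have "partial_hom ?G QZ R"
    using G.comm_group_axioms comm_group_QZ by (simp add: partial_hom_def)
  then obtain \<chi> where \<chi>: "\<chi> \<in> hom ?G QZ" "\<And>x q. (x, q) \<in> R \<Longrightarrow> \<chi> x = q"
    using partial_hom.extends_to_hom[OF _ divisible_QZ] by metis
  obtain e0 where e0: "e0 \<in> Hom C K (dual X)" "\<And>u. u \<in> global (X \<boxtimes> K) \<Longrightarrow> r X K e0 u = \<chi> u"
    using r_surj[OF X Ko \<chi>(1)] by blast
  have "e = e0 \<cdot> f" if fe: "(f, e) \<in> W" for f e
  proof (rule r_eqI[OF WD(3)[OF fe] comp_hom[OF WD(2)[OF fe] e0(1)] X])
    fix h assume h: "h \<in> global (X \<boxtimes> src C f)"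
    have "r X (src C f) (e0 \<cdot> f) h = r X K e0 ((ident C X \<star> f) \<cdot> h)"
      by (rule r_nat_right[OF X WD(2)[OF fe] e0(1) h])
    also have "\<dots> = \<chi> ((ident C X \<star> f) \<cdot> h)" by (rule e0(2)[OF push[OF WD(2)[OF fe] h]])
    also have "\<dots> = r X (src C f) e h" by (rule \<chi>(2)[OF RI[OF fe refl h refl refl]])
    finally show "r X (src C f) e h = r X (src C f) (e0 \<cdot> f) h" by simp
  qed
  with e0(1) show "\<exists>e0\<in>Hom C K (dual X). \<forall>f e. (f, e) \<in> W \<longrightarrow> e = e0 \<cdot> f" by blast
qed

lemma half_duality_dual:
  fixes sz :: "'i itself" and vals :: "'u itself"
  assumes rigid: "\<And>K. compact_object sz C K \<Longrightarrow> rigid_object C K"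
  shows "half_duality sz vals C C I I bidual bidual"
  unfolding half_duality_def
proof (intro conjI allI ballI impI)
  show "exact_contravariant_functor C C I" by (rule dual_exact)
  show "pure_injective sz vals C (dual X)" if "X \<in> obj C" for X
    by (rule baer_pure_injective[OF baer_dual[OF that] dual_obj[OF that]])
  show "pure_mono sz C X (dual (dual X)) (bidual X)" if "X \<in> obj C" for X
    by (rule pure_monoI[OF bidual(1)[OF that] bidual_mono[OF rigid]])
  show "is_product C J (\<lambda>j. dual (X j)) (dual P) (\<lambda>j. dual_arr (\<iota> j))"
    if "small sz J \<and> (\<forall>j\<in>J. X j \<in> obj C) \<and> is_coproduct C J X P \<iota>" for J :: "'i set" and X P \<iota>
    using dual_coproduct that by blast
qed (simp_all add: bidual(1) bidual_natural bidual_triangle)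

end

theorem proposition3p13:
  fixes T :: "('o, 'a) tt_category"
    and I :: "('o, 'a, 'o, 'a) functr"
  assumes "big_tt_category TYPE('i) T"
    and "brown_comenetz_dual T I"
  shows "duality_triple TYPE('i) TYPE('u) T T I I"
proof -
  have T: "tt_category T" "compactly_generated TYPE('i) T"
    and rigid: "\<And>K. compact_object TYPE('i) T K \<Longrightarrow> rigid_object T K"
    using assms(1) by (auto simp: big_tt_category_def compact_object_def rigid_object_def)
  obtain r where "brown_comenetz T I r"
  proof -
    from assms(2)[unfolded brown_comenetz_dual_def, THEN conjunct2] obtain r where
      r: "\<forall>X \<in> obj T. \<forall>Y \<in> obj T. r X Y \<in> iso (hom_group T Y (fobj I X))
             (character_group (hom_group T (unit T) (X \<boxtimes>\<^bsub>T\<^esub> Y)))"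
        "\<forall>X \<in> obj T. \<forall>Y Y'. \<forall>k \<in> Hom T Y' Y. \<forall>g \<in> Hom T Y (fobj I X).
           \<forall>u \<in> Hom T (unit T) (X \<boxtimes>\<^bsub>T\<^esub> Y'). r X Y' (g \<cdot>\<^bsub>T\<^esub> k) u = r X Y g ((ident T X \<star>\<^bsub>T\<^esub> k) \<cdot>\<^bsub>T\<^esub> u)"
        "\<forall>Y \<in> obj T. \<forall>X X'. \<forall>f \<in> Hom T X X'. \<forall>g \<in> Hom T Y (fobj I X').
           \<forall>u \<in> Hom T (unit T) (X \<boxtimes>\<^bsub>T\<^esub> Y). r X Y (farr I f \<cdot>\<^bsub>T\<^esub> g) u = r X' Y g ((f \<star>\<^bsub>T\<^esub> ident T Y) \<cdot>\<^bsub>T\<^esub> u)"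
      by (elim exE conjE)
    have "brown_comenetz T I r"
    proof (intro brown_comenetz.intro brown_comenetz_axioms.intro T(1))
      show "contravariant_functor T T I" using assms(2) by (simp add: brown_comenetz_dual_def)
    qed (use r in simp_all)
    with that show thesis .
  qed
  \<comment> \<open>Both functors and both families of units coincide, so a single
    \<open>half_duality\<close> gives the conditions in both directions.\<close>
  then show ?thesis
    using T(2) brown_comenetz.half_duality_dual[OF _ rigid] unfolding duality_triple_def by blast
qed

end
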